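(* Let $n=2$, let $\Omega\subset\mathbb{R}^2$ be a $C^{1,\mathrm{DMO}}$ domain with $0\in\partial\Omega$ and $\Omega\cap B_1$ simply connected, and let $u$ be a nontrivial (i.e. not identically zero) solution of $$\Delta u=0\ \text{ in } \Omega\cap B_1,\qquad u=0\ \text{ on } \partial\Omega\cap B_1,$$ the boundary values being attained continuously. Then $$\mathcal H^{n-2}\big(C(u)\cap\overline\Omega\cap B_{1/2}\big)=\mathcal H^{0}\big(C(u)\cap\overline\Omega\cap B_{1/2}\big)<\infty,$$ that is, the critical set $C(u)=\{|\nabla u|=0\}$ has only finitely many points in $\overline\Omega\cap B_{1/2}$.
   Context: Notation: $B_r=\{z=(x,y)\in\mathbb{R}^2:|z|<r\}$; $\mathcal H^0$ is the counting measure. $C^{1,\mathrm{DMO}}$ domain ($C^1$ with Dini mean oscillations), planar case: the boundary is locally parametrized as $$\Omega\cap B_1=\{y>\varphi(x)\}\cap B_1,\qquad \partial\Omega\cap B_1=\{y=\varphi(x)\}\cap B_1,$$ where $\varphi\in C^1([-1,1])$, $\varphi(0)=0$, $\varphi'(0)=0$, and the function $$\eta(r)=\sup_{x_0\in(-1,1)}\ \frac{1}{|I_r(x_0)|}\int_{I_r(x_0)}\big|\varphi'(x)-\langle\varphi'\rangle_{x_0,r}\big|\,dx,\qquad \langle\varphi'\rangle_{x_0,r}=\frac{1}{|I_r(x_0)|}\int_{I_r(x_0)}\varphi'(x)\,dx,$$ with $I_r(x_0)=(x_0-r,x_0+r)\cap(-1,1)$, is a Dini function, i.e. $\int_0^1\frac{\eta(r)}{r}\,dr<\infty$.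 For such domains, solutions $u$ as in the claim belong to $C^1_{\mathrm{loc}}(\overline\Omega\cap B_1)$; at points of $\partial\Omega\cap B_1$, $\nabla u$ denotes the continuous extension of the gradient from the interior. *)

theory Defs
  imports "HOL-Analysis.Analysis"
begin

text \<open>The plane is the type \<^typ>\<open>complex\<close>, a point \<open>(x, y)\<close> being the complex number
  with real part \<open>x\<close> and imaginary part \<open>y\<close>; its norm and inner product are the Euclidean ones.\<close>

section \<open>Harmonic functions and their critical points\<close>

definition gradient :: "('a::real_inner \<Rightarrow> real) \<Rightarrow> 'a \<Rightarrow> 'a"
  where "gradient u z = (THE D. GDERIV u z :> D)"

definition C2_on :: "'a::euclidean_space set \<Rightarrow> ('a \<Rightarrow> real) \<Rightarrow> bool"
  where "C2_on S u \<longleftrightarrow>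
    (\<forall>z\<in>S. u differentiable (at z)) \<and>
    (\<forall>z\<in>S. gradient u differentiable (at z)) \<and>
    (\<forall>h. continuous_on S (\<lambda>z. frechet_derivative (gradient u) (at z) h))"

text \<open>The Laplacian is the divergence of the gradient.\<close>

definition laplacian :: "('a::euclidean_space \<Rightarrow> real) \<Rightarrow> 'a \<Rightarrow> real"
  where "laplacian u z = (\<Sum>b\<in>Basis. frechet_derivative (gradient u) (at z) b \<bullet> b)"

definition harmonic_on :: "'a::euclidean_space set \<Rightarrow> ('a \<Rightarrow> real) \<Rightarrow> bool"
  where "harmonic_on S u \<longleftrightarrow> C2_on S u \<and> (\<forall>z\<in>S. laplacian u z = 0)"

text \<open>At a frontier point the gradient is understood as its limit from inside \<open>S\<close>; the point is
  critical when that limit is \<open>0\<close>. Lemma \<open>critical_set_eq_extension\<close> below identifies the result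
  with the zero set of the continuous extension of the gradient.\<close>

definition critical_set :: "'a::real_inner set \<Rightarrow> ('a \<Rightarrow> real) \<Rightarrow> 'a set"
  where "critical_set S u =
    {z \<in> S. gradient u z = 0} \<union> {z \<in> frontier S. (gradient u \<longlongrightarrow> 0) (at z within S)}"

lemma critical_set_eq_extension:
  fixes S V :: "'a::real_inner set"
  assumes "open S" "open V"
    and cont: "continuous_on (closure S \<inter> V) G"
    and ext: "\<And>z. z \<in> S \<inter> V \<Longrightarrow> G z = gradient u z"
  shows "critical_set S u \<inter> V = {z \<in> closure S \<inter> V. G z = 0}"
proof -
  have front: "(gradient u \<longlongrightarrow> 0) (at z within S) \<longleftrightarrow> G z = 0"
    if z: "z \<in> frontier S" "z \<in> V" for z
  proof -
    from z assms(1) have zc: "z \<in> closure S" "z \<notin> S"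
      by (auto simp: frontier_def interior_open)
    then have "z islimpt S" by (simp add: closure_def)
    then have nontriv: "at z within S \<noteq> bot" by (simp add: trivial_limit_within)
    have "(G \<longlongrightarrow> G z) (at z within (closure S \<inter> V))"
      using cont zc z(2) by (simp add: continuous_on_def)
    then have "(G \<longlongrightarrow> G z) (at z within (S \<inter> V))"
      by (rule tendsto_within_subset) (use closure_subset in blast)
    then have "(G \<longlongrightarrow> G z) (at z within S)"
      using assms(2) z(2) at_within_nhd[of z V "S \<inter> V" S] by auto
    moreover have "eventually (\<lambda>w. G w = gradient u w) (at z within S)"
      unfolding eventually_at_topological using assms(2) z(2) ext by blast
    ultimately have "(gradient u \<longlongrightarrow> G z) (at z within S)"
      using tendsto_cong by blast
    then show ?thesis using tendsto_unique[OF nontriv] by metis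
  qed
  have "closure S = S \<union> frontier S" "S \<inter> frontier S = {}"
    using closure_subset[of S] assms(1) by (auto simp: frontier_def interior_open)
  with front ext show ?thesis
    unfolding critical_set_def by auto
qed

section \<open>Domains of class \<open>C\<^sup>1\<close> with Dini mean oscillations\<close>

definition mean_over :: "real set \<Rightarrow> (real \<Rightarrow> real) \<Rightarrow> real"
  where "mean_over I f = integral I f / measure lborel I"

definition window :: "real \<Rightarrow> real \<Rightarrow> real set"
  where "window x\<^sub>0 r = {x\<^sub>0 - r<..<x\<^sub>0 + r} \<inter> {-1<..<1}"

definition mean_oscillation :: "(real \<Rightarrow> real) \<Rightarrow> real \<Rightarrow> real"
  where "mean_oscillation g r =
    (SUP x\<^sub>0\<in>{-1<..<1}. mean_over (window x\<^sub>0 r) (\<lambda>x. \<bar>g x - mean_over (window x\<^sub>0 r) g\<bar>))"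

text \<open>The derivative \<open>g\<close> of the profile is one-sided at the endpoints of \<open>[-1, 1]\<close>.\<close>

definition C1_DMO_profile :: "(real \<Rightarrow> real) \<Rightarrow> bool"
  where "C1_DMO_profile \<phi> \<longleftrightarrow>
    (\<exists>g. (\<forall>x\<in>{-1..1}. (\<phi> has_real_derivative g x) (at x within {-1..1})) \<and>
         continuous_on {-1..1} g \<and> \<phi> 0 = 0 \<and> g 0 = 0 \<and>
         set_integrable lborel {0<..<1} (\<lambda>r. mean_oscillation g r / r))"

definition C1_DMO_graph :: "complex set \<Rightarrow> bool"
  where "C1_DMO_graph \<Omega> \<longleftrightarrow>
    (\<exists>\<phi>. C1_DMO_profile \<phi> \<and>
         \<Omega> \<inter> ball 0 1 = {z. Im z > \<phi> (Re z)} \<inter> ball 0 1 \<and>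
         frontier \<Omega> \<inter> ball 0 1 = {z. Im z = \<phi> (Re z)} \<inter> ball 0 1)"

text \<open>The boundary inside \<open>U\<close> is covered by balls in which \<open>\<Omega>\<close> has the normalised graph form
  after a translation, rotation and dilation: \<open>w \<mapsto> c + s * w\<close> maps the unit ball onto the ball of
  radius \<open>\<bar>s\<bar>\<close> about \<open>c\<close>. One such ball may cover all of the boundary inside \<open>U\<close>, so for
  \<open>U = ball 0 1\<close> a single normalised graph over \<open>[-1, 1]\<close> (\<open>c = 0\<close>, \<open>s = 1\<close>) is allowed.\<close>

definition C1_DMO_domain_in :: "complex set \<Rightarrow> complex set \<Rightarrow> bool"
  where "C1_DMO_domain_in U \<Omega> \<longleftrightarrow> open \<Omega> \<and> connected \<Omega> \<and>
    (\<forall>p\<in>frontier \<Omega> \<inter> U. \<exists>c s. p \<in> ball c (norm s) \<and> C1_DMO_graph {w. c + s * w \<in> \<Omega>})"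

lemma C1_DMO_graph_imp_domain_in:
  assumes "open \<Omega>" "connected \<Omega>" "C1_DMO_graph \<Omega>"
  shows "C1_DMO_domain_in (ball 0 1) \<Omega>"
  unfolding C1_DMO_domain_in_def
proof (intro conjI ballI)
  fix p assume "p \<in> frontier \<Omega> \<inter> ball 0 1"
  then have "p \<in> ball 0 (norm (1::complex)) \<and> C1_DMO_graph {w. 0 + 1 * w \<in> \<Omega>}"
    using assms(3) by simp
  then show "\<exists>c s. p \<in> ball c (norm s) \<and> C1_DMO_graph {w. c + s * w \<in> \<Omega>}" by blast
qed (use assms in auto)

section \<open>The Dirichlet problem near a boundary piece\<close>

text \<open>Only the values of \<open>u\<close> on \<open>closure \<Omega> \<inter> U\<close> matter; continuity there says that the
  boundary values are attained continuously.\<close>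

definition dirichlet_solution :: "complex set \<Rightarrow> complex set \<Rightarrow> (complex \<Rightarrow> real) \<Rightarrow> bool"
  where "dirichlet_solution U \<Omega> u \<longleftrightarrow>
    harmonic_on (\<Omega> \<inter> U) u \<and> continuous_on (closure \<Omega> \<inter> U) u \<and>
    (\<forall>z\<in>frontier \<Omega> \<inter> U. u z = 0)"

end

theory Submission
  imports Defs "HOL-Complex_Analysis.Complex_Analysis"
begin

text \<open>On the simply connected set \<open>S = \<Omega> \<inter> B\<^sub>1\<close> write \<open>u = Im f\<close> with \<open>f\<close> holomorphic, so
  that the critical points in \<open>S\<close> are the zeros of \<open>f'\<close>, and let \<open>g\<close> map \<open>S\<close> conformally onto the
  disc. Near a boundary point \<open>\<Omega>\<close> lies above a Lipschitz graph, where a square root barrier bounds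
  \<open>1 - \<bar>g\<bar>\<close> by the square root of the distance to the boundary. Hence \<open>g\<close> is Hoelder continuous up
  to the graph, its inverse \<open>G\<close> is continuous at the image points, and \<open>Im (f \<circ> G)\<close> vanishes on an
  arc of the circle, across which \<open>f \<circ> G\<close> extends by reflection. The zeros of the derivative of the
  extension are isolated. They account for all critical points inside \<open>\<Omega>\<close>, and near every other
  boundary point \<open>u\<close> has a constant sign.

  At such a point Hopf's lemma excludes that the gradient tends to \<open>0\<close>. It holds although the slope
  of the graph need not be Dini continuous: Dini mean oscillation makes the changes of the mean
  slope between consecutive dyadic scales summable, and this suffices to build an explicit
  holomorphic function, comparable with \<open>z\<close>, whose imaginary part is a barrier.\<close>

section \<open>The maximum principle and harmonic functions in the plane\<close>

text \<open>The extended derivative says nothing direct about the gradient of \<open>u\<close> at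
  the boundary: the conformal map need have neither a bounded nor a nonvanishing derivative there.
  Reflection therefore only confines the boundary points near which \<open>u\<close> is not
  one-signed to a finite set; the other points are treated in the original coordinates, by Hopf's
  lemma. Nothing is known about the frontier of \<open>\<Omega> \<inter> ball 0 1\<close> on the
  unit circle, so every boundary estimate for the conformal map is local to a small disc, rescaled
  to unit size, in which the domain is an epigraph. A C^1 boundary alone admits failures of Hopf's
  lemma, because the conjugate of the boundary angle may be unbounded. Here one line fits the graph
  on both sides of the point at each dyadic scale. The deviation of its angle from the limit is even
  in x and cancels in the conjugate function up to its increments from scale to scale; the error of
  the fit may differ on the two sides, and it is summable. Both are realised by a series of simple
  fractions with poles below the graph.\<close>

lemma closed_superlevel_set:
  fixes \<phi> :: "'a::metric_space \<Rightarrow> real"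
  assumes cont: "continuous_on S \<phi>" and "closed T"
    and fr: "\<And>\<xi>. \<xi> \<in> closure S \<Longrightarrow> \<xi> \<in> T \<Longrightarrow> \<xi> \<notin> S \<Longrightarrow> \<forall>\<^sub>F z in at \<xi> within S. \<phi> z < c"
  shows "closed {z \<in> S \<inter> T. c \<le> \<phi> z}"
  unfolding closed_limpt
proof (intro allI impI)
  fix w assume lim: "w islimpt {z \<in> S \<inter> T. c \<le> \<phi> z}"
  have wT: "w \<in> T"
    using islimpt_subset[OF lim, of T] \<open>closed T\<close> closed_limpt by blast
  have wS: "w \<in> closure S"
    using islimpt_subset[OF lim, of S] by (auto simp: closure_def)
  show "w \<in> {z \<in> S \<inter> T. c \<le> \<phi> z}"
  proof (rule ccontr)
    assume nK: "w \<notin> {z \<in> S \<inter> T. c \<le> \<phi> z}"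
    have "\<forall>\<^sub>F v in at w within S. \<phi> v < c"
    proof (cases "w \<in> S")
      case True
      then have "\<phi> w < c" using nK wT by auto
      moreover have "(\<phi> \<longlongrightarrow> \<phi> w) (at w within S)" using cont True by (simp add: continuous_on_def)
      ultimately show ?thesis by (simp add: order_tendstoD)
    qed (use fr wS wT in blast)
    then obtain V where "open V" "w \<in> V" "\<forall>v\<in>V. v \<noteq> w \<longrightarrow> v \<in> S \<longrightarrow> \<phi> v < c"
      unfolding eventually_at_topological by blast
    moreover from this lim obtain v where "v \<in> S" "c \<le> \<phi> v" "v \<in> V" "v \<noteq> w"
      unfolding islimpt_def by blast
    ultimately show False by force
  qed
qed

text \<open>The function need not extend to the frontier, so the maximum is sought on a superlevel
  set: if \<open>norm (h z) > B\<close>, the set \<open>K\<close> where \<open>norm h\<close> is at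
  least that value stays away from the frontier and is compact. \<open>S\<close> may be
  disconnected, so the modulus is constant only on the component of a maximum point. That component
  lies in \<open>K\<close> and is open and closed in the plane, which is impossible in a bounded
  set.\<close>

lemma norm_le_of_eventually_at_frontier:
  fixes h :: "complex \<Rightarrow> complex"
  assumes "open S" "bounded S" and hol: "h holomorphic_on S"
    and fr: "\<And>\<xi> e. \<xi> \<in> frontier S \<Longrightarrow> 0 < e \<Longrightarrow> \<forall>\<^sub>F z in at \<xi> within S. norm (h z) \<le> B + e"
    and "z \<in> S"
  shows "norm (h z) \<le> B"
proof (rule ccontr)
  assume nz: "\<not> norm (h z) \<le> B"
  define c where "c = norm (h z)"
  define K where "K = {w \<in> S. c \<le> norm (h w)}"
  have cont: "continuous_on S h"
    using hol holomorphic_on_imp_continuous_on by blast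
  have KS: "K \<subseteq> S" by (auto simp: K_def)
  have "closed {w \<in> S \<inter> UNIV. c \<le> norm (h w)}"
  proof (rule closed_superlevel_set)
    show "continuous_on S (\<lambda>w. norm (h w))" using cont by (rule continuous_on_norm)
    fix \<xi> assume "\<xi> \<in> closure S" "\<xi> \<notin> S"
    then have "\<xi> \<in> frontier S" using \<open>open S\<close> by (simp add: frontier_def interior_open)
    then have "\<forall>\<^sub>F v in at \<xi> within S. norm (h v) \<le> B + (c - B) / 2"
      by (rule fr) (use nz in \<open>simp add: c_def\<close>)
    then show "\<forall>\<^sub>F v in at \<xi> within S. norm (h v) < c"
    proof eventually_elim
      case (elim v)
      moreover have "B < c" using nz by (simp add: c_def)
      ultimately show ?case by (simp add: field_simps)
    qed
  qed simp
  then have "closed K" by (simp add: K_def)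
  then have "compact K"
    using assms(2) KS by (meson bounded_subset compact_eq_bounded_closed)
  moreover have "z \<in> K" using assms(5) by (auto simp: K_def c_def)
  moreover have "continuous_on K (\<lambda>w. norm (h w))"
    by (intro continuous_on_norm continuous_on_subset[OF cont KS])
  ultimately obtain \<xi> where xi: "\<xi> \<in> K" "\<And>w. w \<in> K \<Longrightarrow> norm (h w) \<le> norm (h \<xi>)"
    using continuous_attains_sup[of K "\<lambda>w. norm (h w)"] by blast
  have max: "norm (h w) \<le> norm (h \<xi>)" if "w \<in> S" for w
    using xi that by (cases "w \<in> K") (auto simp: K_def)
  define C where "C = connected_component_set S \<xi>"
  have C: "open C" "C \<subseteq> S" "connected C" "\<xi> \<in> C"
    using xi KS \<open>open S\<close> by (auto simp: C_def open_connected_component connected_component_subset)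
  have "h constant_on C"
    by (rule maximum_modulus_principle[OF holomorphic_on_subset[OF hol C(2)] C(1,3) C(1) order_refl C(4)])
      (use max C in blast)
  then have "h w = h \<xi>" if "w \<in> C" for w using that C(4) unfolding constant_on_def by metis
  then have "C \<subseteq> K" using xi(1) C(2) unfolding K_def by (smt (verit) mem_Collect_eq subset_eq)
  \<comment> \<open>A component is closed only relative to \<open>S\<close>; lying inside the
    compact \<open>K\<close> makes it closed in the plane.\<close>
  have "closedin (top_of_set S) C" unfolding C_def by (rule closedin_connected_component)
  then have "closedin (top_of_set K) C" using \<open>C \<subseteq> K\<close> KS by (rule closedin_subset_trans)
  then have "closed C" using \<open>closed K\<close> closedin_closed_trans by blast
  then have "C = UNIV" using C clopen[of C] by auto
  then show False using C assms(2) not_bounded_UNIV bounded_subset by metis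
qed

text \<open>The modulus of \<open>exp h\<close> is \<open>exp (Re h)\<close>. This is why the
  barriers below are built from holomorphic functions rather than from harmonic ones.\<close>

lemma Re_le_of_eventually_at_frontier:
  fixes h :: "complex \<Rightarrow> complex"
  assumes "open S" "bounded S" and hol: "h holomorphic_on S"
    and fr: "\<And>\<xi> e. \<xi> \<in> frontier S \<Longrightarrow> 0 < e \<Longrightarrow> \<forall>\<^sub>F z in at \<xi> within S. Re (h z) \<le> e"
    and "z \<in> S"
  shows "Re (h z) \<le> 0"
proof -
  have "norm (exp (h z)) \<le> 1"
  proof (rule norm_le_of_eventually_at_frontier[OF assms(1,2), where h = "\<lambda>z. exp (h z)"])
    show "(\<lambda>z. exp (h z)) holomorphic_on S" using hol by (intro holomorphic_intros)
    fix \<xi> and e :: real assume "\<xi> \<in> frontier S" "0 < e"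
    then have "\<forall>\<^sub>F z in at \<xi> within S. Re (h z) \<le> ln (1 + e)" by (intro fr) auto
    then show "\<forall>\<^sub>F z in at \<xi> within S. norm (exp (h z)) \<le> 1 + e"
      by eventually_elim (use \<open>0 < e\<close> in \<open>simp add: ln_ge_iff\<close>)
  qed fact
  then show ?thesis by simp
qed

text \<open>Both sides are the limit of the second difference
  \<open>u (z + t h + t k) - u (z + t h) - u (z + t k) + u z\<close> divided by \<open>t\<^sup>2\<close>.\<close>

lemma derivative_of_gradient_symmetric:
  fixes u :: "'a::real_inner \<Rightarrow> real"
  assumes "open S" "z \<in> S" and grad: "\<And>w. w \<in> S \<Longrightarrow> GDERIV u w :> G w"
    and A: "(G has_derivative A) (at z)"
  shows "A h \<bullet> k = A k \<bullet> h"
proof -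
  define D where "D t = u (z + t *\<^sub>R h + t *\<^sub>R k) - u (z + t *\<^sub>R h) - u (z + t *\<^sub>R k) + u z" for t :: real
  have lim: "((\<lambda>t. (u (z + t *\<^sub>R h + t *\<^sub>R k) - u (z + t *\<^sub>R h) - u (z + t *\<^sub>R k) + u z) / t\<^sup>2) \<longlongrightarrow> A k \<bullet> h) (at_right 0)"
    for h k
  proof (rule tendstoI)
    fix e :: real assume "e > 0"
    interpret A: bounded_linear A using A by (rule has_derivative_bounded_linear)
    define N where "N = norm h + norm k + 1"
    \<comment> \<open>The difference quotient will be off by at most
      \<open>2 * e' * N\<^sup>2\<close>, which is below \<open>e\<close>.\<close>
    define e' where "e' = e / (3 * N * N)"
    have N: "N > 0" "norm h \<le> N" "norm k \<le> N" "norm h + norm k \<le> N"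
      using norm_ge_zero[of h] norm_ge_zero[of k] unfolding N_def by linarith+
    have e': "e' > 0" using \<open>e > 0\<close> N by (simp add: e'_def)
    obtain d1 where d1: "d1 > 0" "\<And>y. norm (y - z) < d1 \<Longrightarrow> norm (G y - G z - A (y - z)) \<le> e' * norm (y - z)"
      using A e' unfolding has_derivative_at_alt by blast
    obtain d2 where d2: "d2 > 0" "ball z d2 \<subseteq> S" using assms(1,2) open_contains_ball by blast
    define d where "d = min d1 d2 / N"
    have "d > 0" using d1(1) d2(1) N(1) by (simp add: d_def)
    have "dist ((u (z + t *\<^sub>R h + t *\<^sub>R k) - u (z + t *\<^sub>R h) - u (z + t *\<^sub>R k) + u z) / t\<^sup>2) (A k \<bullet> h) < e"
      if t: "0 < t" "t < d" for t
    proof -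
      have tN: "t * N < min d1 d2" using t N by (simp add: d_def field_simps)
      have near: "norm (x *\<^sub>R h + y *\<^sub>R k) \<le> t * N" if "0 \<le> x" "x \<le> t" "0 \<le> y" "y \<le> t" for x y
      proof -
        have "norm (x *\<^sub>R h + y *\<^sub>R k) \<le> x * norm h + y * norm k"
          using norm_triangle_ineq[of "x *\<^sub>R h" "y *\<^sub>R k"] that by simp
        also have "\<dots> \<le> t * norm h + t * norm k"
          using that by (intro add_mono mult_right_mono) auto
        also have "\<dots> = t * (norm h + norm k)" by (simp add: algebra_simps)
        also have "\<dots> \<le> t * N" using t N by (intro mult_left_mono) auto
        finally show ?thesis .
      qed
      have inS: "z + x *\<^sub>R h + y *\<^sub>R k \<in> S" if "0 \<le> x" "x \<le> t" "0 \<le> y" "y \<le> t" for x y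
      proof -
        have "z + x *\<^sub>R h + y *\<^sub>R k \<in> ball z d2"
          using near[OF that] tN by (simp add: dist_norm norm_minus_commute algebra_simps)
        then show ?thesis using d2 by blast
      qed
      \<comment> \<open>The second difference is the increment of \<open>p\<close> over [0, t]. The
        mean value theorem along \<open>h\<close> leaves a difference of gradients, to which the
        differentiability of \<open>G\<close> at \<open>z\<close> applies.\<close>
      define p where "p x = u (z + x *\<^sub>R h + t *\<^sub>R k) - u (z + x *\<^sub>R h)" for x
      have dp: "(p has_real_derivative h \<bullet> (G (z + x *\<^sub>R h + t *\<^sub>R k) - G (z + x *\<^sub>R h))) (at x)"
        if "0 \<le> x" "x \<le> t" for x
      proof -
        have 1: "((\<lambda>x. u (z + x *\<^sub>R h + t *\<^sub>R k)) has_derivative (\<lambda>s. (s *\<^sub>R h) \<bullet> G (z + x *\<^sub>R h + t *\<^sub>R k))) (at x)"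
          by (rule has_derivative_compose[where g = u])
            (use grad[OF inS[OF that, of t]] t in \<open>auto simp: gderiv_def intro!: derivative_eq_intros\<close>)
        have 2: "((\<lambda>x. u (z + x *\<^sub>R h)) has_derivative (\<lambda>s. (s *\<^sub>R h) \<bullet> G (z + x *\<^sub>R h))) (at x)"
          by (rule has_derivative_compose[where g = u])
            (use grad[OF inS[OF that, of 0]] t in \<open>auto simp: gderiv_def intro!: derivative_eq_intros\<close>)
        show ?thesis unfolding p_def has_field_derivative_def
          by (rule has_derivative_eq_rhs[OF has_derivative_diff[OF 1 2]]) (auto simp: fun_eq_iff inner_diff_right algebra_simps)
      qed
      obtain x where x: "0 < x" "x < t" "p t - p 0 = (t - 0) * (h \<bullet> (G (z + x *\<^sub>R h + t *\<^sub>R k) - G (z + x *\<^sub>R h)))"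
        using MVT2[OF t(1), of p "\<lambda>x. h \<bullet> (G (z + x *\<^sub>R h + t *\<^sub>R k) - G (z + x *\<^sub>R h))", OF dp] by auto
      have b1: "norm (G (z + x *\<^sub>R h + y *\<^sub>R k) - G z - A (x *\<^sub>R h + y *\<^sub>R k)) \<le> e' * (t * N)"
        if "0 \<le> y" "y \<le> t" for y
      proof -
        have n: "norm (x *\<^sub>R h + y *\<^sub>R k) \<le> t * N" using near[of x y] x that by auto
        then have "norm (G (z + x *\<^sub>R h + y *\<^sub>R k) - G z - A (x *\<^sub>R h + y *\<^sub>R k)) \<le> e' * norm (x *\<^sub>R h + y *\<^sub>R k)"
          using d1(2)[of "z + x *\<^sub>R h + y *\<^sub>R k"] tN by (simp add: add.assoc)
        also have "\<dots> \<le> e' * (t * N)" using n e' by (intro mult_left_mono) auto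
        finally show ?thesis .
      qed
      define R where "R = (G (z + x *\<^sub>R h + t *\<^sub>R k) - G (z + x *\<^sub>R h)) - t *\<^sub>R A k"
      have "R = (G (z + x *\<^sub>R h + t *\<^sub>R k) - G z - A (x *\<^sub>R h + t *\<^sub>R k)) - (G (z + x *\<^sub>R h + 0 *\<^sub>R k) - G z - A (x *\<^sub>R h + 0 *\<^sub>R k))"
        by (simp add: R_def A.add A.scaleR)
      then have "norm R \<le> e' * (t * N) + e' * (t * N)"
        using norm_triangle_ineq4 b1[of t] b1[of 0] t by (smt (verit))
      moreover have "\<bar>h \<bullet> R\<bar> \<le> norm h * norm R" by (rule Cauchy_Schwarz_ineq2)
      ultimately have hR: "\<bar>h \<bullet> R\<bar> \<le> N * (2 * (e' * (t * N)))"
        using N by (smt (verit) mult_mono norm_ge_zero)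
      have "p t - p 0 = t * (h \<bullet> R) + t\<^sup>2 * (A k \<bullet> h)"
        using x(3) by (simp add: R_def inner_diff_right inner_commute power2_eq_square algebra_simps)
      then have "(p t - p 0) / t\<^sup>2 - A k \<bullet> h = (h \<bullet> R) / t" using t by (simp add: field_simps power2_eq_square)
      moreover have "p t - p 0 = u (z + t *\<^sub>R h + t *\<^sub>R k) - u (z + t *\<^sub>R h) - u (z + t *\<^sub>R k) + u z"
        by (simp add: p_def)
      moreover have "\<bar>(h \<bullet> R) / t\<bar> \<le> N * (2 * (e' * N))" using hR t by (simp add: field_simps)
      moreover have "N * (2 * (e' * N)) < e" using N \<open>e > 0\<close> by (simp add: e'_def field_simps)
      ultimately show ?thesis by (simp add: dist_norm)
    qed
    then show "\<forall>\<^sub>F t in at_right 0. dist ((u (z + t *\<^sub>R h + t *\<^sub>R k) - u (z + t *\<^sub>R h) - u (z + t *\<^sub>R k) + u z) / t\<^sup>2) (A k \<bullet> h) < e"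
      using \<open>d > 0\<close> unfolding eventually_at_right_field by blast
  qed
  have eq: "(\<lambda>t. (u (z + t *\<^sub>R k + t *\<^sub>R h) - u (z + t *\<^sub>R k) - u (z + t *\<^sub>R h) + u z) / t\<^sup>2) = (\<lambda>t. (u (z + t *\<^sub>R h + t *\<^sub>R k) - u (z + t *\<^sub>R h) - u (z + t *\<^sub>R k) + u z) / t\<^sup>2)"
    by (simp add: fun_eq_iff algebra_simps)
  show ?thesis
    using tendsto_unique[OF _ lim[of k h, unfolded eq] lim[of h k]] by auto
qed


lemma GDERIV_gradient:
  fixes u :: "complex \<Rightarrow> real"
  assumes "u differentiable (at z)"
  shows "GDERIV u z :> gradient u z"
proof -
  obtain l where l: "(u has_derivative l) (at z)" using assms by (auto simp: differentiable_def)
  then interpret l: bounded_linear l by (rule has_derivative_bounded_linear)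
  have "l h = h \<bullet> Complex (l 1) (l \<i>)" for h
  proof -
    have "l h = l (Re h *\<^sub>R 1 + Im h *\<^sub>R \<i>)"
      by (rule arg_cong[of _ _ l]) (simp add: complex_eq_iff)
    also have "\<dots> = h \<bullet> Complex (l 1) (l \<i>)"
      by (simp only: l.add l.scaleR) (simp add: inner_complex_def)
    finally show ?thesis .
  qed
  then have ex: "GDERIV u z :> Complex (l 1) (l \<i>)"
    using has_derivative_eq_rhs[OF l, of "\<lambda>h. h \<bullet> Complex (l 1) (l \<i>)"] unfolding gderiv_def by (metis (no_types) ext)
  have "D = D'" if "GDERIV u z :> D" "GDERIV u z :> D'" for D D'
  proof -
    have "(\<lambda>h. h \<bullet> D) = (\<lambda>h. h \<bullet> D')"
      using that unfolding gderiv_def by (rule has_derivative_unique)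
    then show ?thesis by (metis inner_commute vector_eq_rdot)
  qed
  with ex show ?thesis unfolding gradient_def by (metis theI)
qed

text \<open>The conjugate gradient \<open>F\<close> is holomorphic: symmetry of the Hessian and
  vanishing trace are the Cauchy-Riemann equations. A primitive \<open>k\<close> exists on the
  simply connected set, and \<open>Re k\<close> differs from \<open>u\<close> by a constant. The
  factor \<open>\<i>\<close> makes \<open>u\<close> an imaginary part, so that zero boundary values
  mean that \<open>f\<close> becomes real at the boundary, the form suited to reflection.\<close>

lemma harmonic_on_imp_holomorphic:
  assumes "open S" "simply_connected S" and harm: "harmonic_on S u"
  obtains f where "f holomorphic_on S" "\<And>z. z \<in> S \<Longrightarrow> Im (f z) = u z"
    "\<And>z. z \<in> S \<Longrightarrow> norm (deriv f z) = norm (gradient u z)"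
proof -
  have grad: "GDERIV u z :> gradient u z" if "z \<in> S" for z
    using harm that by (auto simp: harmonic_on_def C2_on_def intro: GDERIV_gradient)
  define F where "F z = cnj (gradient u z)" for z
  have "\<exists>F'. (F has_field_derivative F') (at z)" if z: "z \<in> S" for z
  proof -
    define A where "A = frechet_derivative (gradient u) (at z)"
    have A: "(gradient u has_derivative A) (at z)"
      using harm z by (auto simp: harmonic_on_def C2_on_def A_def frechet_derivative_works[symmetric])
    then interpret A: bounded_linear A by (rule has_derivative_bounded_linear)
    have sym: "Im (A 1) = Re (A \<i>)"
      using derivative_of_gradient_symmetric[OF assms(1) z grad A, of 1 \<i>] by (simp add: inner_complex_def)
    have trace: "Re (A 1) + Im (A \<i>) = 0"
      using harm z by (simp add: harmonic_on_def laplacian_def A_def Basis_complex_def inner_complex_def)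
    have lin: "cnj (A h) = cnj (A 1) * h" for h
    proof -
      have "A h = A (Re h *\<^sub>R 1 + Im h *\<^sub>R \<i>)"
        by (rule arg_cong[of _ _ A]) (simp add: complex_eq_iff)
      also have "\<dots> = Re h *\<^sub>R A 1 + Im h *\<^sub>R A \<i>" by (simp only: A.add A.scaleR)
      finally have "A h = Re h *\<^sub>R A 1 + Im h *\<^sub>R A \<i>" .
      moreover have "Im (A \<i>) = - Re (A 1)" using trace by linarith
      ultimately show ?thesis by (simp add: complex_eq_iff sym[symmetric])
    qed
    have "(F has_derivative (\<lambda>h. cnj (A h))) (at z)"
      unfolding F_def by (rule has_derivative_cnj[OF A])
    then have "(F has_derivative (\<lambda>h. cnj (A 1) * h)) (at z)"
      by (rule has_derivative_eq_rhs) (rule ext, rule lin)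
    then have "(F has_field_derivative cnj (A 1)) (at z)" by (simp only: has_field_derivative_def)
    then show ?thesis ..
  qed
  then have "F holomorphic_on S" using assms(1) by (simp add: holomorphic_on_open)
  then obtain k where k: "\<And>z. z \<in> S \<Longrightarrow> (k has_field_derivative F z) (at z)"
    using assms(1,2) simply_connected_eq_global_primitive by metis
  have "((\<lambda>z. u z - Re (k z)) has_derivative (\<lambda>h. 0)) (at z)" if z: "z \<in> S" for z
  proof -
    have "((\<lambda>z. Re (k z)) has_derivative (\<lambda>h. Re (F z * h))) (at z)"
      using k[OF z] by (intro has_derivative_Re) (simp add: has_field_derivative_def)
    then have "((\<lambda>z. u z - Re (k z)) has_derivative (\<lambda>h. h \<bullet> gradient u z - Re (F z * h))) (at z)"
      using grad[OF z] unfolding gderiv_def by (intro has_derivative_diff)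
    moreover have "(\<lambda>h. h \<bullet> gradient u z - Re (F z * h)) = (\<lambda>h. 0)"
      by (simp add: F_def inner_complex_def fun_eq_iff)
    ultimately show ?thesis by simp
  qed
  then have "u z - Re (k z) = u w - Re (k w)" if "z \<in> S" "w \<in> S" for z w
    using has_derivative_zero_unique_connected[OF assms(1) simply_connected_imp_connected[OF assms(2)],
        of "\<lambda>z. u z - Re (k z)"] that by blast
  then have "\<exists>c. \<forall>z\<in>S. u z - Re (k z) = c" by (cases "S = {}") blast+
  then obtain c where c: "\<And>z. z \<in> S \<Longrightarrow> u z - Re (k z) = c"
    by blast
  define f where "f z = \<i> * (k z + of_real c)" for z
  have df: "(f has_field_derivative \<i> * F z) (at z)" if "z \<in> S" for z
    unfolding f_def using k[OF that] by (auto intro!: derivative_eq_intros)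
  show thesis
  proof
    show "f holomorphic_on S" using df assms(1) by (auto simp: holomorphic_on_open)
    show "Im (f z) = u z" if "z \<in> S" for z using c[OF that] by (simp add: f_def)
    show "norm (deriv f z) = norm (gradient u z)" if "z \<in> S" for z
      using DERIV_imp_deriv[OF df[OF that]] by (simp add: norm_mult F_def)
  qed
qed

section \<open>Hopf's lemma at a point with Dini data\<close>

lemma abs_arctan_diff_le: "\<bar>arctan x - arctan y\<bar> \<le> \<bar>x - y\<bar>" for x y :: real
proof -
  have "norm (arctan x - arctan y) \<le> 1 * norm (x - y)"
  proof (rule field_differentiable_bound[of UNIV])
    show "(arctan has_field_derivative inverse (1 + z\<^sup>2)) (at z within UNIV)" for z
      by (rule DERIV_arctan)
    show "norm (inverse (1 + z\<^sup>2)) \<le> 1" for z :: real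
      by (simp add: inverse_le_1_iff add_pos_nonneg)
  qed auto
  then show ?thesis by simp
qed

text \<open>The points \<open>- \<i> * s\<close> will be poles. A point of the cone with
  \<open>Im z < - s / 2\<close> is at horizontal distance at least \<open>s / (2 * M)\<close> from
  the pole; every other point is at vertical distance at least \<open>s / 2\<close>.\<close>

lemma pole_below_cone_norm_ge:
  assumes "Im z > - M * \<bar>Re z\<bar>" "1 \<le> M" "0 < s"
  shows "s \<le> 2 * M * norm (z + \<i> * of_real s)"
proof (cases "Im z \<ge> - s / 2")
  case True
  have "s / 2 \<le> \<bar>Im (z + \<i> * of_real s)\<bar>" using True assms by auto
  also have "\<dots> \<le> norm (z + \<i> * of_real s)" by (rule abs_Im_le_cmod)
  finally have "s / 2 \<le> norm (z + \<i> * of_real s)" .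
  moreover have "1 * norm (z + \<i> * of_real s) \<le> M * norm (z + \<i> * of_real s)"
    using assms by (intro mult_right_mono) auto
  ultimately show ?thesis by linarith
next
  case False
  have "s / 2 < M * \<bar>Re z\<bar>" using False assms by linarith
  also have "\<bar>Re z\<bar> = \<bar>Re (z + \<i> * of_real s)\<bar>" by simp
  also have "M * \<dots> \<le> M * norm (z + \<i> * of_real s)"
    using assms by (intro mult_left_mono abs_Re_le_cmod) auto
  finally show ?thesis by linarith
qed

text \<open>At a graph point \<open>z = x + i y\<close> the harmonic function \<open>Re (z / (z + i s))\<close> is, up to a multiple
  of \<open>s \<bar>x\<bar> / \<bar>z + i s\<bar>\<^sup>2\<close>, the indicator of \<open>s \<lesssim> \<bar>x\<bar>\<close>; this error is absorbed by
  \<open>Re (s / (z + i s)) = s x / \<bar>z + i s\<bar>\<^sup>2\<close>.\<close>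

lemma angle_term_bound:
  fixes x y s L d e b :: real
  defines "z \<equiv> Complex x y"
  assumes L: "0 \<le> L" "\<bar>y\<bar> \<le> L * \<bar>x\<bar>" and s: "0 < s" and x: "x \<noteq> 0"
    and d: "\<bar>d\<bar> \<le> e"
    and b: "(b = d \<and> s \<le> 2 * \<bar>x\<bar>) \<or> (b = 0 \<and> \<bar>x\<bar> \<le> s)"
    and K: "K = (L + 2) + (1 + L + L\<^sup>2) + 2 * (1 + (L + 1)\<^sup>2)"
  defines "t \<equiv> (of_real d * z + of_real (K * e * s)) / (z + \<i> * of_real s)"
  shows "sgn x * b \<le> sgn x * Re t"
    and "s / 2 \<le> \<bar>x\<bar> \<Longrightarrow> \<bar>x\<bar> \<le> s \<Longrightarrow> sgn x * b + e \<le> sgn x * Re t"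
proof -
  define D where "D = x\<^sup>2 + (y + s)\<^sup>2"
  have D: "D > 0" using x by (simp add: D_def add_pos_nonneg)
  have e: "e \<ge> 0" using d by linarith
  \<comment> \<open>\<open>Q\<close> is the real part of \<open>z / (z + \<i> * s)\<close>, and
    \<open>P\<close> below is the absolute value of the real part of
    \<open>s / (z + \<i> * s)\<close>. The three summands of \<open>K\<close> pay for the error of
    \<open>Q\<close> against 1, for its error against 0, and for the surplus \<open>e\<close> of the
    second claim.\<close>
  define Q where "Q = (x\<^sup>2 + y * (y + s)) / D"
  have Ret: "Re t = d * Q + K * e * (s * x / D)"
    by (simp add: t_def z_def Re_divide D_def Q_def power2_eq_square algebra_simps flip: add_divide_distrib)
  define P where "P = s * \<bar>x\<bar> / D"
  have P: "P \<ge> 0" using D s by (simp add: P_def)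
  have sg: "sgn x * x = \<bar>x\<bar>" by (simp add: sgn_if)
  have sgt: "sgn x * Re t = sgn x * (d * Q) + K * e * P"
  proof -
    have "sgn x * Re t = sgn x * (d * Q) + K * e * (s * (sgn x * x) / D)"
      by (simp add: Ret algebra_simps)
    then show ?thesis by (simp add: sg P_def)
  qed
  have main: "\<bar>d * Q - b\<bar> \<le> e * (((L + 2) + (1 + L + L\<^sup>2)) * P)"
  proof -
    from b consider "b = d" "s \<le> 2 * \<bar>x\<bar>" | "b = 0" "\<bar>x\<bar> \<le> s" by blast
    then have "\<exists>q. d * Q - b = d * q \<and> \<bar>q\<bar> \<le> ((L + 2) + (1 + L + L\<^sup>2)) * P"
    proof cases
      case 1
      have q: "Q - 1 = - (s * (y + s)) / D"
        using D by (simp add: Q_def D_def field_simps power2_eq_square)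
      have "\<bar>y + s\<bar> \<le> (L + 2) * \<bar>x\<bar>" using L 1 s by (simp add: algebra_simps abs_le_iff)
      then have "s * \<bar>y + s\<bar> / D \<le> s * ((L + 2) * \<bar>x\<bar>) / D"
        using s D by (intro divide_right_mono mult_left_mono) auto
      moreover have "\<bar>Q - 1\<bar> = s * \<bar>y + s\<bar> / D"
        unfolding q abs_divide abs_minus_cancel abs_mult using s D by simp
      ultimately have "\<bar>Q - 1\<bar> \<le> (L + 2) * P"
        by (simp add: P_def mult.left_commute)
      also have "\<dots> \<le> ((L + 2) + (1 + L + L\<^sup>2)) * P"
        using P L by (intro mult_right_mono) auto
      finally show ?thesis using 1 by (intro exI[of _ "Q - 1"]) (simp add: algebra_simps)
    next
      case 2
      have "\<bar>x\<^sup>2 + y * (y + s)\<bar> \<le> x\<^sup>2 + \<bar>y\<bar> * (\<bar>y\<bar> + s)"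
      proof -
        have "\<bar>y + s\<bar> \<le> \<bar>y\<bar> + s" using s by linarith
        then have "\<bar>y * (y + s)\<bar> \<le> \<bar>y\<bar> * (\<bar>y\<bar> + s)"
          unfolding abs_mult by (rule mult_left_mono) simp
        moreover have "\<bar>x\<^sup>2 + y * (y + s)\<bar> \<le> x\<^sup>2 + \<bar>y * (y + s)\<bar>"
          using abs_triangle_ineq[of "x\<^sup>2" "y * (y + s)"] by simp
        ultimately show ?thesis by linarith
      qed
      also have "\<dots> \<le> \<bar>x\<bar> * s + (L * \<bar>x\<bar>) * (L * s + s)"
      proof (intro add_mono mult_mono)
        show "x\<^sup>2 \<le> \<bar>x\<bar> * s" using 2 by (metis abs_ge_zero mult_left_mono power2_abs power2_eq_square)
        show "\<bar>y\<bar> \<le> L * s" using L 2 by (meson mult_left_mono order_trans)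
      qed (use L s in auto)
      also have "\<dots> = (1 + L + L\<^sup>2) * (s * \<bar>x\<bar>)" by (simp add: power2_eq_square algebra_simps)
      finally have "\<bar>x\<^sup>2 + y * (y + s)\<bar> / D \<le> (1 + L + L\<^sup>2) * (s * \<bar>x\<bar>) / D"
        using D by (intro divide_right_mono) auto
      then have "\<bar>Q\<bar> \<le> (1 + L + L\<^sup>2) * P" unfolding Q_def P_def using D by simp
      also have "\<dots> \<le> ((L + 2) + (1 + L + L\<^sup>2)) * P"
        using P L by (intro mult_right_mono) auto
      finally show ?thesis using 2 by (intro exI[of _ Q]) simp
    qed
    then obtain q where "d * Q - b = d * q" "\<bar>q\<bar> \<le> ((L + 2) + (1 + L + L\<^sup>2)) * P" by blast
    then show ?thesis using d e by (simp add: abs_mult mult_mono)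
  qed
  have "sgn x * b - sgn x * (d * Q) \<le> \<bar>d * Q - b\<bar>"
    using x by (cases "x > 0"; simp add: sgn_if; linarith)
  then have lower: "sgn x * b + e * (2 * (1 + (L + 1)\<^sup>2) * P) \<le> sgn x * Re t"
    unfolding sgt K using main by (simp add: algebra_simps)
  moreover have "0 \<le> e * (2 * (1 + (L + 1)\<^sup>2) * P)" using e P by simp
  ultimately show "sgn x * b \<le> sgn x * Re t" by linarith
  \<comment> \<open>At the scale of \<open>s\<close> the correction \<open>P\<close> is bounded
    below, and this yields the surplus \<open>e\<close>.\<close>
  assume xs: "s / 2 \<le> \<bar>x\<bar>" "\<bar>x\<bar> \<le> s"
  have "D \<le> s\<^sup>2 + ((L + 1) * s)\<^sup>2"
  proof -
    have "\<bar>y\<bar> \<le> L * s" using L xs by (meson mult_left_mono order_trans)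
    then have "\<bar>y + s\<bar> \<le> \<bar>(L + 1) * s\<bar>" using L s by (simp add: algebra_simps)
    then have "(y + s)\<^sup>2 \<le> ((L + 1) * s)\<^sup>2" by (simp add: abs_le_square_iff)
    moreover have "x\<^sup>2 \<le> s\<^sup>2" using xs s by (simp add: abs_le_square_iff[symmetric])
    ultimately show ?thesis by (simp add: D_def)
  qed
  also have "\<dots> = (1 + (L + 1)\<^sup>2) * (s * s)" by (simp add: power2_eq_square algebra_simps)
  also have "\<dots> \<le> (1 + (L + 1)\<^sup>2) * (s * (2 * \<bar>x\<bar>))"
    using xs s by (intro mult_left_mono) auto
  finally have "1 \<le> 2 * (1 + (L + 1)\<^sup>2) * P"
    using D by (simp add: P_def field_simps)
  then have "e * 1 \<le> e * (2 * (1 + (L + 1)\<^sup>2) * P)" using e by (intro mult_left_mono) auto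
  with lower show "sgn x * b + e \<le> sgn x * Re t" by linarith
qed


text \<open>The angle of the chord from 0 to a graph point at scale \<open>s j\<close> is that of
  the fitted line, \<open>a j\<close>, up to \<open>2 * \<epsilon> j\<close>. The difference
  \<open>a j - \<alpha>\<close> is the sum of the increments \<open>d k\<close> with
  \<open>k \<ge> j\<close>, that is with \<open>s k\<close> at most about \<bar>x\<bar>, so a series
  of the smoothed indicators of \<open>angle_term_bound\<close> reproduces it; absolute convergence
  makes \<open>A\<close> small once the series starts late. The factor \<open>sgn x\<close> orients
  the last inequality so that multiplication by \<open>exp (- \<i> * (\<alpha> + A z))\<close> moves
  both branches of the graph weakly below the real axis.\<close>

lemma dini_angle_function:
  fixes \<psi> :: "real \<Rightarrow> real" and c \<epsilon> :: "nat \<Rightarrow> real" and L :: real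
  assumes L: "0 \<le> L" "\<And>x. \<bar>x\<bar> \<le> 1 \<Longrightarrow> \<bar>\<psi> x\<bar> \<le> L * \<bar>x\<bar>"
    and eps: "\<And>k. 0 \<le> \<epsilon> k" "summable \<epsilon>"
    and dini: "\<And>k x. \<bar>x\<bar> \<le> (1/2)^k \<Longrightarrow> \<bar>\<psi> x - c k * x\<bar> \<le> \<epsilon> k * (1/2)^k"
  shows "\<exists>\<alpha>. \<bar>\<alpha>\<bar> < pi / 2 \<and> (\<forall>\<kappa>>0.
    \<exists>\<rho> A. 0 < \<rho> \<and> \<rho> \<le> 1 \<and> A holomorphic_on {z. Im z > - (L + 1) * \<bar>Re z\<bar>} \<and>
       (\<forall>z\<in>{z. Im z > - (L + 1) * \<bar>Re z\<bar>}. norm (A z) \<le> \<kappa>) \<and>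
       (\<forall>x. x \<noteq> 0 \<longrightarrow> \<bar>x\<bar> < \<rho> \<longrightarrow> \<bar>arctan (\<psi> x / x) - \<alpha>\<bar> \<le> \<kappa> \<and>
          sgn x * (arctan (\<psi> x / x) - \<alpha>) \<le> sgn x * Re (A (Complex x (\<psi> x)))))"
proof -
  define s :: "nat \<Rightarrow> real" where "s k = (1/2)^k" for k
  have s: "s k > 0" "s (Suc k) = s k / 2" for k by (simp_all add: s_def)
  have s_le1: "s k \<le> 1" for k by (simp add: s_def power_le_one)
  have s_mono: "s k \<le> s j" if "j \<le> k" for j k using that by (simp add: s_def power_decreasing)
  define a where "a k = arctan (c k)" for k
  define d where "d k = a k - a (Suc k)" for k
  \<comment> \<open>Comparing the fits of orders \<open>k\<close> and \<open>k + 1\<close> at the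
    point \<open>s (Suc k) = s k / 2\<close> bounds the change of slope by
    \<open>e k\<close>.\<close>
  define e where "e k = 2 * \<epsilon> k + \<epsilon> (Suc k)" for k
  have e0: "e k \<ge> 0" for k using eps(1)[of k] eps(1)[of "Suc k"] by (simp add: e_def)
  have sum_e: "summable e" unfolding e_def
    using eps(2) by (intro summable_add summable_mult) (simp_all add: summable_Suc_iff)
  have d_le: "\<bar>d k\<bar> \<le> e k" for k
  proof -
    have 1: "\<bar>\<psi> (s (Suc k)) - c k * s (Suc k)\<bar> \<le> \<epsilon> k * s k"
      using dini[of "s (Suc k)" k] s[of k] by (simp add: s_def)
    have 2: "\<bar>\<psi> (s (Suc k)) - c (Suc k) * s (Suc k)\<bar> \<le> \<epsilon> (Suc k) * s (Suc k)"
      using dini[of "s (Suc k)" "Suc k"] by (simp add: s_def)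
    have "\<bar>c k - c (Suc k)\<bar> * s (Suc k) = \<bar>c k * s (Suc k) - c (Suc k) * s (Suc k)\<bar>"
      using s(1)[of "Suc k"] by (simp add: abs_mult left_diff_distrib[symmetric])
    also have "\<dots> \<le> \<epsilon> k * s k + \<epsilon> (Suc k) * s (Suc k)" using 1 2 by linarith
    also have "\<dots> = e k * s (Suc k)" by (simp add: e_def s(2) algebra_simps)
    finally have "\<bar>c k - c (Suc k)\<bar> \<le> e k" using s(1)[of "Suc k"] by simp
    then show ?thesis unfolding d_def a_def using abs_arctan_diff_le order_trans by blast
  qed
  have sum_d: "summable d"
    by (rule summable_comparison_test'[OF sum_e, of 0]) (use d_le in auto)
  have tele: "(\<Sum>i<n. d i) = a 0 - a n" for n
    by (induction n) (auto simp: d_def)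
  define \<alpha> where "\<alpha> = a 0 - suminf d"
  have lim: "a \<longlonglongrightarrow> \<alpha>"
  proof -
    have "(\<lambda>n. a 0 - (\<Sum>i<n. d i)) \<longlonglongrightarrow> \<alpha>"
      unfolding \<alpha>_def using summable_LIMSEQ[OF sum_d] by (intro tendsto_intros)
    then show ?thesis by (simp add: tele)
  qed
  have tail: "(\<lambda>k. d (k + j)) sums (a j - \<alpha>)" for j
  proof -
    have "(\<lambda>k. a (k + j)) \<longlonglongrightarrow> \<alpha>" using lim LIMSEQ_ignore_initial_segment by blast
    from telescope_sums'[OF this] show ?thesis by (simp add: d_def)
  qed
  have "\<exists>B. \<forall>k. \<epsilon> k \<le> B"
    using summable_LIMSEQ_zero[OF eps(2)] convergent_imp_Bseq convergentI
    by (metis Bseq_def abs_le_D1 real_norm_def)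
  then obtain E where E: "\<And>k. \<epsilon> k \<le> E" by blast
  have c_bd: "\<bar>c k\<bar> \<le> L + E" for k
  proof -
    have "\<bar>\<psi> (s k) - c k * s k\<bar> \<le> \<epsilon> k * s k" "\<bar>\<psi> (s k)\<bar> \<le> L * s k"
      using dini[of "s k" k] L(2)[of "s k"] s_le1[of k] s(1)[of k] by (simp_all add: s_def)
    then have "\<bar>c k * s k\<bar> \<le> (L + \<epsilon> k) * s k" by (simp add: algebra_simps)
    then have "\<bar>c k\<bar> \<le> L + \<epsilon> k" using s(1)[of k] by (simp add: abs_mult)
    then show ?thesis using E[of k] by simp
  qed
  \<comment> \<open>The uniform bound for the slopes keeps the limit angle strictly away from the
    vertical.\<close>
  have "\<bar>\<alpha>\<bar> \<le> arctan (L + E)"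
  proof (rule tendsto_upperbound[OF tendsto_rabs[OF lim]])
    show "\<forall>\<^sub>F k in sequentially. \<bar>a k\<bar> \<le> arctan (L + E)"
      using c_bd by (intro always_eventually allI) (simp add: a_def abs_le_iff arctan_le_iff flip: arctan_minus)
  qed simp
  then have alpha: "\<bar>\<alpha>\<bar> < pi / 2" using arctan_ubound[of "L + E"] by linarith
  define V where "V = {z. Im z > - (L + 1) * \<bar>Re z\<bar>}"
  have "open V" unfolding V_def by (intro open_Collect_less continuous_intros)
  define K where "K = (L + 2) + (1 + L + L\<^sup>2) + 2 * (1 + (L + 1)\<^sup>2)"
  have K: "K \<ge> 0" using L by (simp add: K_def)
  define M where "M = 2 * (L + 1)"
  have M: "M > 0" using L by (simp add: M_def)
  have "\<exists>\<rho> A. 0 < \<rho> \<and> \<rho> \<le> 1 \<and> A holomorphic_on V \<and>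
       (\<forall>z\<in>V. norm (A z) \<le> \<kappa>) \<and>
       (\<forall>x. x \<noteq> 0 \<longrightarrow> \<bar>x\<bar> < \<rho> \<longrightarrow> \<bar>arctan (\<psi> x / x) - \<alpha>\<bar> \<le> \<kappa> \<and>
          sgn x * (arctan (\<psi> x / x) - \<alpha>) \<le> sgn x * Re (A (Complex x (\<psi> x))))"
    if kap: "0 < \<kappa>" for \<kappa>
  proof -
    \<comment> \<open>\<open>C\<close> dominates both factors that multiply the tail of
      \<open>e\<close>: \<open>(1 + M) + K * M\<close> in the bound for \<open>A\<close>, and
      \<open>2\<close> in the bound for the deviation of the angle.\<close>
    define C where "C = 2 + (1 + M) + K * M"
    have C: "C > 0" using M K by (simp add: C_def add_pos_nonneg)
    obtain k0 where k0: "norm (\<Sum>i. e (i + k0)) < \<kappa> / C"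
      using suminf_exist_split[OF _ sum_e, of "\<kappa> / C"] kap C by (metis divide_pos_pos order_refl)
    define T where "T k z = (of_real (d (k + k0)) * z + of_real (K * e (k + k0) * s (k + k0))) / (z + \<i> * of_real (s (k + k0)))" for k z
    define m where "m k = ((1 + M) + K * M) * e (k + k0)" for k
    have sum_ek: "summable (\<lambda>k. e (k + k0))" using sum_e by (simp add: summable_iff_shift)
    have sum_m: "summable m" unfolding m_def by (intro summable_mult sum_ek)
    have den: "s k \<le> M * norm (z + \<i> * of_real (s k))" "norm z \<le> (1 + M) * norm (z + \<i> * of_real (s k))" if "z \<in> V" for k z
    proof -
      show 1: "s k \<le> M * norm (z + \<i> * of_real (s k))"
        using pole_below_cone_norm_ge[of "L + 1" z "s k"] that L s by (simp add: V_def M_def algebra_simps)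
      have "norm z \<le> norm (z + \<i> * of_real (s k)) + norm (\<i> * of_real (s k))"
        by (metis add_diff_cancel norm_triangle_ineq4)
      also have "norm (\<i> * of_real (s k)) = s k" using s(1)[of k] by (simp add: norm_mult)
      finally show "norm z \<le> (1 + M) * norm (z + \<i> * of_real (s k))" using 1 by (simp add: algebra_simps)
    qed
    have den0: "norm (z + \<i> * of_real (s k)) > 0" if "z \<in> V" for k z
      using den(1)[OF that, of k] s(1)[of k] M by (smt (verit) mult_pos_pos zero_less_mult_pos)
    have T_le: "norm (T k z) \<le> m k" if "z \<in> V" for k z
    proof -
      let ?n = "norm (z + \<i> * of_real (s (k + k0)))"
      have "norm (of_real (d (k + k0)) * z + of_real (K * e (k + k0) * s (k + k0)))
          \<le> \<bar>d (k + k0)\<bar> * norm z + K * e (k + k0) * s (k + k0)"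
        by (rule order_trans[OF norm_triangle_ineq]) (use K e0 s(1) in \<open>simp add: norm_mult abs_mult less_imp_le\<close>)
      also have "\<dots> \<le> e (k + k0) * ((1 + M) * ?n) + K * e (k + k0) * (M * ?n)"
        using den[OF that, of "k + k0"] d_le e0 K s(1)[of "k + k0"] by (intro add_mono mult_mono) auto
      also have "\<dots> = m k * ?n" by (simp add: m_def algebra_simps)
      finally show ?thesis unfolding T_def norm_divide
        using den0[OF that, of "k + k0"] by (simp add: pos_divide_le_eq)
    qed
    have T_hol: "T k holomorphic_on V" for k
      unfolding T_def using den0 by (intro holomorphic_intros) fastforce
    define A where "A z = (\<Sum>k. T k z)" for z
    have unif: "uniform_limit V (\<lambda>n z. \<Sum>k<n. T k z) A sequentially"
      unfolding A_def by (rule Weierstrass_m_test[OF T_le sum_m])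
    have A_hol: "A holomorphic_on V"
    proof (rule holomorphic_uniform_sequence[OF \<open>open V\<close>])
      show "(\<lambda>z. \<Sum>k<n. T k z) holomorphic_on V" for n
        by (intro holomorphic_on_sum T_hol)
      fix z assume "z \<in> V"
      then obtain r where "r > 0" "cball z r \<subseteq> V" using \<open>open V\<close> open_contains_cball by blast
      then show "\<exists>r>0. cball z r \<subseteq> V \<and> uniform_limit (cball z r) (\<lambda>n z. \<Sum>k<n. T k z) A sequentially"
        using uniform_limit_on_subset[OF unif] by blast
    qed
    have sumT: "summable (\<lambda>k. norm (T k z))" if "z \<in> V" for z
      by (rule summable_comparison_test'[OF sum_m, of 0]) (use T_le[OF that] in auto)
    have m_small: "suminf m \<le> \<kappa>"
    proof -
      have "suminf m = ((1 + M) + K * M) * (\<Sum>i. e (i + k0))"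
        unfolding m_def by (rule suminf_mult[OF sum_ek])
      also have "\<dots> \<le> C * (\<kappa> / C)"
        using k0 e0 sum_ek M K by (intro mult_mono) (auto simp: C_def suminf_nonneg)
      finally show ?thesis using C by simp
    qed
    have A_le: "norm (A z) \<le> \<kappa>" if "z \<in> V" for z
    proof -
      have "norm (A z) \<le> (\<Sum>k. norm (T k z))" unfolding A_def by (rule summable_norm[OF sumT[OF that]])
      also have "\<dots> \<le> suminf m" by (rule suminf_le[OF T_le[OF that] sumT[OF that] sum_m])
      finally show ?thesis using m_small by linarith
    qed
    have graph: "\<bar>arctan (\<psi> x / x) - \<alpha>\<bar> \<le> \<kappa> \<and>
          sgn x * (arctan (\<psi> x / x) - \<alpha>) \<le> sgn x * Re (A (Complex x (\<psi> x)))"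
      if x: "x \<noteq> 0" "\<bar>x\<bar> < s k0" for x
    proof -
      have x1: "\<bar>x\<bar> \<le> 1" using x s_le1[of k0] by linarith
      have y: "\<bar>\<psi> x\<bar> \<le> L * \<bar>x\<bar>" using L(2)[OF x1] .
      have "\<exists>n. s n < \<bar>x\<bar>" using real_arch_pow_inv[of "\<bar>x\<bar>" "1/2"] x by (simp add: s_def)
      \<comment> \<open>\<open>n\<close> is the first order with \<open>s n < \<bar>x\<bar>\<close>.
        Its predecessor \<open>j\<close> is the dyadic scale of \<open>x\<close>, and
        \<open>\<bar>x\<bar> < s k0\<close> ensures \<open>j \<ge> k0\<close>.\<close>
      then obtain n where n: "s n < \<bar>x\<bar>" "\<And>i. i < n \<Longrightarrow> \<not> s i < \<bar>x\<bar>" using exists_least_iff[of "\<lambda>n. s n < \<bar>x\<bar>"] by blast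
      have "k0 < n" using n(1) x(2) s_mono[of n k0] by (cases "n \<le> k0") auto
      then obtain i where i: "n = Suc (i + k0)" by (metis add.commute less_iff_Suc_add)
      define j where "j = i + k0"
      have xj: "s j / 2 < \<bar>x\<bar>" "\<bar>x\<bar> \<le> s j"
        using n(1) n(2)[of j] s(2)[of j] by (auto simp: i j_def)
      have zV: "Complex x (\<psi> x) \<in> V"
        using y x by (auto simp: V_def algebra_simps abs_le_iff)
      have th: "\<bar>arctan (\<psi> x / x) - a j\<bar> \<le> 2 * \<epsilon> j"
      proof -
        have "\<bar>\<psi> x - c j * x\<bar> \<le> \<epsilon> j * s j" using dini[of x j] xj by (simp add: s_def)
        also have "\<dots> \<le> \<epsilon> j * (2 * \<bar>x\<bar>)" using xj eps(1) by (intro mult_left_mono) auto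
        finally have "\<bar>\<psi> x - c j * x\<bar> / \<bar>x\<bar> \<le> 2 * \<epsilon> j"
          using x by (simp add: pos_divide_le_eq mult_ac)
        moreover have "\<psi> x / x - c j = (\<psi> x - c j * x) / x" using x by (simp add: field_simps)
        ultimately have "\<bar>\<psi> x / x - c j\<bar> \<le> 2 * \<epsilon> j" by simp
        then show ?thesis unfolding a_def using abs_arctan_diff_le order_trans by blast
      qed
      \<comment> \<open>Orders below \<open>j\<close> should contribute 0 and the others their full
        increment. The surplus \<open>e j\<close>, taken only from the term at the scale of
        \<open>x\<close>, absorbs the fitting error \<open>2 * \<epsilon> j\<close>.\<close>
      define b where "b k = (if i \<le> k then d (k + k0) else 0)" for k
      have b: "b sums (a j - \<alpha>)"
      proof -
        have "(\<lambda>k. b (k + i)) sums (a j - \<alpha>)" using tail[of j] by (simp add: b_def j_def add.assoc)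
        moreover have "(\<Sum>k<i. b k) = 0" by (simp add: b_def)
        ultimately show ?thesis using sums_iff_shift[of b i "a j - \<alpha>"] by simp
      qed
      have "(\<lambda>k. sgn x * b k + (if k = i then e j else 0)) sums (sgn x * (a j - \<alpha>) + e j)"
        by (rule sums_add[OF sums_mult[OF b, of "sgn x"] sums_single[of i "\<lambda>_. e j"]])
      moreover have "(\<lambda>k. sgn x * Re (T k (Complex x (\<psi> x)))) sums (sgn x * Re (A (Complex x (\<psi> x))))"
        unfolding A_def 
        by (rule sums_mult[OF sums_Re[OF summable_sums[OF summable_norm_cancel[OF sumT[OF zV]]]]])
      moreover have "sgn x * b k + (if k = i then e j else 0) \<le> sgn x * Re (T k (Complex x (\<psi> x)))" for k
      proof -
        have bk: "(b k = d (k + k0) \<and> s (k + k0) \<le> 2 * \<bar>x\<bar>) \<or> (b k = 0 \<and> \<bar>x\<bar> \<le> s (k + k0))"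
          using xj s_mono[of j "k + k0"] s_mono[of "k + k0" j] by (auto simp: b_def j_def)
        note tb = angle_term_bound[OF L(1) y s(1)[of "k + k0"] x(1) d_le[of "k + k0"] bk K_def]
        show ?thesis using tb xj by (auto simp: T_def j_def)
      qed
      ultimately have fin: "sgn x * (a j - \<alpha>) + e j \<le> sgn x * Re (A (Complex x (\<psi> x)))"
        by (rule sums_le[rotated])
      have sg: "\<bar>sgn x * w\<bar> = \<bar>w\<bar>" for w using x by (simp add: abs_mult abs_sgn_eq)
      have "sgn x * (arctan (\<psi> x / x) - a j) \<le> 2 * \<epsilon> j"
        using th sg[of "arctan (\<psi> x / x) - a j"] by linarith
      moreover have "2 * \<epsilon> j \<le> e j" using eps(1)[of "Suc j"] by (simp add: e_def)
      ultimately have "sgn x * (arctan (\<psi> x / x) - \<alpha>) \<le> sgn x * Re (A (Complex x (\<psi> x)))"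
        using fin by (simp add: algebra_simps)
      moreover have "\<bar>arctan (\<psi> x / x) - \<alpha>\<bar> \<le> \<kappa>"
      proof -
        have nd: "summable (\<lambda>k. norm (d (k + j)))"
          by (rule summable_comparison_test'[of "\<lambda>k. e (k + j)" 0]) (use d_le sum_e in \<open>auto simp: summable_iff_shift\<close>)
        have se: "summable (\<lambda>k. e (k + j))" using sum_e by (simp add: summable_iff_shift)
        have "a j - \<alpha> = (\<Sum>k. d (k + j))" using tail[of j] by (simp add: sums_iff)
        then have "\<bar>a j - \<alpha>\<bar> \<le> (\<Sum>k. norm (d (k + j)))" using summable_norm[OF nd] by simp
        also have "\<dots> \<le> (\<Sum>k. e (k + j))" by (rule suminf_le[OF _ nd se]) (use d_le in simp)
        also have "\<dots> = (\<Sum>k. e (k + k0)) - (\<Sum>k<i. e (k + k0))"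
          using suminf_minus_initial_segment[OF sum_ek, of i] by (simp add: j_def add.assoc)
        finally have 1: "\<bar>a j - \<alpha>\<bar> \<le> (\<Sum>k. e (k + k0))" using sum_nonneg[of "{..<i}" "\<lambda>k. e (k + k0)"] e0 by simp
        have "e j \<le> (\<Sum>k. e (k + k0))" using sum_le_suminf[OF sum_ek, of "{i}"] e0 by (simp add: j_def)
        then have "\<bar>arctan (\<psi> x / x) - \<alpha>\<bar> \<le> 2 * (\<Sum>k. e (k + k0))"
          using 1 th \<open>2 * \<epsilon> j \<le> e j\<close> by linarith
        also have "\<dots> \<le> C * (\<kappa> / C)"
          using k0 e0 sum_ek M K by (intro mult_mono) (auto simp: C_def suminf_nonneg)
        finally show ?thesis using C by simp
      qed
      ultimately show ?thesis by blast
    qed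
    show ?thesis using s(1)[of k0] s_le1[of k0] A_hol A_le graph by blast
  qed
  with alpha show ?thesis unfolding V_def by blast
qed

lemma Complex_1_eq_cis_arctan: "Complex 1 m = of_real (sqrt (1 + m\<^sup>2)) * cis (arctan m)"
proof -
  have "sqrt (1 + m\<^sup>2) > 0" by (simp add: add_pos_nonneg)
  then show ?thesis by (simp add: complex_eq_iff cos_arctan sin_arctan)
qed

text \<open>The comparison function is the imaginary part of
  \<open>z exp (- i (\<alpha> + A z))\<close>, which is nonpositive on the graph, corrected by
  \<open>Re (z\<^sup>2 exp (- 2 i \<alpha>))\<close>, which is positive on the graph away from \<open>0\<close> and hence makes the
  comparison function negative where the graph meets the circle of comparison.\<close>

lemma hopf_boundary:
  fixes \<psi> :: "real \<Rightarrow> real" and c \<epsilon> :: "nat \<Rightarrow> real" and L :: real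
  assumes "open S" and cont: "continuous_on {-1..1} \<psi>"
    and graph: "\<And>w. norm w < 1 \<Longrightarrow> w \<in> S \<longleftrightarrow> \<psi> (Re w) < Im w"
    and L: "0 \<le> L" "\<And>x. \<bar>x\<bar> \<le> 1 \<Longrightarrow> \<bar>\<psi> x\<bar> \<le> L * \<bar>x\<bar>"
    and eps: "\<And>k. 0 \<le> \<epsilon> k" "summable \<epsilon>"
    and dini: "\<And>k x. \<bar>x\<bar> \<le> (1/2)^k \<Longrightarrow> \<bar>\<psi> x - c k * x\<bar> \<le> \<epsilon> k * (1/2)^k"
    and f: "f holomorphic_on S"
    and r: "0 < r" "\<And>z. z \<in> S \<Longrightarrow> norm z < r \<Longrightarrow> 0 < Im (f z)"
    and f0: "((\<lambda>z. Im (f z)) \<longlongrightarrow> 0) (at 0 within S)"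
  shows "\<not> (deriv f \<longlongrightarrow> 0) (at 0 within S)"
proof
  assume df0: "(deriv f \<longlongrightarrow> 0) (at 0 within S)"

  \<comment> \<open>The barrier and its sign on the graph\<close>
  define V where "V = {z. Im z > - (L + 1) * \<bar>Re z\<bar>}"
  have "open V" unfolding V_def by (intro open_Collect_less continuous_intros)
  obtain \<alpha> where al: "\<bar>\<alpha>\<bar> < pi / 2"
    and ang: "\<forall>\<kappa>>0. \<exists>\<rho> A. 0 < \<rho> \<and> \<rho> \<le> 1 \<and> A holomorphic_on V \<and>
       (\<forall>z\<in>V. norm (A z) \<le> \<kappa>) \<and>
       (\<forall>x. x \<noteq> 0 \<longrightarrow> \<bar>x\<bar> < \<rho> \<longrightarrow> \<bar>arctan (\<psi> x / x) - \<alpha>\<bar> \<le> \<kappa> \<and>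
          sgn x * (arctan (\<psi> x / x) - \<alpha>) \<le> sgn x * Re (A (Complex x (\<psi> x))))"
    using dini_angle_function[OF L eps dini, folded V_def] by blast
  \<comment> \<open>\<open>\<kappa> \<le> pi / 8\<close> keeps
    \<open>2 * (\<theta> - \<alpha>)\<close> within a right angle, so that \<open>qq\<close> has
    positive real part on the graph. The other bound keeps \<open>\<alpha> + Re (A z)\<close>
    strictly between the two verticals, so that \<open>Im (kk z)\<close> grows along the imaginary
    axis.\<close>
  define \<kappa> where "\<kappa> = min (pi / 8) ((pi / 2 - \<bar>\<alpha>\<bar>) / 2)"
  have kap: "0 < \<kappa>" "\<kappa> \<le> pi / 8" "\<bar>\<alpha>\<bar> + \<kappa> < pi / 2"
    using al pi_gt_zero unfolding \<kappa>_def by (auto simp: min_def field_simps)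
  obtain \<rho> A where rho: "0 < \<rho>" "\<rho> \<le> 1" and A: "A holomorphic_on V" "\<And>z. z \<in> V \<Longrightarrow> norm (A z) \<le> \<kappa>"
    and gr: "\<And>x. x \<noteq> 0 \<Longrightarrow> \<bar>x\<bar> < \<rho> \<Longrightarrow> \<bar>arctan (\<psi> x / x) - \<alpha>\<bar> \<le> \<kappa>"
      "\<And>x. x \<noteq> 0 \<Longrightarrow> \<bar>x\<bar> < \<rho> \<Longrightarrow> sgn x * (arctan (\<psi> x / x) - \<alpha>) \<le> sgn x * Re (A (Complex x (\<psi> x)))"
    using ang kap(1) by blast
  define kk where "kk z = z * exp (- \<i> * (of_real \<alpha> + A z))" for z
  define qq where "qq z = z\<^sup>2 * cis (- 2 * \<alpha>)" for z
  define w where "w z = Im (kk z) - Re (qq z)" for z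
  have hol: "kk holomorphic_on V" "qq holomorphic_on V"
    unfolding kk_def qq_def by (intro holomorphic_intros A)+
  have contw: "continuous_on V w"
    unfolding w_def using hol by (intro continuous_intros holomorphic_on_imp_continuous_on)
  have above_V: "z \<in> V" if "z \<noteq> 0" "\<bar>Re z\<bar> \<le> 1" "\<psi> (Re z) \<le> Im z" for z
  proof (cases "Re z = 0")
    case True
    then have "0 \<le> Im z" using that L(2)[of 0] by simp
    with True that(1) show ?thesis by (auto simp: V_def complex_eq_iff)
  next
    case False
    have "- (L * \<bar>Re z\<bar>) \<le> Im z" using L(2)[OF that(2)] that(3) by linarith
    moreover have "- (L + 1) * \<bar>Re z\<bar> < - (L * \<bar>Re z\<bar>)" using False by (simp add: algebra_simps)
    ultimately show ?thesis by (simp add: V_def)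
  qed
  have psi0: "\<psi> 0 = 0" using L(2)[of 0] by simp
  have w_graph: "w z < 0" if z: "z \<noteq> 0" "\<bar>Re z\<bar> < \<rho>" "Im z = \<psi> (Re z)" for z
  proof -
    define x where "x = Re z"
    define m where "m = \<psi> x / x"
    define \<theta> where "\<theta> = arctan m"
    define R where "R = sqrt (1 + m\<^sup>2)"
    have x: "x \<noteq> 0" using z psi0 by (auto simp: x_def complex_eq_iff)
    have R: "R > 0" by (simp add: R_def add_pos_nonneg)
    have zx: "z = Complex x (\<psi> x)" using z by (simp add: x_def complex_eq_iff)
    \<comment> \<open>The real factor carries the sign of \<open>x\<close>: for \<open>x < 0\<close>
      the chord points opposite to the unit vector at angle \<open>\<theta>\<close>.\<close>
    have zpol: "z = of_real (x * R) * cis \<theta>"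
    proof -
      have "z = of_real x * Complex 1 m" using x by (simp add: zx m_def complex_eq_iff)
      then show ?thesis by (simp add: Complex_1_eq_cis_arctan R_def \<theta>_def)
    qed
    have zV: "z \<in> V" using above_V[of z] z rho by auto
    define a b where "a = Re (A z)" and "b = Im (A z)"
    have ab: "\<bar>a\<bar> \<le> \<kappa>" using A(2)[OF zV] abs_Re_le_cmod[of "A z"] by (simp add: a_def)
    have exps: "exp (- \<i> * (of_real \<alpha> + A z)) = of_real (exp b) * cis (- \<alpha> - a)"
      by (simp add: complex_eq_iff a_def b_def Re_exp Im_exp cos_diff sin_diff cos_add sin_add)
    have kz: "kk z = of_real (x * R * exp b) * cis (\<theta> - \<alpha> - a)"
    
    proof -
      have "kk z = of_real (x * R) * cis \<theta> * (of_real (exp b) * cis (- \<alpha> - a))"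
        unfolding kk_def exps by (simp only: zpol[symmetric])
      also have "\<dots> = of_real (x * R * exp b) * (cis \<theta> * cis (- \<alpha> - a))" by (simp only: of_real_mult mult_ac)
      finally show ?thesis by (simp add: cis_mult algebra_simps)
    qed
    have th: "\<bar>\<theta> - \<alpha>\<bar> \<le> \<kappa>" "sgn x * (\<theta> - \<alpha>) \<le> sgn x * a"
      using gr(1)[OF x] gr(2)[OF x] z(2)
      unfolding \<theta>_def m_def a_def x_def[symmetric] zx[symmetric] by auto
    have "x * sin (\<theta> - \<alpha> - a) \<le> 0"
    proof (cases "x > 0")
      case True
      then have "\<theta> - \<alpha> - a \<le> 0" "- pi \<le> \<theta> - \<alpha> - a" using th ab kap pi_gt_zero by auto
      then have "sin (- (\<theta> - \<alpha> - a)) \<ge> 0" by (intro sin_ge_zero) auto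
      then have "sin (\<theta> - \<alpha> - a) \<le> 0" by (simp only: sin_minus)
      with True show ?thesis by (simp add: mult_nonneg_nonpos)
    next
      case False
      then have "\<theta> - \<alpha> - a \<ge> 0" "\<theta> - \<alpha> - a \<le> pi" using th ab kap x pi_gt_zero by (auto simp: sgn_if)
      then have "sin (\<theta> - \<alpha> - a) \<ge> 0" by (intro sin_ge_zero)
      with False show ?thesis by (simp add: mult_nonpos_nonneg)
    qed
    then have "(R * exp b) * (x * sin (\<theta> - \<alpha> - a)) \<le> 0" using R mult_nonneg_nonpos[of "R * exp b"] by simp
    then have "Im (kk z) \<le> 0" by (simp add: kz mult_ac)
    moreover have "Re (qq z) > 0"
    proof -
      have "qq z = of_real ((x * R)\<^sup>2) * cis (2 * (\<theta> - \<alpha>))"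
      proof -
        have "qq z = (of_real (x * R) * cis \<theta>)\<^sup>2 * cis (- 2 * \<alpha>)" unfolding qq_def by (simp only: zpol[symmetric])
        also have "\<dots> = of_real ((x * R)\<^sup>2) * (cis (2 * \<theta>) * cis (- 2 * \<alpha>))"
          using power2_eq_square[of "cis \<theta>"] by (simp add: power_mult_distrib cis_mult)
        finally show ?thesis by (simp add: cis_mult algebra_simps)
      qed
      moreover have "cos (2 * (\<theta> - \<alpha>)) > 0" using th kap pi_gt_zero by (intro cos_gt_zero_pi) auto
      ultimately show ?thesis using x R by simp
    qed
    ultimately show ?thesis by (simp add: w_def)
  qed

  \<comment> \<open>Comparison of the barrier with \<open>Im f\<close> near 0\<close>
  define \<delta> where "\<delta> = min \<rho> r / 2"
  have del: "0 < \<delta>" "\<delta> < \<rho>" "\<delta> < r" "\<delta> < 1" using rho r(1) by (auto simp: \<delta>_def min_def)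
  \<comment> \<open>On the circle of radius \<open>\<delta>\<close> the barrier is negative at the
    graph, so it is nonnegative only on a compact part of \<open>S\<close>. There
    \<open>Im f\<close> is positive and continuous, and a multiple of it dominates the
    barrier.\<close>
  have "\<exists>C\<ge>1. \<forall>z. norm z = \<delta> \<longrightarrow> \<psi> (Re z) \<le> Im z \<longrightarrow> 0 \<le> w z \<longrightarrow> z \<in> S \<and> w z \<le> C * Im (f z)"
  proof -
    define Kc where "Kc = {z \<in> sphere 0 \<delta>. \<psi> (Re z) \<le> Im z}"
    have ReI: "Re z \<in> {-1..1}" if "z \<in> sphere 0 \<delta>" for z
      using that abs_Re_le_cmod[of z] del by (auto simp: abs_le_iff)
    have cpsi: "continuous_on (sphere 0 \<delta>) (\<lambda>z. \<psi> (Re z))"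
      by (rule continuous_on_compose2[OF cont]) (use ReI in \<open>auto intro!: continuous_intros\<close>)
    have "closed Kc" unfolding Kc_def
      by (rule continuous_on_closed_Collect_le[OF cpsi]) (auto intro!: continuous_intros)
    moreover have "bounded Kc"
      by (rule bounded_subset[of "sphere 0 \<delta>"]) (auto simp: Kc_def)
    ultimately have Kc: "compact Kc" by (simp add: compact_eq_bounded_closed)
    have KcV: "Kc \<subseteq> V" using above_V ReI del by (fastforce simp: Kc_def)
    define K1 where "K1 = {z \<in> Kc. 0 \<le> w z}"
    have cw: "continuous_on Kc w" using contw KcV continuous_on_subset by blast
    have "closed K1" unfolding K1_def
      by (rule continuous_on_closed_Collect_le[OF _ cw compact_imp_closed[OF Kc]]) (intro continuous_intros)
    moreover have "bounded K1"
      by (rule bounded_subset[OF compact_imp_bounded[OF Kc]]) (auto simp: K1_def)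
    ultimately have K1: "compact K1" by (simp add: compact_eq_bounded_closed)
    have K1S: "z \<in> S" if "z \<in> K1" for z
    proof -
      have "norm z = \<delta>" "\<psi> (Re z) \<le> Im z" "0 \<le> w z" using that by (auto simp: K1_def Kc_def)
      moreover from this have "Im z \<noteq> \<psi> (Re z)" using w_graph[of z] abs_Re_le_cmod[of z] del by auto
      ultimately show ?thesis using graph[of z] del by auto
    qed
    have fp: "0 < Im (f z)" if "z \<in> K1" for z
      using r(2)[OF K1S[OF that]] that del by (auto simp: K1_def Kc_def)
    have cf: "continuous_on K1 (\<lambda>z. w z / Im (f z))"
    proof (intro continuous_on_divide continuous_on_subset[OF cw] continuous_on_Im)
      show "continuous_on K1 f"
        using holomorphic_on_imp_continuous_on[OF f] K1S continuous_on_subset by blast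
      show "K1 \<subseteq> Kc" by (auto simp: K1_def)
    qed (use fp in force)
    obtain C where "\<forall>y\<in>(\<lambda>z. w z / Im (f z)) ` K1. norm y \<le> C"
      using compact_imp_bounded[OF compact_continuous_image[OF cf K1]] unfolding bounded_iff by blast
    then have C: "w z / Im (f z) \<le> C" if "z \<in> K1" for z
      using that by (metis abs_le_D1 imageI real_norm_def)
    show ?thesis
    proof (intro exI[of _ "max 1 C"] conjI allI impI)
      fix z assume z: "norm z = \<delta>" "\<psi> (Re z) \<le> Im z" "0 \<le> w z"
      then have zK: "z \<in> K1" by (simp add: K1_def Kc_def)
      show "z \<in> S" by (rule K1S[OF zK])
      have "w z / Im (f z) \<le> max 1 C" using C[OF zK] by simp
      then show "w z \<le> max 1 C * Im (f z)" using fp[OF zK] by (simp add: pos_divide_le_eq)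
    qed simp
  qed
  then obtain C where C: "C \<ge> 1" "\<And>z. norm z = \<delta> \<Longrightarrow> \<psi> (Re z) \<le> Im z \<Longrightarrow> 0 \<le> w z \<Longrightarrow> z \<in> S \<and> w z \<le> C * Im (f z)"
    by blast
  define D where "D = S \<inter> ball 0 \<delta>"
  have DV: "D \<subseteq> V"
  proof
    fix z assume "z \<in> D"
    then have z: "z \<in> S" "norm z < \<delta>" by (auto simp: D_def)
    then have "\<psi> (Re z) < Im z" using graph[of z] del by auto
    moreover from this have "z \<noteq> 0" using psi0 by auto
    ultimately show "z \<in> V" using above_V[of z] z abs_Re_le_cmod[of z] del by auto
  qed
  define H where "H z = - \<i> * kk z - qq z + \<i> * of_real C * f z" for z
  have ReH: "Re (H z) = w z - C * Im (f z)" for z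
    by (simp add: H_def w_def)
  have H_le: "Re (H z) \<le> 0" if zD: "z \<in> D" for z
  proof (rule Re_le_of_eventually_at_frontier[of D H])
    show "open D" using assms(1) by (simp add: D_def open_Int)
    show "bounded D" unfolding D_def by (simp add: bounded_Int)
    show "H holomorphic_on D"
      unfolding H_def using hol DV f
      by (intro holomorphic_intros holomorphic_on_subset[OF hol(1)] holomorphic_on_subset[OF hol(2)] holomorphic_on_subset[OF f])
        (auto simp: D_def)
    show "z \<in> D" by fact
    fix \<xi> e assume xi: "\<xi> \<in> frontier D" and e: "(0::real) < e"
    have fD: "\<forall>\<^sub>F z in at \<xi> within D. z \<in> D" by (simp add: eventually_at_filter)
    have fDpos: "\<forall>\<^sub>F z in at \<xi> within D. 0 < Im (f z)"
      using fD by eventually_elim (use r(2) del in \<open>auto simp: D_def\<close>)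
    have xcl: "\<xi> \<in> closure D" using xi by (simp add: frontier_def)
    have "closure D \<subseteq> cball 0 \<delta>" by (rule closure_minimal) (auto simp: D_def)
    with xcl have xn: "norm \<xi> \<le> \<delta>" by auto
    have xpsi: "\<psi> (Re \<xi>) \<le> Im \<xi>"
    proof (rule ccontr)
      assume neg: "\<not> \<psi> (Re \<xi>) \<le> Im \<xi>"
      have "Re z \<in> {-1..1}" if "z \<in> cball 0 \<delta>" for z
        using that abs_Re_le_cmod[of z] del by (auto simp: abs_le_iff)
      then have c1: "continuous_on (cball 0 \<delta>) (\<lambda>z. \<psi> (Re z))"
        by (intro continuous_on_compose2[OF cont]) (auto intro!: continuous_intros)
      have "closed {z \<in> cball 0 \<delta>. \<psi> (Re z) \<le> Im z}"
        by (rule continuous_on_closed_Collect_le[OF c1]) (auto intro!: continuous_intros)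
      moreover have "D \<subseteq> {z \<in> cball 0 \<delta>. \<psi> (Re z) \<le> Im z}"
        using graph del by (auto simp: D_def intro: less_imp_le)
      ultimately have "closure D \<subseteq> {z \<in> cball 0 \<delta>. \<psi> (Re z) \<le> Im z}" by (rule closure_minimal[rotated])
      with xcl neg show False by blast
    qed
    show "\<forall>\<^sub>F z in at \<xi> within D. Re (H z) \<le> e"
    \<comment> \<open>At 0 the barrier tends to 0, and at the other graph points it is negative. In
      both cases the positivity of \<open>Im f\<close> inside is enough to bound
      \<open>Re H\<close>.\<close>
    proof (cases "\<xi> = 0")
      case True
      have lim0: "((\<lambda>z. norm z * exp \<kappa> + (norm z)\<^sup>2) \<longlongrightarrow> norm (0::complex) * exp \<kappa> + (norm (0::complex))\<^sup>2) (at 0 within D)"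
        by (intro tendsto_intros)
      then have "\<forall>\<^sub>F z in at 0 within D. norm z * exp \<kappa> + (norm z)\<^sup>2 < e"
        using e by (intro order_tendstoD(2)[OF lim0]) auto
      with fD fDpos show ?thesis unfolding True
      proof eventually_elim
        case (elim z)
        have "norm (kk z) \<le> norm z * exp \<kappa>"
        proof -
          have "Im (A z) \<le> \<kappa>" using A(2)[of z] elim(1) DV abs_Im_le_cmod[of "A z"] by fastforce
          then show ?thesis by (simp add: kk_def norm_mult norm_exp mult_left_mono)
        qed
        moreover have "norm (qq z) = (norm z)\<^sup>2" by (simp add: qq_def norm_mult norm_power)
        moreover have "w z \<le> norm (kk z) + norm (qq z)"
          unfolding w_def using abs_Im_le_cmod[of "kk z"] abs_Re_le_cmod[of "qq z"] by linarith
        moreover have "0 < C * Im (f z)" using elim C(1) by simp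
        ultimately show ?case using elim unfolding ReH by linarith
      qed
    next
      case False
      have xV: "\<xi> \<in> V" using above_V[OF False _ xpsi] xn del abs_Re_le_cmod[of \<xi>] by auto
      have limw: "(w \<longlongrightarrow> w \<xi>) (at \<xi> within D)"
        using contw xV DV by (meson continuous_on_def tendsto_within_subset)
      show ?thesis
      proof (cases "w \<xi> < 0")
        case True
        from order_tendstoD(2)[OF limw this] fDpos show ?thesis
        proof eventually_elim
          case (elim z)
          then have "0 < C * Im (f z)" using C(1) by simp
          with elim e show ?case unfolding ReH by linarith
        qed
      next
        case w0: False
        have "\<psi> (Re \<xi>) \<noteq> Im \<xi>" using w_graph[OF False] w0 xn del abs_Re_le_cmod[of \<xi>] by force
        then have xS: "\<xi> \<in> S" using xpsi graph[of \<xi>] xn del by auto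
        have "norm \<xi> = \<delta>"
        proof (rule ccontr)
          assume "norm \<xi> \<noteq> \<delta>"
          then have "\<xi> \<in> D" using xn xS by (simp add: D_def)
          moreover have "open D" using assms(1) by (simp add: D_def open_Int)
          ultimately show False using xi by (simp add: frontier_def interior_open)
        qed
        then have lt: "w \<xi> - C * Im (f \<xi>) < e" using C(2)[of \<xi>] xpsi w0 e by auto
        have "((\<lambda>z. w z - C * Im (f z)) \<longlongrightarrow> w \<xi> - C * Im (f \<xi>)) (at \<xi> within D)"
        proof (intro tendsto_intros limw)
          have "(f \<longlongrightarrow> f \<xi>) (at \<xi> within S)"
            using holomorphic_on_imp_continuous_on[OF f] xS by (simp add: continuous_on_def)
          then show "(f \<longlongrightarrow> f \<xi>) (at \<xi> within D)"
            by (rule tendsto_within_subset) (auto simp: D_def)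
        qed
        from order_tendstoD(2)[OF this lt] show ?thesis by eventually_elim (simp add: ReH)
      qed
    qed
  qed

  \<comment> \<open>Linear growth along the imaginary axis against a vanishing derivative\<close>
  define c0 where "c0 = exp (- \<kappa>) * cos (\<bar>\<alpha>\<bar> + \<kappa>)"
  have c0: "c0 > 0" unfolding c0_def using kap by (intro mult_pos_pos cos_gt_zero_pi) auto
  have lowerf: "c0 * t - t\<^sup>2 \<le> C * Im (f (\<i> * of_real t))" if t: "0 < t" "t < \<delta>" for t
  proof -
    define z where "z = \<i> * complex_of_real t"
    have z: "Re z = 0" "Im z = t" "norm z = t" using t by (auto simp: z_def norm_mult)
    then have zD: "z \<in> D" using graph[of z] t del psi0 by (auto simp: D_def)
    then have zV: "z \<in> V" using DV by blast
    define a b where "a = Re (A z)" and "b = Im (A z)"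
    have ab: "\<bar>a\<bar> \<le> \<kappa>" "\<bar>b\<bar> \<le> \<kappa>"
      using A(2)[OF zV] abs_Re_le_cmod[of "A z"] abs_Im_le_cmod[of "A z"] by (simp_all add: a_def b_def)
    have exps: "exp (- \<i> * (of_real \<alpha> + A z)) = of_real (exp b) * cis (- \<alpha> - a)"
      by (simp add: complex_eq_iff a_def b_def Re_exp Im_exp cos_diff sin_diff cos_add sin_add)
    have "Im (kk z) = t * (exp b * cos (\<alpha> + a))"
      unfolding kk_def exps using cos_minus[of "\<alpha> + a"] by (simp add: z_def)
    moreover have "exp (- \<kappa>) * cos (\<bar>\<alpha>\<bar> + \<kappa>) \<le> exp b * cos (\<alpha> + a)"
    proof (rule mult_mono)
      have "cos (\<bar>\<alpha>\<bar> + \<kappa>) \<le> cos \<bar>\<alpha> + a\<bar>"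
        using ab kap by (intro cos_monotone_0_pi_le) auto
      then show "cos (\<bar>\<alpha>\<bar> + \<kappa>) \<le> cos (\<alpha> + a)" by simp
      show "0 \<le> cos (\<bar>\<alpha>\<bar> + \<kappa>)" using kap by (intro cos_ge_zero) auto
    qed (use ab in auto)
    ultimately have "c0 * t \<le> Im (kk z)" using t by (simp add: c0_def mult_left_mono mult.commute)
    moreover have "\<bar>Re (qq z)\<bar> \<le> t\<^sup>2"
      using abs_Re_le_cmod[of "qq z"] z by (simp add: qq_def norm_mult norm_power)
    moreover have "w z \<le> C * Im (f z)" using H_le[OF zD] by (simp add: ReH)
    ultimately show ?thesis unfolding w_def z_def[symmetric] by linarith
  qed
  \<comment> \<open>For \<open>t \<le> c0 / 4\<close> the lower bound
    \<open>c0 * t - t\<^sup>2\<close> exceeds \<open>C * \<eta> * t = c0 * t / 4\<close>, the most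
    that the derivative bound allows.\<close>
  define \<eta> where "\<eta> = c0 / (4 * C)"
  have eta: "\<eta> > 0" using c0 C(1) by (simp add: \<eta>_def)
  obtain d where d: "d > 0" "\<And>z. z \<in> S \<Longrightarrow> norm z < d \<Longrightarrow> norm (deriv f z) \<le> \<eta>"
  proof -
    have "\<forall>\<^sub>F z in at 0 within S. norm (deriv f z) < \<eta>"
      using df0 eta unfolding tendsto_iff by simp
    then obtain d where "d > 0" "\<forall>z\<in>S. z \<noteq> 0 \<and> dist z 0 < d \<longrightarrow> norm (deriv f z) < \<eta>"
      unfolding eventually_at by blast
    moreover have "0 \<notin> S" using graph[of 0] psi0 by simp
    ultimately show thesis by (intro that[of d]) (auto simp: less_imp_le)
  qed
  define t where "t = min (min d \<delta> / 2) (c0 / 4)"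
  have t: "0 < t" "t < d" "t < \<delta>" "t \<le> c0 / 4" using d(1) del c0 by (auto simp: t_def min_def)
  have inS: "\<i> * of_real s \<in> S" "norm (\<i> * of_real s :: complex) = s" if "0 < s" "s \<le> t" for s
    using that t del graph[of "\<i> * of_real s"] psi0 by (auto simp: norm_mult)
  \<comment> \<open>0 lies outside \<open>S\<close>, so the derivative bound is integrated from some
    \<open>s > 0\<close>, and the limit of \<open>Im f\<close> is used as \<open>s\<close> tends to
    0.\<close>
  have small: "Im (f (\<i> * of_real t)) \<le> Im (f (\<i> * of_real s)) + \<eta> * t" if s: "0 < s" "s \<le> t" for s
  proof -
    define I where "I = (\<lambda>x. \<i> * complex_of_real x) ` {s..t}"
    have "convex I" unfolding I_def
      by (intro convex_linear_image linearI) (auto simp: algebra_simps scaleR_conv_of_real)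
    have IS: "z \<in> S \<and> norm z < d" if "z \<in> I" for z
      using that inS s t by (auto simp: I_def)
    have "norm (f (\<i> * of_real t) - f (\<i> * of_real s)) \<le> \<eta> * norm (\<i> * of_real t - \<i> * complex_of_real s)"
    proof (rule field_differentiable_bound[OF \<open>convex I\<close>, of f "deriv f"])
      show "(f has_field_derivative deriv f z) (at z within I)" if "z \<in> I" for z
        using holomorphic_derivI[OF f assms(1)] IS[OF that] by blast
      show "norm (deriv f z) \<le> \<eta>" if "z \<in> I" for z using d(2) IS[OF that] by blast
    qed (use s in \<open>auto simp: I_def\<close>)
    also have "norm (\<i> * of_real t - \<i> * complex_of_real s) = t - s"
      using s by (simp add: norm_mult flip: right_diff_distrib of_real_diff)
    also have "\<eta> * (t - s) \<le> \<eta> * t" using s eta by (intro mult_left_mono) auto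
    finally show ?thesis using abs_Im_le_cmod[of "f (\<i> * of_real t) - f (\<i> * of_real s)"] by simp
  qed
  have lim_i: "((\<lambda>s. Im (f (\<i> * of_real s))) \<longlongrightarrow> 0) (at_right 0)"
  proof (rule filterlim_compose[OF f0])
    show "filterlim (\<lambda>s. \<i> * complex_of_real s) (at 0 within S) (at_right 0)"
      unfolding filterlim_at
    proof
      have "((\<lambda>s. \<i> * complex_of_real s) \<longlongrightarrow> \<i> * of_real 0) (at_right 0)" by (intro tendsto_intros)
      then show "((\<lambda>s. \<i> * complex_of_real s) \<longlongrightarrow> 0) (at_right 0)" by simp
      show "\<forall>\<^sub>F s in at_right 0. \<i> * complex_of_real s \<in> S \<and> \<i> * complex_of_real s \<noteq> 0"
        using t(1) inS by (intro eventually_at_rightI[of 0 t]) auto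
    qed
  qed
  have "Im (f (\<i> * of_real t)) \<le> 0 + \<eta> * t"
  proof (rule tendsto_lowerbound)
    show "((\<lambda>s. Im (f (\<i> * of_real s)) + \<eta> * t) \<longlongrightarrow> 0 + \<eta> * t) (at_right 0)"
      by (intro tendsto_intros lim_i)
    show "\<forall>\<^sub>F s in at_right 0. Im (f (\<i> * of_real t)) \<le> Im (f (\<i> * of_real s)) + \<eta> * t"
      using t(1) small by (intro eventually_at_rightI[of 0 t]) auto
  qed simp
  then have "C * Im (f (\<i> * of_real t)) \<le> C * (\<eta> * t)" using C(1) by (intro mult_left_mono) auto
  also have "\<dots> = c0 / 4 * t" using C(1) by (simp add: \<eta>_def)
  finally have "c0 * t - t\<^sup>2 \<le> c0 / 4 * t" using lowerf[OF t(1,3)] by linarith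
  moreover have "t\<^sup>2 \<le> c0 / 4 * t" using t by (simp add: power2_eq_square mult_right_mono)
  moreover have "c0 * t > 0" using c0 t by simp
  ultimately show False by linarith
qed

section \<open>Dini data from the mean oscillation\<close>

lemma integral_real_interval_le:
  fixes f :: "real \<Rightarrow> real"
  assumes "a \<le> b" "continuous_on {a..b} f" "\<And>x. x \<in> {a..b} \<Longrightarrow> f x \<le> B"
  shows "integral {a..b} f \<le> B * (b - a)"
proof -
  have "integral {a..b} f \<le> integral {a..b} (\<lambda>x. B)"
    using assms by (intro integral_le integrable_continuous_interval) auto
  then show ?thesis using assms(1) by (simp add: mult.commute)
qed

lemma mean_over_open_interval:
  fixes f :: "real \<Rightarrow> real"
  assumes "a < b"
  shows "mean_over {a<..<b} f = integral {a..b} f / (b - a)"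
  using assms integral_open_interval[of a b f] by (simp add: mean_over_def)

text \<open>A real supremum bounds its members only if the family is bounded above; here
  \<open>g\<close> is bounded by some \<open>B\<close> on the compact interval, and so every
  oscillation is at most \<open>2 * B\<close>. The conditions on \<open>x\<close> and
  \<open>r\<close> keep the window from being cut off, so that it has length
  \<open>2 * r\<close>.\<close>

lemma mean_oscillation_upper:
  assumes g: "continuous_on {-1..1} g" and r: "0 < r" and x: "- 1 \<le> x - r" "x + r \<le> 1"
  defines "c \<equiv> integral {x - r..x + r} g / (2 * r)"
  shows "integral {x - r..x + r} (\<lambda>t. \<bar>g t - c\<bar>) \<le> 2 * r * mean_oscillation g r"
    and "0 \<le> mean_oscillation g r"
proof -
  obtain B where B: "\<And>t. t \<in> {-1..1} \<Longrightarrow> \<bar>g t\<bar> \<le> B"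
    using compact_imp_bounded[OF compact_continuous_image[OF g compact_Icc]] unfolding bounded_iff by fastforce
  define osc where "osc y = mean_over (window y r) (\<lambda>t. \<bar>g t - mean_over (window y r) g\<bar>)" for y
  have win: "window y r = {max (y - r) (-1)<..<min (y + r) 1}" for y
    by (auto simp: window_def)
  have le: "osc y \<le> 2 * B" if y: "y \<in> {-1<..<1}" for y
  proof -
    define a b where "a = max (y - r) (-1)" and "b = min (y + r) 1"
    have ab: "a < b" "{a..b} \<subseteq> {-1..1}" using y r by (auto simp: a_def b_def)
    define m where "m = mean_over (window y r) g"
    have m: "m = integral {a..b} g / (b - a)"
      unfolding m_def win a_def[symmetric] b_def[symmetric] using ab by (simp add: mean_over_open_interval)
    have cg: "continuous_on {a..b} g" using g ab(2) continuous_on_subset by blast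
    have "integral {a..b} g \<le> B * (b - a)"
      using ab B by (intro integral_real_interval_le cg) (auto dest!: abs_le_D1 simp: subset_iff)
    moreover have "integral {a..b} (\<lambda>t. - g t) \<le> B * (b - a)"
      using ab B by (intro integral_real_interval_le continuous_intros cg) (auto dest!: abs_le_D2 simp: subset_iff)
    ultimately have "\<bar>integral {a..b} g\<bar> \<le> B * (b - a)" by (simp add: abs_le_iff)
    then have mB: "\<bar>m\<bar> \<le> B" using ab by (simp add: m pos_divide_le_eq)
    have "integral {a..b} (\<lambda>t. \<bar>g t - m\<bar>) \<le> (2 * B) * (b - a)"
    proof (rule integral_real_interval_le)
      fix t assume "t \<in> {a..b}"
      then have "\<bar>g t\<bar> \<le> B" using B ab by blast
      then show "\<bar>g t - m\<bar> \<le> 2 * B" using mB by linarith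
    qed (use ab in \<open>auto intro!: continuous_intros cg\<close>)
    then show ?thesis
      unfolding osc_def m_def[symmetric] unfolding win a_def[symmetric] b_def[symmetric]
      using ab by (simp add: mean_over_open_interval pos_divide_le_eq)
  qed
  have bdd: "bdd_above (osc ` {-1<..<1})" using le by (intro bdd_aboveI[of _ "2 * B"]) auto
  have upper: "osc y \<le> mean_oscillation g r" if "y \<in> {-1<..<1}" for y
    unfolding mean_oscillation_def osc_def[symmetric] using that bdd by (rule cSUP_upper)
  have xr: "x \<in> {-1<..<1}" using x r by auto
  have win': "window x r = {x - r<..<x + r}" using x by (auto simp: window_def)
  have c: "mean_over (window x r) g = c" unfolding win' c_def using r by (simp add: mean_over_open_interval)
  have eq: "osc x = integral {x - r..x + r} (\<lambda>t. \<bar>g t - c\<bar>) / (2 * r)"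
    unfolding osc_def c unfolding win' using r by (simp add: mean_over_open_interval)
  show "integral {x - r..x + r} (\<lambda>t. \<bar>g t - c\<bar>) \<le> 2 * r * mean_oscillation g r"
    using upper[OF xr] r unfolding eq by (simp add: pos_divide_le_eq mult_ac)
  have "{x - r..x + r} \<subseteq> {-1..1}" using x by auto
  then have "0 \<le> integral {x - r..x + r} (\<lambda>t. \<bar>g t - c\<bar>)"
    using g by (intro integral_nonneg integrable_continuous_interval continuous_intros continuous_on_subset[OF g]) auto
  then show "0 \<le> mean_oscillation g r" using upper[OF xr] r unfolding eq
    by (meson divide_nonneg_pos mult_pos_pos order_trans zero_less_numeral)
qed

text \<open>The function \<open>\<phi> y - c * y\<close> has derivative \<open>g - c\<close>, so its
  increments are at most the integral of \<open>\<bar>g - c\<bar>\<close> over the window: an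
  integral oscillation of the slope gives a uniform bound on the distance to the line of mean
  slope.\<close>

lemma affine_deviation_le_oscillation:
  assumes \<phi>: "\<And>x. x \<in> {-1..1} \<Longrightarrow> (\<phi> has_real_derivative g x) (at x within {-1..1})"
    and g: "continuous_on {-1..1} g" and r: "0 < r" and x: "- 1 \<le> x - r" "x + r \<le> 1"
  defines "c \<equiv> integral {x - r..x + r} g / (2 * r)"
  assumes t: "\<bar>t\<bar> \<le> r"
  shows "\<bar>\<phi> (x + t) - \<phi> x - c * t\<bar> \<le> 2 * r * mean_oscillation g r"
proof -
  define P where "P y = \<phi> y - c * y" for y
  have sub: "{x - r..x + r} \<subseteq> {-1..1}" using x by auto
  have cg: "continuous_on {x - r..x + r} (\<lambda>t. g t - c)"
    using g sub by (intro continuous_intros continuous_on_subset[OF g])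
  have main: "\<bar>P b - P a\<bar> \<le> integral {x - r..x + r} (\<lambda>t. \<bar>g t - c\<bar>)"
    if ab: "a \<le> b" "x - r \<le> a" "b \<le> x + r" for a b
  proof -
    have subab: "{a..b} \<subseteq> {x - r..x + r}" using ab by auto
    have "((\<lambda>y. g y - c) has_integral (P b - P a)) {a..b}"
    proof (rule fundamental_theorem_of_calculus[OF ab(1)])
      fix y assume y: "y \<in> {a..b}"
      have "(\<phi> has_real_derivative g y) (at y within {a..b})"
        using \<phi>[of y] y subab sub by (meson DERIV_subset order_trans subsetD)
      then have "(P has_real_derivative g y - c) (at y within {a..b})"
        unfolding P_def by (auto intro!: derivative_eq_intros)
      then show "(P has_vector_derivative g y - c) (at y within {a..b})"
        by (simp add: has_real_derivative_iff_has_vector_derivative)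
    qed
    then have "P b - P a = integral {a..b} (\<lambda>y. g y - c)" by (simp add: integral_unique)
    also have "\<bar>\<dots>\<bar> \<le> integral {a..b} (\<lambda>y. \<bar>g y - c\<bar>)"
    proof -
      have cab: "continuous_on {a..b} (\<lambda>y. g y - c)" using cg subab by (rule continuous_on_subset)
      have "norm (integral {a..b} (\<lambda>y. g y - c)) \<le> integral {a..b} (\<lambda>y. \<bar>g y - c\<bar>)"
        by (rule integral_norm_bound_integral)
          (use cab in \<open>auto intro!: integrable_continuous_interval continuous_on_rabs\<close>)
      then show ?thesis by simp
    qed
    also have "\<dots> \<le> integral {x - r..x + r} (\<lambda>t. \<bar>g t - c\<bar>)"
      using cg subab by (intro integral_subset_le integrable_continuous_interval continuous_on_rabs)
        (auto intro: continuous_on_subset)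
    finally show ?thesis .
  qed
  have "\<bar>P (x + t) - P x\<bar> \<le> integral {x - r..x + r} (\<lambda>t. \<bar>g t - c\<bar>)"
    using main[of x "x + t"] main[of "x + t" x] t by (cases "0 \<le> t") (auto simp: abs_minus_commute)
  also have "\<dots> \<le> 2 * r * mean_oscillation g r"
    unfolding c_def by (rule mean_oscillation_upper(1)[OF g r x])
  finally show ?thesis by (simp add: P_def algebra_simps)
qed

text \<open>Only an integral of \<open>h\<close> is controlled, so the radius is chosen within each
  dyadic interval \<open>J k\<close> instead of being fixed. If \<open>h\<close> exceeded
  \<open>\<epsilon> k\<close> on all of \<open>J k\<close>, which has length \<open>s k\<close> and
  satisfies \<open>r < 2 * s k\<close>, the integral \<open>I k\<close> would be at least
  \<open>\<epsilon> k / 2\<close>, against the choice of \<open>\<epsilon>\<close>. The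
  \<open>I k\<close> are summable as integrals over disjoint sets.\<close>

lemma dyadic_dini_selection:
  fixes h :: "real \<Rightarrow> real"
  assumes int: "set_integrable lborel {0<..<1} (\<lambda>r. h r / r)"
    and nonneg: "\<And>r. 0 < r \<Longrightarrow> r < 2 * \<sigma> \<Longrightarrow> 0 \<le> h r"
    and sig: "0 < \<sigma>" "2 * \<sigma> < 1"
  obtains \<epsilon> where "\<And>k. 0 \<le> \<epsilon> k" "summable \<epsilon>"
    "\<And>k::nat. \<exists>r\<in>{\<sigma> * (1/2)^k..<2 * (\<sigma> * (1/2)^k)}. h r \<le> \<epsilon> k"
proof -
  define s where "s k = \<sigma> * (1/2)^k" for k :: nat
  have s: "0 < s k" "s k \<le> \<sigma>" "s (Suc k) = s k / 2" for k
    using sig by (simp_all add: s_def power_le_one mult_left_le)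
  define J where "J k = {s k..<2 * s k}" for k
  define q where "q r = h r / r" for r
  have Jsub: "J k \<subseteq> {0<..<1}" "J k \<subseteq> {0<..<2 * \<sigma>}" for k using s[of k] sig by (auto simp: J_def)
  have qpos: "0 \<le> q r" if "r \<in> J k" for r k
    using that nonneg[of r] Jsub(2)[of k] by (auto simp: q_def)
  have intJ: "set_integrable lborel (J k) q" for k
    unfolding q_def using Jsub(1) by (intro set_integrable_subset[OF int]) (auto simp: J_def)
  define I where "I k = (LINT r:J k|lborel. q r)" for k
  have I0: "0 \<le> I k" for k
    unfolding I_def set_lebesgue_integral_def using qpos
    by (intro integral_nonneg_AE AE_I2) (auto simp: indicator_def)
  have s_mono: "s j \<le> s i" if "i \<le> j" for i j
    using that sig by (simp add: s_def power_decreasing)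
  have disj: "disjoint_family J"
    unfolding disjoint_family_on_def
  proof (intro ballI impI)
    have "J i \<inter> J j = {}" if "i < j" for i j
      using s_mono[of "Suc i" j] that s(3)[of i] by (auto simp: J_def)
    then show "J i \<inter> J j = {}" if "i \<noteq> j" for i j using that by (metis Int_commute nat_neq_iff)
  qed
  have U: "set_integrable lborel {0<..<2 * \<sigma>} q"
    unfolding q_def using sig by (intro set_integrable_subset[OF int]) auto
  have "sum I {..<n} \<le> (LINT r:{0<..<2 * \<sigma>}|lborel. q r)" for n
  proof -
    have "sum I {..<n} = (LINT r|lborel. (\<Sum>k<n. indicator (J k) r *\<^sub>R q r))"
      unfolding I_def set_lebesgue_integral_def
      using intJ unfolding set_integrable_def by (intro Bochner_Integration.integral_sum[symmetric]) auto
    also have "\<dots> \<le> (LINT r|lborel. indicator {0<..<2 * \<sigma>} r *\<^sub>R q r)"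
    proof (rule integral_mono)
      show "integrable lborel (\<lambda>r. \<Sum>k<n. indicator (J k) r *\<^sub>R q r)"
        using intJ unfolding set_integrable_def by (intro Bochner_Integration.integrable_sum) auto
      show "integrable lborel (\<lambda>r. indicator {0<..<2 * \<sigma>} r *\<^sub>R q r)"
        using U unfolding set_integrable_def .
      fix r :: real
      have "indicat_real (\<Union>k<n. J k) r = (\<Sum>k<n. indicator (J k) r)"
        by (rule indicator_UN_disjoint[OF _ disjoint_family_on_mono[OF _ disj]]) auto
      then have "(\<Sum>k<n. indicator (J k) r *\<^sub>R q r) = indicator (\<Union>k<n. J k) r * q r"
        by (simp add: sum_distrib_right)
      also have "\<dots> \<le> indicator {0<..<2 * \<sigma>} r * q r"
      proof (cases "r \<in> {0<..<2 * \<sigma>}")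
        case True
        then show ?thesis using nonneg[of r] by (auto simp: indicator_def q_def)
      next
        case False
        then have "r \<notin> (\<Union>k<n. J k)" using Jsub(2) by blast
        with False show ?thesis by simp
      qed
      finally show "(\<Sum>k<n. indicator (J k) r *\<^sub>R q r) \<le> indicator {0<..<2 * \<sigma>} r *\<^sub>R q r" by simp
    qed
    finally show ?thesis by (simp add: set_lebesgue_integral_def)
  qed
  then have sumI: "summable I" using I0 by (intro summableI_nonneg_bounded)
  \<comment> \<open>The summable term \<open>(1/2)^k\<close> makes the contradiction strict, also
    when \<open>I k\<close> is 0.\<close>
  define \<epsilon> where "\<epsilon> k = 2 * I k + (1/2)^k" for k
  show thesis
  proof
    show "0 \<le> \<epsilon> k" for k using I0[of k] by (simp add: \<epsilon>_def)
    show "summable \<epsilon>" unfolding \<epsilon>_def by (intro summable_add summable_mult sumI summable_geometric) auto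
    fix k
    show "\<exists>r\<in>{\<sigma> * (1/2)^k..<2 * (\<sigma> * (1/2)^k)}. h r \<le> \<epsilon> k"
    proof (rule ccontr)
      assume "\<not> ?thesis"
      then have big: "\<epsilon> k \<le> h r" if "r \<in> J k" for r using that by (force simp: J_def s_def)
      have eps: "0 \<le> \<epsilon> k" using I0[of k] by (simp add: \<epsilon>_def)
      have "\<epsilon> k / 2 = (LINT r:J k|lborel. \<epsilon> k / (2 * s k))"
        using s(1)[of k] by (simp add: J_def set_integral_const)
      also have "\<dots> \<le> (LINT r:J k|lborel. q r)"
      proof (rule set_integral_mono[OF _ intJ])
        show "set_integrable lborel (J k) (\<lambda>r. \<epsilon> k / (2 * s k))"
          unfolding J_def set_integrable_def using s(1)[of k]
          by (intro integrable_scaleR_left integrable_real_indicator) auto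
        fix r assume r: "r \<in> J k"
        have "\<epsilon> k / (2 * s k) \<le> \<epsilon> k / r"
          using r s(1)[of k] eps by (intro divide_left_mono) (auto simp: J_def)
        also have "\<dots> \<le> q r" unfolding q_def using big[OF r] r s(1)[of k] by (intro divide_right_mono) (auto simp: J_def)
        finally show "\<epsilon> k / (2 * s k) \<le> q r" .
      qed
      finally have "\<epsilon> k / 2 \<le> I k" by (simp add: I_def)
      then have "(1/2)^k \<le> (0::real)" by (simp add: \<epsilon>_def)
      moreover have "(0::real) < (1/2)^k" by (rule zero_less_power) simp
      ultimately show False by (metis not_le)
    qed
  qed
qed

text \<open>The mean slope over the window of the radius selected at order \<open>k\<close> serves
  as the slope of the fitted line at that order. Rescaling by \<open>\<sigma>\<close> brings this
  into the form that Hopf's lemma takes.\<close>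

lemma C1_DMO_profile_local:
  assumes "C1_DMO_profile \<phi>" "\<bar>x\<bar> < 1" "0 < R"
  obtains \<sigma> c \<epsilon> where "0 < \<sigma>" "\<sigma> < R" "\<bar>x\<bar> + \<sigma> < 1" "\<And>k. 0 \<le> \<epsilon> k" "summable \<epsilon>"
    "\<And>(k::nat) t. \<bar>t\<bar> \<le> (1/2)^k \<Longrightarrow>
      \<bar>(\<phi> (x + \<sigma> * t) - \<phi> x) / \<sigma> - c k * t\<bar> \<le> \<epsilon> k * (1/2)^k"
proof -
  obtain g where \<phi>: "\<And>x. x \<in> {-1..1} \<Longrightarrow> (\<phi> has_real_derivative g x) (at x within {-1..1})"
    and g: "continuous_on {-1..1} g" and int: "set_integrable lborel {0<..<1} (\<lambda>r. mean_oscillation g r / r)"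
    using assms(1) unfolding C1_DMO_profile_def by blast
  \<comment> \<open>The selected radii stay below \<open>2 * \<sigma>\<close>, so this choice keeps
    all windows inside [-1, 1].\<close>
  define \<sigma> where "\<sigma> = min (R / 2) ((1 - \<bar>x\<bar>) / 4)"
  have sig: "0 < \<sigma>" "\<sigma> < R" "\<bar>x\<bar> + 2 * \<sigma> < 1" using assms(2,3) by (auto simp: \<sigma>_def min_def field_simps)
  have range: "- 1 \<le> x - r" "x + r \<le> 1" if "r < 2 * \<sigma>" for r
    using sig(3) that by (auto simp: abs_if split: if_splits)
  obtain \<epsilon> where eps: "\<And>k. 0 \<le> \<epsilon> k" "summable \<epsilon>"
    and sel: "\<And>k::nat. \<exists>r\<in>{\<sigma> * (1/2)^k..<2 * (\<sigma> * (1/2)^k)}. mean_oscillation g r \<le> \<epsilon> k"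
  proof (rule dyadic_dini_selection[OF int, of \<sigma>])
    show "0 \<le> mean_oscillation g r" if "0 < r" "r < 2 * \<sigma>" for r
      by (rule mean_oscillation_upper(2)[OF g that(1) range[OF that(2)]])
    show "0 < \<sigma>" "2 * \<sigma> < 1" using sig by auto
  qed blast
  obtain \<rho> where rho: "\<And>k::nat. \<rho> k \<in> {\<sigma> * (1/2)^k..<2 * (\<sigma> * (1/2)^k)}" "\<And>k. mean_oscillation g (\<rho> k) \<le> \<epsilon> k"
    using sel by metis
  define c where "c k = integral {x - \<rho> k..x + \<rho> k} g / (2 * \<rho> k)" for k
  show thesis
  \<comment> \<open>The factor 4 is 2 from \<open>affine_deviation_le_oscillation\<close> times 2
    from \<open>\<rho> k < 2 * (\<sigma> * (1/2)^k)\<close>.\<close>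
  proof (rule that[of \<sigma> "\<lambda>k. 4 * \<epsilon> k" c])
    show "summable (\<lambda>k. 4 * \<epsilon> k)" using eps(2) by (intro summable_mult)
    show "0 \<le> 4 * \<epsilon> k" for k using eps(1)[of k] by simp
    show "\<bar>x\<bar> + \<sigma> < 1" using sig by simp
    fix k :: nat and t :: real assume t: "\<bar>t\<bar> \<le> (1/2)^k"
    have p: "0 < \<sigma> * (1/2)^k" "\<sigma> * (1/2)^k \<le> \<sigma>" using sig(1) by (simp_all add: power_le_one mult_left_le)
    have r: "0 < \<rho> k" "\<rho> k < 2 * \<sigma>" "\<rho> k \<le> 2 * (\<sigma> * (1/2)^k)" using rho(1)[of k] p by auto
    have "\<bar>\<sigma> * t\<bar> \<le> \<rho> k"
    proof -
      have "\<bar>\<sigma> * t\<bar> \<le> \<sigma> * (1/2)^k" using t sig(1) by (simp add: abs_mult)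
      then show ?thesis using rho(1)[of k] by simp
    qed
    then have "\<bar>\<phi> (x + \<sigma> * t) - \<phi> x - c k * (\<sigma> * t)\<bar> \<le> 2 * \<rho> k * mean_oscillation g (\<rho> k)"
      unfolding c_def by (intro affine_deviation_le_oscillation[OF \<phi> g r(1)] range[OF r(2)]) auto
    also have "\<dots> \<le> 2 * (2 * (\<sigma> * (1/2)^k)) * \<epsilon> k"
      using rho(2)[of k] r p eps(1)[of k] mean_oscillation_upper(2)[OF g r(1) range[OF r(2)]]
      by (intro mult_mono) auto
    finally have "\<bar>\<phi> (x + \<sigma> * t) - \<phi> x - c k * (\<sigma> * t)\<bar> / \<sigma> \<le> 4 * \<epsilon> k * (1/2)^k"
      using sig(1) by (simp add: pos_divide_le_eq mult_ac)
    moreover have "\<bar>\<phi> (x + \<sigma> * t) - \<phi> x - c k * (\<sigma> * t)\<bar> / \<sigma> = \<bar>(\<phi> (x + \<sigma> * t) - \<phi> x) / \<sigma> - c k * t\<bar>"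
    proof -
      have "(\<phi> (x + \<sigma> * t) - \<phi> x) / \<sigma> - c k * t = (\<phi> (x + \<sigma> * t) - \<phi> x - c k * (\<sigma> * t)) / \<sigma>"
        using sig(1) by (simp add: field_simps)
      then show ?thesis using sig(1) by simp
    qed
    ultimately show "\<bar>(\<phi> (x + \<sigma> * t) - \<phi> x) / \<sigma> - c k * t\<bar> \<le> 4 * \<epsilon> k * (1/2)^k" by simp
  qed (use sig in auto)
qed

section \<open>Boundary behaviour of conformal maps over a Lipschitz graph\<close>

text \<open>Outside the unit disc \<open>S\<close> is an arbitrary open set. It can thus be the
  whole rescaled domain, on which the conformal map lives, with graph information only near
  0.\<close>

locale graph_domain =
  fixes S :: "complex set" and \<psi> :: "real \<Rightarrow> real" and L :: real
  assumes open_S: "open S"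
    and L_nonneg: "0 \<le> L"
    and lipschitz: "\<bar>x\<bar> \<le> 1 \<Longrightarrow> \<bar>y\<bar> \<le> 1 \<Longrightarrow> \<bar>\<psi> x - \<psi> y\<bar> \<le> L * \<bar>x - y\<bar>"
    and psi_0: "\<psi> 0 = 0"
    and mem_S_iff: "norm w < 1 \<Longrightarrow> w \<in> S \<longleftrightarrow> \<psi> (Re w) < Im w"
begin

lemma Re_le_1: "norm w \<le> 1 \<Longrightarrow> \<bar>Re w\<bar> \<le> 1" for w :: complex
  using abs_Re_le_cmod[of w] by linarith

lemma continuous_psi: "continuous_on {-1..1} \<psi>"
proof (rule lipschitz_on_continuous_on[of L])
  show "L-lipschitz_on {-1..1} \<psi>"
    using lipschitz L_nonneg by (intro lipschitz_onI) (auto simp: dist_real_def abs_le_iff)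
qed

lemma continuous_height: "continuous_on (cball 0 1) (\<lambda>w. Im w - \<psi> (Re w))"
proof -
  have "Re w \<in> {-1..1}" if "w \<in> cball 0 1" for w
    using Re_le_1[of w] that by (simp add: abs_le_iff)
  then have "continuous_on (cball 0 1) (\<lambda>w. \<psi> (Re w))"
    by (intro continuous_on_compose2[OF continuous_psi]) (auto intro!: continuous_intros)
  then show ?thesis by (intro continuous_intros)
qed

lemma mem_closure_S_iff:
  assumes "norm w < 1"
  shows "w \<in> closure S \<longleftrightarrow> \<psi> (Re w) \<le> Im w"
proof
  assume w: "w \<in> closure S"
  show "\<psi> (Re w) \<le> Im w"
  proof (rule ccontr)
    assume neg: "\<not> \<psi> (Re w) \<le> Im w"
    have "continuous_on (ball 0 1) (\<lambda>w. Im w - \<psi> (Re w))"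
      using continuous_height continuous_on_subset ball_subset_cball by blast
    then have "open (ball 0 1 \<inter> (\<lambda>w. Im w - \<psi> (Re w)) -` {..<0})"
      by (rule continuous_open_preimage) auto
    moreover have "w \<in> ball 0 1 \<inter> (\<lambda>w. Im w - \<psi> (Re w)) -` {..<0}" using neg assms by simp
    ultimately obtain v where "v \<in> S" "v \<in> ball 0 1 \<inter> (\<lambda>w. Im w - \<psi> (Re w)) -` {..<0}"
      using w by (metis (no_types, lifting) Int_iff closure_iff_nhds_not_empty disjoint_iff order_refl)
    then show False using mem_S_iff[of v] by simp
  qed
next
  assume le: "\<psi> (Re w) \<le> Im w"
  have "\<exists>v\<in>S. dist v w < e" if "e > 0" for e
  proof -
    define d where "d = min (e / 2) ((1 - norm w) / 2)"
    have d: "0 < d" "d < e" "d < 1 - norm w" using that assms by (auto simp: d_def min_def field_simps)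
    have "norm (w + \<i> * of_real d) \<le> norm w + d"
      using norm_triangle_ineq[of w "\<i> * of_real d"] d by (simp add: norm_mult)
    then have "w + \<i> * of_real d \<in> S" using mem_S_iff[of "w + \<i> * of_real d"] d le by simp
    moreover have "dist (w + \<i> * of_real d) w < e" using d by (simp add: dist_norm norm_mult)
    ultimately show ?thesis by blast
  qed
  then show "w \<in> closure S" by (simp add: closure_approachable)
qed

lemma mem_frontier_S_iff: "norm w < 1 \<Longrightarrow> w \<in> frontier S \<longleftrightarrow> Im w = \<psi> (Re w)"
  using mem_closure_S_iff[of w] mem_S_iff[of w] open_S by (auto simp: frontier_def interior_open)

lemma abs_psi_le: "\<bar>x\<bar> \<le> 1 \<Longrightarrow> \<bar>\<psi> x\<bar> \<le> L * \<bar>x\<bar>"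
  using lipschitz[of x 0] psi_0 by simp

lemma height_change:
  assumes "norm z \<le> 1" "norm w \<le> 1"
  shows "\<bar>(Im w - \<psi> (Re w)) - (Im z - \<psi> (Re z))\<bar> \<le> (1 + L) * norm (w - z)"
proof -
  have "\<bar>\<psi> (Re w) - \<psi> (Re z)\<bar> \<le> L * \<bar>Re w - Re z\<bar>"
    using lipschitz Re_le_1 assms by blast
  also have "\<dots> \<le> L * norm (w - z)"
    using abs_Re_le_cmod[of "w - z"] L_nonneg by (intro mult_left_mono) auto
  finally show ?thesis
    using abs_Im_le_cmod[of "w - z"] by (simp add: algebra_simps)
qed

end

locale graph_domain_map = graph_domain +
  fixes g G :: "complex \<Rightarrow> complex"
  assumes g_holo: "g holomorphic_on S" and G_holo: "G holomorphic_on ball 0 1"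
    and g_disc: "z \<in> S \<Longrightarrow> norm (g z) < 1" and G_g: "z \<in> S \<Longrightarrow> G (g z) = z"
    and G_mem: "norm w < 1 \<Longrightarrow> G w \<in> S" and g_G: "norm w < 1 \<Longrightarrow> g (G w) = w"
begin

text \<open>The conformal map is proper: the image under \<open>G\<close> of the closed disc of
  radius \<open>1 - e\<close> is compact in \<open>S\<close>, hence misses a neighbourhood of
  \<open>\<xi>\<close>. This applies at every frontier point, on the graph or not.\<close>

lemma norm_g_near_frontier:
  assumes "\<xi> \<in> frontier S" "0 < e"
  shows "\<forall>\<^sub>F z in at \<xi> within S. 1 - e < norm (g z)"
proof -
  define K where "K = G ` cball 0 (1 - e)"
  have sub: "cball (0::complex) (1 - e) \<subseteq> ball 0 1" using assms(2) by auto
  have "compact K" unfolding K_def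
    using holomorphic_on_imp_continuous_on[OF G_holo] sub
    by (intro compact_continuous_image compact_cball) (rule continuous_on_subset)
  then have "open (- K)" by (simp add: compact_imp_closed open_Compl)
  moreover have "K \<subseteq> S" using G_mem sub by (auto simp: K_def subset_iff)
  then have "\<xi> \<in> - K" using assms(1) open_S by (auto simp: frontier_def interior_open)
  ultimately have "\<forall>\<^sub>F z in at \<xi> within S. z \<in> - K"
    by (rule topological_tendstoD[OF tendsto_ident_at])
  moreover have "\<forall>\<^sub>F z in at \<xi> within S. z \<in> S" by (simp add: eventually_at_filter)
  ultimately show ?thesis
  proof eventually_elim
    case (elim z)
    show ?case
    proof (rule ccontr)
      assume "\<not> 1 - e < norm (g z)"
      then have "G (g z) \<in> K" unfolding K_def by (intro imageI) auto
      then show False using elim G_g by simp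
    qed
  qed
qed

text \<open>The factor \<open>- \<i>\<close> turns the upward direction into the positive real axis,
  so the graph condition keeps \<open>w\<close> out of a sector about the negative axis. Outside
  that sector \<open>norm w + Re w\<close> is comparable with \<open>norm w\<close>, because
  \<open>(Im w)\<^sup>2 = (norm w + Re w) * (norm w - Re w)\<close>; half of it is the square of
  \<open>Re (csqrt w)\<close>.\<close>

lemma Re_csqrt_above_graph:
  assumes "norm q < 1" "norm z < 1" "Im q = \<psi> (Re q)" "z \<in> S"
  shows "- \<i> * (z - q) \<notin> \<real>\<^sub>\<le>\<^sub>0"
    and "sqrt (norm (z - q) / (4 * (1 + L\<^sup>2))) \<le> Re (csqrt (- \<i> * (z - q)))"
proof -
  define w where "w = - \<i> * (z - q)"
  have Rew: "Re w = Im (z - q)" "Im w = - Re (z - q)" by (simp_all add: w_def)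
  have nw: "norm w = norm (z - q)" by (simp add: w_def norm_mult norm_minus_commute)
  have zpos: "\<psi> (Re z) < Im z" using assms mem_S_iff by blast
  have "\<bar>\<psi> (Re z) - \<psi> (Re q)\<bar> \<le> L * \<bar>Re z - Re q\<bar>"
    using lipschitz Re_le_1 assms(1,2) less_imp_le by blast
  then have low: "- (L * \<bar>Im w\<bar>) < Re w" using zpos assms(3) by (simp add: Rew abs_minus_commute abs_le_iff)
  show "- \<i> * (z - q) \<notin> \<real>\<^sub>\<le>\<^sub>0"
    using low unfolding w_def[symmetric] complex_nonpos_Reals_iff by auto
  have L2: "0 < 1 + L\<^sup>2" by (simp add: add_pos_nonneg)
  have "norm w / (2 * (1 + L\<^sup>2)) \<le> norm w + Re w"
  proof (cases "0 \<le> Re w")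
    case True
    have "norm w * 1 \<le> norm w * (2 * (1 + L\<^sup>2))" by (intro mult_left_mono) auto
    then have "norm w / (2 * (1 + L\<^sup>2)) \<le> norm w" using L2 by (simp add: pos_divide_le_eq)
    with True show ?thesis by linarith
  next
    case False
    have n0: "norm w > 0" using False by auto
    have "(Re w)\<^sup>2 \<le> L\<^sup>2 * (Im w)\<^sup>2"
    proof -
      have "\<bar>Re w\<bar> \<le> \<bar>L * Im w\<bar>" using low False L_nonneg by (simp add: abs_mult)
      then have "(Re w)\<^sup>2 \<le> (L * Im w)\<^sup>2" by (simp add: abs_le_square_iff)
      then show ?thesis by (simp add: power_mult_distrib)
    qed
    then have "(norm w)\<^sup>2 \<le> (1 + L\<^sup>2) * (Im w)\<^sup>2" by (simp add: cmod_power2 algebra_simps)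
    moreover have "(Im w)\<^sup>2 = (norm w + Re w) * (norm w - Re w)"
      by (simp add: cmod_power2 power2_eq_square[symmetric] square_diff_square_factored[symmetric] algebra_simps)
    moreover have "(norm w + Re w) * (norm w - Re w) \<le> (norm w + Re w) * (2 * norm w)"
      using abs_Re_le_cmod[of w] by (intro mult_left_mono) auto
    ultimately have "(norm w)\<^sup>2 \<le> (1 + L\<^sup>2) * ((norm w + Re w) * (2 * norm w))"
      using L2 by (smt (verit) mult_left_mono)
    then have "norm w * norm w \<le> ((1 + L\<^sup>2) * 2 * (norm w + Re w)) * norm w"
      by (simp only: power2_eq_square[of "norm w"] mult_ac)
    then have "norm w \<le> (1 + L\<^sup>2) * 2 * (norm w + Re w)" using n0 by simp
    then show ?thesis using L2 by (simp add: pos_divide_le_eq mult_ac)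
  qed
  then have "norm w / (2 * (1 + L\<^sup>2)) / 2 \<le> (norm w + Re w) / 2" by (rule divide_right_mono) simp
  then have "sqrt (norm w / (4 * (1 + L\<^sup>2))) \<le> sqrt ((norm w + Re w) / 2)"
    by (intro real_sqrt_le_mono) (simp add: mult.commute)
  then have "sqrt (norm w / (4 * (1 + L\<^sup>2))) \<le> Re (csqrt w)" by simp
  then show "sqrt (norm (z - q) / (4 * (1 + L\<^sup>2))) \<le> Re (csqrt (- \<i> * (z - q)))"
    unfolding nw[symmetric] unfolding w_def .
qed

text \<open>The barrier at \<open>q\<close> is the real part of the square root that is cut along the ray below \<open>q\<close>.\<close>

lemma norm_g_lower_bound:
  obtains r C where "0 < r" "r \<le> 1/2" "0 < C"
    "\<And>q z. norm q < r / 2 \<Longrightarrow> Im q = \<psi> (Re q) \<Longrightarrow> z \<in> S \<Longrightarrow> norm z < r \<Longrightarrow>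
      exp (- C * sqrt (norm (z - q))) \<le> norm (g z)"
proof -
  have "0 \<in> frontier S" using mem_frontier_S_iff[of 0] psi_0 by simp
  from norm_g_near_frontier[OF this, of "1/2"] obtain d where d: "d > 0"
    "\<And>z. z \<in> S \<Longrightarrow> z \<noteq> 0 \<Longrightarrow> dist z 0 < d \<Longrightarrow> 1/2 < norm (g z)"
    unfolding eventually_at by auto
  define r where "r = min d (1/2)"
  have r: "0 < r" "r \<le> 1/2" "r \<le> d" using d by (auto simp: r_def)
  have nz: "z \<noteq> 0" if "z \<in> S" for z using that mem_S_iff[of 0] psi_0 by auto
  have g2: "1/2 < norm (g z)" if "z \<in> S" "norm z < r" for z using d(2)[OF that(1) nz] that r by simp
  \<comment> \<open>\<open>m\<close> bounds the barrier below at distance at least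
    \<open>r / 3\<close> from \<open>q\<close>, and \<open>C\<close> gives
    \<open>exp (- C * m) = 1/2\<close>, the lower bound for \<open>norm g\<close> on
    \<open>N\<close>.\<close>
  define m where "m = sqrt (r / 3 / (4 * (1 + L\<^sup>2)))"
  have m: "m > 0" using r by (simp add: m_def add_pos_nonneg)
  define C where "C = ln 2 / m"
  have C: "C > 0" using m by (simp add: C_def)
  define N where "N = S \<inter> ball 0 r"
  have N: "open N" "bounded N" using open_S by (auto simp: N_def open_Int bounded_Int)
  have main: "exp (- C * sqrt (norm (z - q))) \<le> norm (g z)"
    if q: "norm q < r / 2" "Im q = \<psi> (Re q)" and z: "z \<in> S" "norm z < r" for q z
  proof -
    define b where "b z = csqrt (- \<i> * (z - q))" for z
    \<comment> \<open>The aim is \<open>norm h \<le> 1\<close>. At the frontier of \<open>S\<close>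
      the denominator tends to 1 in modulus while the numerator is at most 1; on the arc of radius
      \<open>r\<close> the choice of \<open>C\<close> decides.\<close>
    define h where "h z = exp (- of_real C * b z) / g z" for z
    have Reb: "0 \<le> Re (b v)" for v by (simp add: b_def Re_csqrt del: csqrt.simps)
    have hol: "h holomorphic_on N"
      unfolding h_def b_def
    proof (intro holomorphic_intros holomorphic_on_subset[OF g_holo])
      fix v assume "v \<in> N"
      then have v: "v \<in> S" "norm v < r" by (auto simp: N_def)
      show "- \<i> * (v - q) \<notin> \<real>\<^sub>\<le>\<^sub>0" using Re_csqrt_above_graph(1)[of q v] q v r by auto
      show "g v \<noteq> 0" using g2[OF v] by auto
    qed (auto simp: N_def)
    have nh: "norm (h v) = exp (- C * Re (b v)) / norm (g v)" for v by (simp add: h_def norm_divide)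
    have "norm (h z) \<le> 1"
    proof (rule norm_le_of_eventually_at_frontier[OF N hol])
      show "z \<in> N" using z by (simp add: N_def)
      fix \<xi> and e :: real assume xi: "\<xi> \<in> frontier N" and e: "0 < e"
      have inN: "\<forall>\<^sub>F v in at \<xi> within N. v \<in> N" by (simp add: eventually_at_filter)
      have xcl: "\<xi> \<in> closure N" "\<xi> \<notin> N" using xi N(1) by (auto simp: frontier_def interior_open)
      have xclS: "\<xi> \<in> closure S" using xcl(1) closure_mono[of N S] by (auto simp: N_def)
      have "closure N \<subseteq> cball 0 r" by (rule closure_minimal) (auto simp: N_def)
      with xcl have xr: "norm \<xi> \<le> r" by auto
      show "\<forall>\<^sub>F v in at \<xi> within N. norm (h v) \<le> 1 + e"
      proof (cases "\<xi> \<in> S")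
        case False
        then have "\<xi> \<in> frontier S" using xclS open_S by (simp add: frontier_def interior_open)
        then have "\<forall>\<^sub>F v in at \<xi> within S. 1 - e / (1 + e) < norm (g v)"
          using e by (intro norm_g_near_frontier) auto
        then have "\<forall>\<^sub>F v in at \<xi> within N. 1 - e / (1 + e) < norm (g v)"
          by (rule filter_leD[OF at_le, rotated]) (auto simp: N_def)
        then show ?thesis
        proof eventually_elim
          case (elim v)
          have "1 - e / (1 + e) = 1 / (1 + e)" using e by (simp add: field_simps)
          with elim have gv: "1 / (1 + e) < norm (g v)" by simp
          then have g0: "0 < norm (g v)" using e by (smt (verit) divide_pos_pos)
          have "exp (- C * Re (b v)) \<le> 1" using C Reb[of v] by simp
          also have "1 \<le> (1 + e) * norm (g v)" using gv e by (simp add: pos_divide_less_eq mult.commute less_imp_le)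
          finally show ?case unfolding nh using g0 by (simp add: pos_divide_le_eq)
        qed
      next
        case True
        then have "norm \<xi> = r" using xcl(2) xr by (auto simp: N_def)
        \<comment> \<open>Since \<open>norm q < r / 2\<close>, points beyond radius
          \<open>5 * r / 6\<close> are at distance at least \<open>r / 3\<close> from
          \<open>q\<close>.\<close>
        then have "\<xi> \<in> - cball 0 (5 * r / 6)" using r by simp
        moreover have "open (- cball (0::complex) (5 * r / 6))" by (simp add: open_Compl)
        ultimately have "\<forall>\<^sub>F v in at \<xi> within N. v \<in> - cball 0 (5 * r / 6)"
          by (intro topological_tendstoD[OF tendsto_ident_at])
        with inN show ?thesis
        proof eventually_elim
          case (elim v)
          then have v: "v \<in> S" "norm v < r" "5 * r / 6 < norm v" by (auto simp: N_def)
          have far: "r / 3 \<le> norm (v - q)" using norm_triangle_ineq2[of v q] v q by linarith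
          have "m \<le> sqrt (norm (v - q) / (4 * (1 + L\<^sup>2)))"
            unfolding m_def using far by (intro real_sqrt_le_mono divide_right_mono) (auto simp: add_nonneg_nonneg)
          also have "\<dots> \<le> Re (b v)"
            unfolding b_def using Re_csqrt_above_graph(2)[of q v] q v r by auto
          finally have "C * m \<le> C * Re (b v)" using C by (intro mult_left_mono) auto
          then have "ln 2 \<le> C * Re (b v)" using m by (simp add: C_def)
          then have "exp (- C * Re (b v)) \<le> exp (- ln 2)" by simp
          then have "exp (- C * Re (b v)) \<le> 1/2" by (simp add: exp_minus)
          also have "\<dots> \<le> norm (g v)" using g2[OF v(1,2)] by simp
          finally have "exp (- C * Re (b v)) \<le> norm (g v)" .
          moreover have "0 < norm (g v)" using g2[OF v(1,2)] by linarith
          ultimately have "norm (h v) \<le> 1" unfolding nh by (simp add: pos_divide_le_eq)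
          then show ?case using e by simp
        qed
      qed
    qed
    moreover have "0 < norm (g z)" using g2[OF z] by linarith
    ultimately have le: "exp (- C * Re (b z)) \<le> norm (g z)"
      unfolding nh by (simp add: pos_divide_le_eq)
    have "Re (b z) \<le> norm (b z)" by (rule complex_Re_le_cmod)
    also have "\<dots> = sqrt (norm (z - q))" by (simp add: b_def norm_csqrt norm_mult norm_minus_commute del: csqrt.simps)
    finally have "- C * sqrt (norm (z - q)) \<le> - C * Re (b z)" using C by simp
    then have "exp (- C * sqrt (norm (z - q))) \<le> exp (- C * Re (b z))" by simp
    with le show ?thesis by linarith
  qed
  show thesis by (rule that[OF r(1,2) C main])
qed

text \<open>Cauchy's estimate is applied to the power \<open>g\<^sup>n\<close> with \<open>n \<approx> 1 / sqrt t\<close>: it is bounded by \<open>1\<close>,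
  and bounded below at \<open>z\<close>.\<close>

lemma norm_deriv_g_bound:
  obtains r K where "0 < r" "r \<le> 1/2" "0 < K"
    "\<And>z. z \<in> S \<Longrightarrow> norm z < r \<Longrightarrow> norm (deriv g z) \<le> K / sqrt (Im z - \<psi> (Re z))"
proof -
  obtain r0 C where r0: "0 < r0" "r0 \<le> 1/2" and C: "0 < C"
    and low: "\<And>q z. norm q < r0 / 2 \<Longrightarrow> Im q = \<psi> (Re q) \<Longrightarrow> z \<in> S \<Longrightarrow> norm z < r0 \<Longrightarrow>
      exp (- C * sqrt (norm (z - q))) \<le> norm (g z)"
    using norm_g_lower_bound by metis
  \<comment> \<open>The first bound puts the graph point \<open>q\<close> below \<open>z\<close>
    into the range of \<open>norm_g_lower_bound\<close>; the second gives
    \<open>\<tau> \<le> 1/2\<close>.\<close>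
  define r where "r = min (r0 / (2 * (1 + L))) (1 / (4 * C\<^sup>2 * (2 + L)))"
  have L1: "0 < 1 + L" using L_nonneg by simp
  have r: "0 < r" "r * (1 + L) \<le> r0 / 2" "C\<^sup>2 * ((2 + L) * r) \<le> 1/4"
  proof -
    show "0 < r" using r0 C L_nonneg by (simp add: r_def)
    have "r \<le> r0 / (2 * (1 + L))" by (simp add: r_def)
    then show "r * (1 + L) \<le> r0 / 2" using L1 by (simp add: pos_le_divide_eq mult_ac)
    have "r \<le> 1 / (4 * C\<^sup>2 * (2 + L))" by (simp add: r_def)
    then show "C\<^sup>2 * ((2 + L) * r) \<le> 1/4" using C L_nonneg by (simp add: pos_le_divide_eq mult_ac)
  qed
  have rr0: "r \<le> r0 / 2"
  proof -
    have "r * 1 \<le> r * (1 + L)" using r(1) L_nonneg by (intro mult_left_mono) auto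
    then show ?thesis using r(2) by simp
  qed
  define K where "K = 4 * C * exp 1 * (1 + L)"
  have K: "0 < K" using C L1 by (simp add: K_def)
  have "norm (deriv g z) \<le> K / sqrt (Im z - \<psi> (Re z))" if z: "z \<in> S" "norm z < r" for z
  proof -
    define q where "q = Complex (Re z) (\<psi> (Re z))"
    define t where "t = Im z - \<psi> (Re z)"
    have z1: "norm z < 1" using z rr0 r0 by linarith
    have t: "t > 0" using mem_S_iff[OF z1] z by (simp add: t_def)
    have psiz: "\<bar>\<psi> (Re z)\<bar> \<le> L * norm z"
    proof -
      have "\<bar>\<psi> (Re z)\<bar> \<le> L * \<bar>Re z\<bar>" using abs_psi_le Re_le_1 z1 by simp
      also have "\<dots> \<le> L * norm z" using L_nonneg abs_Re_le_cmod by (intro mult_left_mono)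
      finally show ?thesis .
    qed
    have nq: "norm q < r0 / 2"
    proof -
      have "norm q \<le> \<bar>Re z\<bar> + \<bar>\<psi> (Re z)\<bar>" using cmod_le[of q] by (simp add: q_def)
      also have "\<dots> \<le> norm z * (1 + L)" using psiz abs_Re_le_cmod[of z] by (simp add: algebra_simps)
      also have "\<dots> < r * (1 + L)" using z L1 by (intro mult_strict_right_mono)
      finally show ?thesis using r(2) by linarith
    qed
    have zq: "norm (z - q) = t"
    proof -
      have "z - q = \<i> * of_real t" by (simp add: complex_eq_iff q_def t_def)
      then show ?thesis using t by (simp add: norm_mult)
    qed
    have gz: "exp (- C * sqrt t) \<le> norm (g z)"
      using low[OF nq _ z(1)] z rr0 r0 by (simp add: zq) (simp add: q_def)
    have "t \<le> norm z + L * norm z" using psiz abs_Im_le_cmod[of z] by (simp add: t_def)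
    also have "\<dots> \<le> (2 + L) * r"
    proof -
      have "(1 + L) * norm z \<le> (2 + L) * r" using z r L_nonneg by (intro mult_mono) auto
      then show ?thesis by (simp add: algebra_simps)
    qed
    finally have tle: "t \<le> (2 + L) * r" .
    define \<tau> where "\<tau> = C * sqrt t"
    have tau: "0 < \<tau>" "\<tau> \<le> 1/2"
    proof -
      show "0 < \<tau>" using C t by (simp add: \<tau>_def)
      have "\<tau>\<^sup>2 = C\<^sup>2 * t" using t by (simp add: \<tau>_def power_mult_distrib)
      also have "\<dots> \<le> C\<^sup>2 * ((2 + L) * r)" using tle by (intro mult_left_mono) auto
      also have "\<dots> \<le> (1/2)\<^sup>2" using r(3) by (simp add: power2_eq_square)
      finally show "\<tau> \<le> 1/2" by (rule power2_le_imp_le) simp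
    qed
    \<comment> \<open>Cauchy's estimate for \<open>g\<close> itself would give a multiple of
      \<open>1 / t\<close>, which is not integrable up to the graph. The power gains the factor
      \<open>1 / n\<close>, and \<open>n\<close> is the largest exponent with
      \<open>n * \<tau> \<le> 1\<close>, which keeps \<open>norm (g z) ^ n\<close> above
      \<open>exp (- 1)\<close>.\<close>
    define n where "n = nat \<lfloor>1 / \<tau>\<rfloor>"
    have n: "real n * \<tau> \<le> 1" "1 \<le> 2 * \<tau> * real n" "0 < n"
    proof -
      have two: "2 \<le> 1 / \<tau>" using tau by (simp add: field_simps)
      have "0 \<le> \<lfloor>1 / \<tau>\<rfloor>" using two by linarith
      then have rn: "real n = of_int \<lfloor>1 / \<tau>\<rfloor>" by (simp add: n_def)
      have "real n \<le> 1 / \<tau>" unfolding rn by linarith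
      then show "real n * \<tau> \<le> 1" using tau by (simp add: field_simps)
      have "1 / \<tau> - 1 < real n" unfolding rn by linarith
      then have "1 / (2 * \<tau>) \<le> real n" using two by simp
      then show "1 \<le> 2 * \<tau> * real n" using tau by (simp add: field_simps)
      then show "0 < n" by (cases n) auto
    qed
    \<comment> \<open>The height above the graph is Lipschitz with constant \<open>1 + L\<close>, so
      the disc of this radius about \<open>z\<close> stays in \<open>S\<close>.\<close>
    define \<rho> where "\<rho> = t / (2 * (1 + L))"
    have rho: "0 < \<rho>" using t L1 by (simp add: \<rho>_def)
    have "(1 + L) * \<rho> = t / 2"
      unfolding \<rho>_def using L1 by (metis less_irrefl mult.commute nonzero_mult_divide_mult_cancel_left times_divide_eq_right)
    then have rho1: "(1 + L) * \<rho> < t" using t by simp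
    have rho_half: "\<rho> \<le> 1/2"
    proof -
      have "\<rho> \<le> (1 + L) * norm z / (2 * (1 + L))"
        unfolding \<rho>_def using \<open>t \<le> norm z + L * norm z\<close> L1 by (intro divide_right_mono) (auto simp: algebra_simps)
      also have "\<dots> = norm z / 2"
        using L1 by (metis less_irrefl mult.commute nonzero_mult_divide_mult_cancel_left)
      finally show ?thesis using z1 by linarith
    qed
    have cb: "cball z \<rho> \<subseteq> S"
    proof
      fix w assume "w \<in> cball z \<rho>"
      then have w: "norm (w - z) \<le> \<rho>" by (simp add: dist_norm norm_minus_commute)
      have "norm w \<le> norm z + norm (w - z)" using norm_triangle_ineq[of z "w - z"] by simp
      then have w1: "norm w < 1" using w rho_half z rr0 r0 by linarith
      have "(1 + L) * norm (w - z) \<le> (1 + L) * \<rho>" using w L1 by (intro mult_left_mono) auto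
      then have "0 < Im w - \<psi> (Re w)"
        using height_change[of z w] z1 w1 rho1 by (simp add: t_def abs_le_iff)
      then show "w \<in> S" using mem_S_iff[OF w1] by simp
    qed
    have "norm ((deriv ^^ 1) (\<lambda>w. g w ^ n) z) \<le> fact 1 * 1 / \<rho> ^ 1"
    proof (rule Cauchy_inequality[OF _ _ rho])
      have gc: "g holomorphic_on cball z \<rho>" using g_holo cb holomorphic_on_subset by blast
      show "(\<lambda>w. g w ^ n) holomorphic_on ball z \<rho>"
        by (intro holomorphic_intros holomorphic_on_subset[OF gc]) auto
      show "continuous_on (cball z \<rho>) (\<lambda>w. g w ^ n)"
        by (intro continuous_intros holomorphic_on_imp_continuous_on gc)
      fix w assume "norm (z - w) = \<rho>"
      then have "w \<in> S" using cb by (auto simp: dist_norm)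
      then show "norm (g w ^ n) \<le> 1" using g_disc[of w] by (simp add: norm_power power_le_one)
    qed
    moreover have "deriv (\<lambda>w. g w ^ n) z = of_nat n * g z ^ (n - 1) * deriv g z"
    proof -
      have "(g has_field_derivative deriv g z) (at z)"
        using g_holo open_S z holomorphic_derivI by blast
      then have "((\<lambda>w. g w ^ n) has_field_derivative of_nat n * g z ^ (n - 1) * deriv g z) (at z)"
        by (auto intro!: derivative_eq_intros)
      then show ?thesis by (rule DERIV_imp_deriv)
    qed
    ultimately have cauchy: "real n * norm (g z) ^ (n - 1) * norm (deriv g z) \<le> 1 / \<rho>"
      by (simp add: norm_mult norm_power)
    have "exp (- 1) \<le> exp (- \<tau>) ^ n" using n(1) by (simp add: exp_of_nat_mult[symmetric])
    also have "\<dots> \<le> norm (g z) ^ n" using gz by (intro power_mono) (auto simp: \<tau>_def)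
    also have "\<dots> \<le> norm (g z) ^ (n - 1)" using g_disc[OF z(1)] by (intro power_decreasing) auto
    finally have glow: "exp (- 1) \<le> norm (g z) ^ (n - 1)" .
    have "real n * exp (- 1) * norm (deriv g z) \<le> real n * norm (g z) ^ (n - 1) * norm (deriv g z)"
      using glow by (intro mult_right_mono mult_left_mono) auto
    also note cauchy
    finally have c2: "real n * exp (- 1) * norm (deriv g z) \<le> 1 / \<rho>" .
    have "1 * norm (deriv g z) \<le> (2 * \<tau> * real n) * norm (deriv g z)"
      using n(2) by (intro mult_right_mono) auto
    also have "\<dots> = 2 * \<tau> * exp 1 * (real n * exp (- 1) * norm (deriv g z))"
      by (simp add: exp_minus)
    also have "\<dots> \<le> 2 * \<tau> * exp 1 * (1 / \<rho>)" using c2 tau by (intro mult_left_mono) auto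
    also have "\<dots> = K / sqrt t"
    proof -
      have "1 / \<rho> = 2 * (1 + L) / t" by (simp add: \<rho>_def)
      then have "2 * \<tau> * exp 1 * (1 / \<rho>) = K * (sqrt t / t)"
        by (simp add: \<tau>_def K_def algebra_simps add_divide_distrib)
      moreover have "sqrt t / t = 1 / sqrt t" using t by (simp add: field_simps)
      ultimately show ?thesis by simp
    qed
    finally show ?thesis by (simp add: t_def)
  qed
  then show thesis using that[of r K] r(1) rr0 r0 K by auto
qed

end

context graph_domain_map
begin

text \<open>Two points at distance \<open>\<delta>\<close> are joined by moving up from each by
  \<open>\<tau>\<close> and then across. On the vertical parts the derivative bound is integrable
  and costs a multiple of \<open>sqrt \<tau>\<close>; on the crossing, of length
  \<open>\<delta>\<close>, the derivative is at most \<open>K / sqrt \<delta>\<close>.\<close>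

lemma g_Hoelder:
  obtains r K where "0 < r" "r \<le> 1/2"
    "\<And>z w. z \<in> S \<Longrightarrow> w \<in> S \<Longrightarrow> norm z < r \<Longrightarrow> norm w < r \<Longrightarrow> norm (g z - g w) \<le> K * sqrt (norm (z - w))"
proof -
  obtain r1 K where r1: "0 < r1" "r1 \<le> 1/2" and K: "0 < K"
    and dg: "\<And>z. z \<in> S \<Longrightarrow> norm z < r1 \<Longrightarrow> norm (deriv g z) \<le> K / sqrt (Im z - \<psi> (Re z))"
    using norm_deriv_g_bound by metis
  have der: "(g has_field_derivative deriv g z) (at z)" if "z \<in> S" for z
    using that g_holo open_S holomorphic_derivI by blast
  have up: "norm (g (z + \<i> * of_real \<tau>) - g z) \<le> 2 * K * sqrt \<tau>"
    if z: "z \<in> S" "0 \<le> \<tau>" "norm z + \<tau> < r1" for z \<tau>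
  proof (cases "\<tau> = 0")
    case False
    define h where "h = Im z - \<psi> (Re z)"
    have h: "0 < h" using z mem_S_iff[of z] r1 by (simp add: h_def)
    have inS: "z + \<i> * of_real s \<in> S" "norm (z + \<i> * of_real s) < r1" if "s \<in> {0..\<tau>}" for s
    proof -
      have "norm (z + \<i> * of_real s) \<le> norm z + s"
        using norm_triangle_ineq[of z "\<i> * of_real s"] that by (simp add: norm_mult)
      then show n: "norm (z + \<i> * of_real s) < r1" using that z by auto
      show "z + \<i> * of_real s \<in> S"
        using mem_S_iff[of "z + \<i> * of_real s"] n r1 that h by (simp add: h_def)
    qed
    have path: "((\<lambda>s. g (z + \<i> * of_real s)) has_vector_derivative (\<i> * deriv g (z + \<i> * of_real s))) (at s)"
      if "s \<in> {0..\<tau>}" for s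
    proof -
      have "((\<lambda>s. z + \<i> * complex_of_real s) has_vector_derivative \<i>) (at s)"
        by (auto intro!: derivative_eq_intros)
      from field_vector_diff_chain_at[OF this der[OF inS(1)[OF that]]] show ?thesis by (simp add: o_def)
    qed
    have "norm (g (z + \<i> * of_real \<tau>) - g (z + \<i> * of_real 0)) \<le> 2 * K * sqrt (h + \<tau>) - 2 * K * sqrt (h + 0)"
    proof (rule differentiable_bound_general[where f = "\<lambda>s. g (z + \<i> * of_real s)" and \<phi> = "\<lambda>s. 2 * K * sqrt (h + s)"
          and f' = "\<lambda>s. \<i> * deriv g (z + \<i> * of_real s)" and \<phi>' = "\<lambda>s. K / sqrt (h + s)"])
      show "0 < \<tau>" using False z by simp
      show "continuous_on {0..\<tau>} (\<lambda>s. g (z + \<i> * of_real s))"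
        using path by (intro continuous_at_imp_continuous_on ballI) (blast intro: has_vector_derivative_continuous)
      show "continuous_on {0..\<tau>} (\<lambda>s. 2 * K * sqrt (h + s))" by (intro continuous_intros)
      fix s assume s: "0 < s" "s < \<tau>"
      show "((\<lambda>s. g (z + \<i> * of_real s)) has_vector_derivative (\<i> * deriv g (z + \<i> * of_real s))) (at s)"
        using path s by simp
      show "((\<lambda>s. 2 * K * sqrt (h + s)) has_vector_derivative K / sqrt (h + s)) (at s)"
        unfolding has_real_derivative_iff_has_vector_derivative[symmetric]
        using h s by (auto intro!: derivative_eq_intros simp: field_simps)
      show "norm (\<i> * deriv g (z + \<i> * of_real s)) \<le> K / sqrt (h + s)"
        using dg[OF inS[of s]] s by (simp add: norm_mult h_def algebra_simps)
    qed
    also have "\<dots> \<le> 2 * K * sqrt \<tau>"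
    proof -
      have "sqrt (h + \<tau>) \<le> sqrt h + sqrt \<tau>" using h z by (intro sqrt_add_le_add_sqrt) auto
      then have "2 * K * sqrt (h + \<tau>) \<le> 2 * K * (sqrt h + sqrt \<tau>)" using K by (intro mult_left_mono) auto
      then show ?thesis by (simp add: algebra_simps)
    qed
    finally show ?thesis by simp
  qed simp
  define r where "r = r1 / (2 * L + 8)"
  have L8: "0 < 2 * L + 8" using L_nonneg by simp
  have r: "0 < r" "r * (2 * L + 8) = r1" using r1 L8 by (simp_all add: r_def)
  have r_le: "r \<le> r1" 
  proof -
    have "r * 1 \<le> r * (2 * L + 8)" using r(1) L_nonneg by (intro mult_left_mono) auto
    then show ?thesis using r(2) by simp
  qed
  define K' where "K' = 4 * K * sqrt (L + 2) + K"
  have main: "norm (g z - g w) \<le> K' * sqrt (norm (z - w))"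
    if zw: "z \<in> S" "w \<in> S" "norm z < r" "norm w < r" for z w
  proof (cases "z = w")
    case False
    define \<delta> where "\<delta> = norm (w - z)"
    have del: "0 < \<delta>" "\<delta> < 2 * r"
      using False zw norm_triangle_ineq4[of w z] by (auto simp: \<delta>_def)
    \<comment> \<open>Along the segment the height can drop by \<open>(1 + L) * \<delta>\<close>;
      the remaining \<open>\<delta>\<close> is the clearance from the graph.\<close>
    define \<tau> where "\<tau> = (L + 2) * \<delta>"
    have tau: "0 < \<tau>" using del L_nonneg by (simp add: \<tau>_def)
    have tau2: "\<tau> < (L + 2) * (2 * r)" unfolding \<tau>_def using del L_nonneg by (intro mult_strict_left_mono) auto
    have small: "2 * r + \<tau> < r1" using tau2 r by (simp add: algebra_simps)
    have u1: "norm (g (z + \<i> * of_real \<tau>) - g z) \<le> 2 * K * sqrt \<tau>"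
      using up[of z \<tau>] zw tau small r(1) by simp
    have u2: "norm (g (w + \<i> * of_real \<tau>) - g w) \<le> 2 * K * sqrt \<tau>"
      using up[of w \<tau>] zw tau small r(1) by simp
    have seg: "v \<in> S \<and> norm v < r1 \<and> \<delta> \<le> Im v - \<psi> (Re v)"
      if v: "v \<in> closed_segment (z + \<i> * of_real \<tau>) (w + \<i> * of_real \<tau>)" for v
    proof -
      obtain x where x: "0 \<le> x" "x \<le> 1" and vx: "v = (1 - x) *\<^sub>R (z + \<i> * of_real \<tau>) + x *\<^sub>R (w + \<i> * of_real \<tau>)"
        using v unfolding closed_segment_def by blast
      define p where "p = z + of_real x * (w - z)"
      have vp: "v = p + \<i> * of_real \<tau>" by (simp add: vx p_def scaleR_conv_of_real algebra_simps)
      have pz: "norm (p - z) \<le> \<delta>" using x by (simp add: p_def \<delta>_def norm_mult mult_left_le_one_le)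
      have "p = (1 - x) *\<^sub>R z + x *\<^sub>R w" by (simp add: p_def scaleR_conv_of_real algebra_simps)
      then have "p \<in> closed_segment z w" using x unfolding closed_segment_def by blast
      moreover have "closed_segment z w \<subseteq> ball 0 r"
        using zw by (intro closed_segment_subset) auto
      ultimately have pn: "norm p < r" by auto
      have "norm v \<le> norm p + \<tau>" using norm_triangle_ineq[of p "\<i> * of_real \<tau>"] tau by (simp add: vp norm_mult)
      then have vn: "norm v < r1" using pn small r(1) by linarith
      have "\<bar>(Im p - \<psi> (Re p)) - (Im z - \<psi> (Re z))\<bar> \<le> (1 + L) * norm (p - z)"
        using pn zw r_le r1 by (intro height_change) auto
      also have "\<dots> \<le> (1 + L) * \<delta>" using pz L_nonneg by (intro mult_left_mono) auto
      finally have "- ((1 + L) * \<delta>) < Im p - \<psi> (Re p)"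
        using mem_S_iff[of z] zw r_le r1 by (simp add: abs_le_iff)
      then have "\<delta> \<le> Im v - \<psi> (Re v)" by (simp add: vp \<tau>_def algebra_simps)
      moreover from this have "v \<in> S" using mem_S_iff[of v] vn r1 del by simp
      ultimately show ?thesis using vn by blast
    qed
    have "norm (g (z + \<i> * of_real \<tau>) - g (w + \<i> * of_real \<tau>)) \<le> K / sqrt \<delta> * norm (z + \<i> * of_real \<tau> - (w + \<i> * of_real \<tau>))"
    proof (rule field_differentiable_bound[OF convex_closed_segment])
      fix v assume v: "v \<in> closed_segment (z + \<i> * of_real \<tau>) (w + \<i> * of_real \<tau>)"
      show "(g has_field_derivative deriv g v) (at v within closed_segment (z + \<i> * of_real \<tau>) (w + \<i> * of_real \<tau>))"
        using der seg[OF v] has_field_derivative_at_within by blast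
      have "norm (deriv g v) \<le> K / sqrt (Im v - \<psi> (Re v))" using dg seg[OF v] by blast
      also have "\<dots> \<le> K / sqrt \<delta>" using seg[OF v] del K by (intro divide_left_mono mult_pos_pos real_sqrt_le_mono) auto
      finally show "norm (deriv g v) \<le> K / sqrt \<delta>" .
    qed auto
    also have "\<dots> = K * (\<delta> / sqrt \<delta>)" by (simp add: \<delta>_def norm_minus_commute)
    also have "\<delta> / sqrt \<delta> = sqrt \<delta>" using del by (simp add: real_div_sqrt)
    finally have u3: "norm (g (z + \<i> * of_real \<tau>) - g (w + \<i> * of_real \<tau>)) \<le> K * sqrt \<delta>" .
    have "norm (g z - g w) \<le> norm (g (z + \<i> * of_real \<tau>) - g z) + norm (g (z + \<i> * of_real \<tau>) - g (w + \<i> * of_real \<tau>)) + norm (g (w + \<i> * of_real \<tau>) - g w)"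
      using norm_triangle_ineq[of "g (z + \<i> * of_real \<tau>) - g (w + \<i> * of_real \<tau>) - (g (z + \<i> * of_real \<tau>) - g z)" "g (w + \<i> * of_real \<tau>) - g w"]
        norm_triangle_ineq4[of "g (z + \<i> * of_real \<tau>) - g (w + \<i> * of_real \<tau>)" "g (z + \<i> * of_real \<tau>) - g z"]
      by simp
    also have "\<dots> \<le> 2 * K * sqrt \<tau> + K * sqrt \<delta> + 2 * K * sqrt \<tau>" using u1 u2 u3 by linarith
    also have "\<dots> = K' * sqrt \<delta>" 
      unfolding K'_def \<tau>_def real_sqrt_mult by (simp add: distrib_right)
    finally show ?thesis by (simp add: \<delta>_def norm_minus_commute)
  qed simp
  show thesis using that[of r K'] main r(1) r_le r1 by auto
qed

text \<open>Hoelder continuity gives uniform continuity near 0, hence a continuous extension; its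
  modulus is 1 on the graph because \<open>g\<close> is proper.\<close>

lemma g_extension:
  obtains r e where "0 < r" "r \<le> 1/2" "continuous_on (closure S \<inter> ball 0 r) e"
    "\<And>z. z \<in> S \<Longrightarrow> norm z < r \<Longrightarrow> e z = g z"
    "\<And>z. z \<in> frontier S \<Longrightarrow> norm z < r \<Longrightarrow> norm (e z) = 1"
proof -
  obtain r K where r: "0 < r" "r \<le> 1/2"
    and hoel: "\<And>z w. z \<in> S \<Longrightarrow> w \<in> S \<Longrightarrow> norm z < r \<Longrightarrow> norm w < r \<Longrightarrow> norm (g z - g w) \<le> K * sqrt (norm (z - w))"
    using g_Hoelder by metis
  define N where "N = S \<inter> ball 0 r"
  have uc: "uniformly_continuous_on N g"
    unfolding uniformly_continuous_on_def
  proof (intro allI impI)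
    fix e :: real assume e: "0 < e"
    define d where "d = (e / (\<bar>K\<bar> + 1))\<^sup>2"
    have "d > 0" using e by (simp add: d_def)
    moreover have "dist (g w) (g z) < e" if "z \<in> N" "w \<in> N" "dist w z < d" for z w
    proof -
      have "sqrt (norm (w - z)) < sqrt d" using that by (intro real_sqrt_less_mono) (simp add: dist_norm)
      also have "sqrt d = e / (\<bar>K\<bar> + 1)" using e by (simp add: d_def)
      finally have 1: "sqrt (norm (w - z)) * (\<bar>K\<bar> + 1) < e" by (simp add: pos_less_divide_eq)
      have "norm (g w - g z) \<le> K * sqrt (norm (w - z))" using hoel that by (simp add: N_def)
      also have "\<dots> \<le> (\<bar>K\<bar> + 1) * sqrt (norm (w - z))" by (intro mult_right_mono) auto
      also note 1[unfolded mult.commute[of _ "\<bar>K\<bar> + 1"]]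
      finally show ?thesis by (simp add: dist_norm)
    qed
    ultimately show "\<exists>d>0. \<forall>x\<in>N. \<forall>x'\<in>N. dist x' x < d \<longrightarrow> dist (g x') (g x) < e" by blast
  qed
  obtain e where e: "uniformly_continuous_on (closure N) e" "\<And>x. x \<in> N \<Longrightarrow> g x = e x"
    using uniformly_continuous_on_extension_on_closure[OF uc] by metis
  have cl: "closure S \<inter> ball 0 r \<subseteq> closure N"
    unfolding N_def using open_Int_closure_subset[of "ball 0 r" S] by (simp add: Int_commute)
  have ce: "continuous_on (closure S \<inter> ball 0 r) e"
    using uniformly_continuous_imp_continuous[OF e(1)] cl by (rule continuous_on_subset)
  have "norm (e z) = 1" if z: "z \<in> frontier S" "norm z < r" for z
  proof (rule antisym)
    have zc: "z \<in> closure S \<inter> ball 0 r" "z \<notin> S" using z open_S by (auto simp: frontier_def interior_open)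
    have "z \<in> closure N" "z \<notin> N" using cl zc by (auto simp: N_def)
    then have "z islimpt N" by (simp add: closure_def)
    then have nb: "at z within N \<noteq> bot" by (simp add: trivial_limit_within)
    have "(e \<longlongrightarrow> e z) (at z within N)"
    proof (rule tendsto_within_subset)
      show "(e \<longlongrightarrow> e z) (at z within closure S \<inter> ball 0 r)" using ce zc(1) by (simp add: continuous_on_def)
      show "N \<subseteq> closure S \<inter> ball 0 r" using closure_subset by (auto simp: N_def)
    qed
    then have lim: "((\<lambda>w. norm (e w)) \<longlongrightarrow> norm (e z)) (at z within N)" by (rule tendsto_norm)
    have ev: "\<forall>\<^sub>F w in at z within N. w \<in> N" by (simp add: eventually_at_filter)
    show "norm (e z) \<le> 1"
    proof (rule tendsto_upperbound[OF lim _ nb])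
      show "\<forall>\<^sub>F w in at z within N. norm (e w) \<le> 1"
        using ev by eventually_elim (use g_disc e(2) in \<open>force simp: N_def\<close>)
    qed
    show "1 \<le> norm (e z)"
    proof (rule field_le_epsilon)
      fix \<eta> :: real assume "0 < \<eta>"
      from norm_g_near_frontier[OF z(1) this] have "\<forall>\<^sub>F w in at z within N. 1 - \<eta> < norm (g w)"
        by (rule filter_leD[OF at_le, rotated]) (auto simp: N_def)
      with ev have "\<forall>\<^sub>F w in at z within N. 1 - \<eta> \<le> norm (e w)"
        by eventually_elim (use e(2) in force)
      from tendsto_lowerbound[OF lim this nb] show "1 \<le> norm (e z) + \<eta>" by simp
    qed
  qed
  then show thesis using that[of r e] r ce e(2) by (auto simp: N_def)
qed

end

locale graph_domain_extended = graph_domain_map +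
  fixes r :: real and e :: "complex \<Rightarrow> complex"
  assumes r_pos: "0 < r" and r_le: "r \<le> 1/2"
    and e_cont: "continuous_on (closure S \<inter> ball 0 r) e"
    and e_eq: "z \<in> S \<Longrightarrow> norm z < r \<Longrightarrow> e z = g z"
    and norm_e: "z \<in> frontier S \<Longrightarrow> norm z < r \<Longrightarrow> norm (e z) = 1"
begin

lemma e_tendsto: "z \<in> closure S \<Longrightarrow> norm z < r \<Longrightarrow> (e \<longlongrightarrow> e z) (at z within closure S \<inter> ball 0 r)"
  using e_cont by (simp add: continuous_on_def)

lemma g_tendsto:
  assumes "z \<in> closure S" "norm z < r"
  shows "(g \<longlongrightarrow> e z) (at z within S)"
proof -
  have "(e \<longlongrightarrow> e z) (at z within S \<inter> ball 0 r)"
    by (rule tendsto_within_subset[OF e_tendsto[OF assms]]) (use closure_subset in auto)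
  then have "(e \<longlongrightarrow> e z) (at z within S)"
    using at_within_nhd[of z "ball 0 r" "S \<inter> ball 0 r" S] assms(2) by auto
  moreover have "\<forall>\<^sub>F w in at z within S. e w = g w"
    unfolding eventually_at_topological
    by (rule exI[of _ "ball 0 r"]) (use assms e_eq in auto)
  ultimately show ?thesis using tendsto_cong by blast
qed

text \<open>The factor \<open>(\<rho> / (z - a'))\<^sup>n\<close> has modulus \<open>1\<close> on the circle of radius \<open>\<rho>\<close> about a point \<open>a'\<close> below
  the graph and grows with \<open>n\<close> inside, so a function that vanishes on the enclosed arc is \<open>0\<close>.\<close>

lemma e_not_constant_on_arc:
  assumes ab: "a < b" "-1 \<le> a" "b \<le> 1"
    and arc: "\<And>x. a < x \<Longrightarrow> x < b \<Longrightarrow> norm (Complex x (\<psi> x)) < r"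
  shows "\<exists>x\<in>{a<..<b}. e (Complex x (\<psi> x)) \<noteq> \<zeta>"
proof (rule ccontr)
  assume "\<not> ?thesis"
  then have const: "e (Complex x (\<psi> x)) = \<zeta>" if "a < x" "x < b" for x using that by auto
  define x1 where "x1 = (a + b) / 2"
  have x1: "a < x1" "x1 < b" using ab by (auto simp: x1_def)
  define q where "q = Complex x1 (\<psi> x1)"
  have q: "norm q < r" using arc x1 by (simp add: q_def)
  define \<tau> where "\<tau> = min ((b - a) / 2) (r - norm q) / 4"
  have tau: "0 < \<tau>" "3 * \<tau> < (b - a) / 2" "3 * \<tau> < r - norm q"
    using ab q by (auto simp: \<tau>_def min_def)
  define a' where "a' = q - \<i> * of_real \<tau>"
  define \<rho> where "\<rho> = 2 * \<tau>"
  have qa: "norm (q - a') = \<tau>" using tau by (simp add: a'_def norm_mult)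
  have near: "norm (z - q) \<le> 3 * \<tau>" if "norm (z - a') \<le> \<rho>" for z
    using norm_triangle_ineq4[of "z - a'" "q - a'"] qa that by (simp add: \<rho>_def)
  have near_r: "norm z < r" if "norm (z - a') \<le> \<rho>" for z
    using near[OF that] norm_triangle_ineq[of q "z - q"] tau by simp
  have a'r: "norm a' < r" using near_r[of a'] tau by (simp add: \<rho>_def)
  have a'cl: "a' \<notin> closure S"
    using mem_closure_S_iff[of a'] a'r r_le tau by (simp add: a'_def q_def)
  have qfr: "q \<in> frontier S" using mem_frontier_S_iff[of q] q r_le by (simp add: q_def)
  have "e q = \<zeta>" using const[OF x1] by (simp add: q_def)
  then have zeta: "norm \<zeta> = 1" using norm_e[OF qfr q] by simp
  define D where "D = S \<inter> ball a' \<rho>"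
  have D: "open D" "bounded D" using open_S by (auto simp: D_def open_Int bounded_Int)
  \<comment> \<open>At \<open>z0\<close> the growing factor is the power of a number of modulus
    \<open>4/3\<close>, so a bound independent of \<open>n\<close> forces
    \<open>g z0 = \<zeta>\<close>, a point of the circle.\<close>
  define z0 where "z0 = q + \<i> * of_real (\<tau> / 2)"
  have z0a: "z0 - a' = \<i> * of_real (3 * \<tau> / 2)" by (simp add: z0_def a'_def algebra_simps)
  have z0n: "norm (z0 - a') = 3 * \<tau> / 2" unfolding z0a norm_mult norm_of_real using tau by simp
  have z0r: "norm z0 < r" using near_r[of z0] z0n tau by (simp add: \<rho>_def)
  have z0S: "z0 \<in> S" using mem_S_iff[of z0] z0r r_le tau by (simp add: z0_def q_def)
  have z0D: "z0 \<in> D" using z0S z0n tau by (simp add: D_def \<rho>_def dist_norm norm_minus_commute)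
  have bound: "norm ((g z0 - \<zeta>) * (of_real \<rho> / (z0 - a'))^n) \<le> 2" for n :: nat
  proof (rule norm_le_of_eventually_at_frontier[OF D, where h = "\<lambda>z. (g z - \<zeta>) * (of_real \<rho> / (z - a'))^n"])
    show "(\<lambda>z. (g z - \<zeta>) * (of_real \<rho> / (z - a'))^n) holomorphic_on D"
      using a'cl closure_subset by (intro holomorphic_intros holomorphic_on_subset[OF g_holo]) (auto simp: D_def)
    fix \<xi> and \<eta> :: real assume xi: "\<xi> \<in> frontier D" and eta: "0 < \<eta>"
    have xcl: "\<xi> \<in> closure D" "\<xi> \<notin> D" using xi D(1) by (auto simp: frontier_def interior_open)
    have "closure D \<subseteq> cball a' \<rho>" by (rule closure_minimal) (auto simp: D_def)
    then have xa: "norm (\<xi> - a') \<le> \<rho>" using xcl by (auto simp: dist_norm norm_minus_commute)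
    have xr: "norm \<xi> < r" by (rule near_r[OF xa])
    have xS: "\<xi> \<in> closure S" using xcl(1) closure_mono[of D S] by (auto simp: D_def)
    have xne: "\<xi> \<noteq> a'" using xS a'cl by blast
    define k where "k z = (e z - \<zeta>) * (of_real \<rho> / (z - a'))^n" for z
    have "norm (k \<xi>) \<le> 2"
    proof (cases "\<xi> \<in> S")
      case True
      then have "norm (\<xi> - a') = \<rho>" using xcl(2) xa by (simp add: D_def dist_norm norm_minus_commute)
      then have "norm (k \<xi>) = norm (g \<xi> - \<zeta>)"
        using tau by (simp add: k_def norm_mult norm_power norm_divide e_eq[OF True xr] \<rho>_def)
      also have "\<dots> \<le> 2" using norm_triangle_ineq4[of "g \<xi>" \<zeta>] g_disc[OF True] zeta by linarith
      finally show ?thesis .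
    next
      case False
      then have "\<xi> \<in> frontier S" using xS open_S by (simp add: frontier_def interior_open)
      then have "\<xi> = Complex (Re \<xi>) (\<psi> (Re \<xi>))" using mem_frontier_S_iff[of \<xi>] xr r_le by (simp add: complex_eq_iff)
      moreover have "\<bar>Re \<xi> - x1\<bar> \<le> 3 * \<tau>"
        using near[OF xa] abs_Re_le_cmod[of "\<xi> - q"] by (simp add: q_def)
      then have "a < Re \<xi>" "Re \<xi> < b" using tau(2) unfolding x1_def by (auto simp: abs_le_iff field_simps)
      ultimately have "e \<xi> = \<zeta>" using const by metis
      then show ?thesis by (simp add: k_def)
    qed
    have "(k \<longlongrightarrow> k \<xi>) (at \<xi> within D)"
    proof -
      have "(e \<longlongrightarrow> e \<xi>) (at \<xi> within D)"
      proof (rule tendsto_within_subset[OF e_tendsto[OF xS xr]])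
        show "D \<subseteq> closure S \<inter> ball 0 r"
          using closure_subset near_r by (auto simp: D_def dist_norm norm_minus_commute)
      qed
      then show ?thesis unfolding k_def using xne by (intro tendsto_intros) auto
    qed
    then have lim: "((\<lambda>z. norm (k z)) \<longlongrightarrow> norm (k \<xi>)) (at \<xi> within D)" by (rule tendsto_norm)
    have "norm (k \<xi>) < 2 + \<eta>" using \<open>norm (k \<xi>) \<le> 2\<close> eta by simp
    from order_tendstoD(2)[OF lim this] have "\<forall>\<^sub>F z in at \<xi> within D. norm (k z) < 2 + \<eta>" .
    moreover have "\<forall>\<^sub>F z in at \<xi> within D. z \<in> D" by (simp add: eventually_at_filter)
    ultimately show "\<forall>\<^sub>F z in at \<xi> within D. norm ((g z - \<zeta>) * (of_real \<rho> / (z - a'))^n) \<le> 2 + \<eta>"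
    proof eventually_elim
      case (elim z)
      then have "e z = g z" by (intro e_eq near_r) (auto simp: D_def dist_norm norm_minus_commute)
      with elim show ?case by (simp add: k_def less_imp_le)
    qed
  qed (rule z0D)
  have "norm (g z0 - \<zeta>) \<le> 2 * (3/4)^n" for n :: nat
  proof -
    have eq: "norm (of_real \<rho> / (z0 - a')) = 4/3" using tau by (simp add: norm_divide z0n \<rho>_def)
    have "norm (g z0 - \<zeta>) * (4/3)^n \<le> 2" using bound[of n] by (simp only: norm_mult norm_power eq)
    then have "norm (g z0 - \<zeta>) * (4/3)^n * (3/4)^n \<le> 2 * (3/4)^n" by (intro mult_right_mono) auto
    moreover have "(4/3)^n * (3/4)^n = (1::real)" by (simp flip: power_mult_distrib)
    ultimately show ?thesis by (simp only: mult.assoc mult_1_right)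
  qed
  moreover have "(\<lambda>n. 2 * (3/4)^n) \<longlonglongrightarrow> (2 * 0 :: real)" by (intro tendsto_intros LIMSEQ_power_zero) auto
  ultimately have "norm (g z0 - \<zeta>) \<le> 2 * 0" using LIMSEQ_le_const by blast
  then have "g z0 = \<zeta>" by simp
  then show False using g_disc[OF z0S] zeta by simp
qed

lemma norm_graph_box:
  assumes "\<bar>x - x0\<bar> \<le> \<delta>" "0 \<le> t" "t \<le> \<delta>" "\<bar>x\<bar> \<le> 1" "\<bar>x0\<bar> \<le> 1"
  shows "norm (Complex x (\<psi> x + t) - Complex x0 (\<psi> x0)) \<le> (2 + L) * \<delta>"
proof -
  have "norm (Complex x (\<psi> x + t) - Complex x0 (\<psi> x0)) \<le> \<bar>x - x0\<bar> + \<bar>\<psi> x + t - \<psi> x0\<bar>"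
    using cmod_le[of "Complex x (\<psi> x + t) - Complex x0 (\<psi> x0)"] by simp
  moreover have "\<bar>\<psi> x - \<psi> x0\<bar> \<le> L * \<bar>x - x0\<bar>" using lipschitz assms by blast
  moreover have "L * \<bar>x - x0\<bar> \<le> L * \<delta>" using L_nonneg assms by (intro mult_left_mono)
  ultimately show ?thesis using assms by (simp add: algebra_simps)
qed

text \<open>A neighbourhood of \<open>e q\<close> in the disc is connected and, as \<open>e \<noteq> e q\<close> on the compact outer boundary of a
  small box at \<open>q\<close>, its preimage cannot leave the box.\<close>

lemma G_tendsto:
  assumes q: "q \<in> frontier S" "norm q < r" and eta: "0 < \<eta>"
  obtains \<epsilon> where "0 < \<epsilon>" "\<And>w. norm w < 1 \<Longrightarrow> norm (w - e q) < \<epsilon> \<Longrightarrow> norm (G w - q) < \<eta>"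
proof -
  define x0 where "x0 = Re q"
  have qx: "q = Complex x0 (\<psi> x0)" using mem_frontier_S_iff[of q] q r_le by (simp add: complex_eq_iff x0_def)
  define \<eta>' where "\<eta>' = min \<eta> (r - norm q)"
  have eta': "0 < \<eta>'" "\<eta>' \<le> \<eta>" "\<eta>' \<le> r - norm q" using eta q by (auto simp: \<eta>'_def)
  define \<delta> where "\<delta> = \<eta>' / (3 + L)"
  have L3: "0 < 3 + L" using L_nonneg by simp
  have del: "0 < \<delta>" using eta' L3 by (simp add: \<delta>_def)
  have del2: "(2 + L) * \<delta> < \<eta>'"
  proof -
    have "(2 + L) * \<delta> < (3 + L) * \<delta>" using del by (intro mult_strict_right_mono) auto
    then show ?thesis using L3 by (simp add: \<delta>_def)
  qed
  have "\<bar>x0\<bar> \<le> norm q" unfolding x0_def by (rule abs_Re_le_cmod)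
  moreover have "1 * \<delta> \<le> (2 + L) * \<delta>" using del L_nonneg by (intro mult_right_mono) auto
  ultimately have x0d: "\<bar>x0\<bar> + \<delta> < r" using del2 eta' by linarith
  have box: "norm (Complex x (\<psi> x + t) - q) < \<eta>'" "norm (Complex x (\<psi> x + t)) < r" "\<bar>x\<bar> \<le> 1"
    if "\<bar>x - x0\<bar> \<le> \<delta>" "0 \<le> t" "t \<le> \<delta>" for x t
  proof -
    show x: "\<bar>x\<bar> \<le> 1" using that x0d r_le by linarith
    show 1: "norm (Complex x (\<psi> x + t) - q) < \<eta>'"
      using norm_graph_box[OF that x] x0d del2 del r_le unfolding qx by linarith
    show "norm (Complex x (\<psi> x + t)) < r"
      using 1 norm_triangle_ineq[of q "Complex x (\<psi> x + t) - q"] eta' by simp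
  qed
  define \<zeta> where "\<zeta> = e q"
  have zeta: "norm \<zeta> = 1" using norm_e q by (simp add: \<zeta>_def)
  \<comment> \<open>The side walls of the box stand over graph points where \<open>e\<close> differs
    from \<open>\<zeta>\<close>; the lemma on arcs supplies one on each side of
    \<open>q\<close>.\<close>
  obtain a where a: "x0 - \<delta> < a" "a < x0" "e (Complex a (\<psi> a)) \<noteq> \<zeta>"
    using e_not_constant_on_arc[of "x0 - \<delta>" x0 \<zeta>] box[of _ 0] del x0d r_le by (force simp: abs_le_iff)
  obtain b where b: "x0 < b" "b < x0 + \<delta>" "e (Complex b (\<psi> b)) \<noteq> \<zeta>"
    using e_not_constant_on_arc[of x0 "x0 + \<delta>" \<zeta>] box[of _ 0] del x0d r_le by (force simp: abs_le_iff)
  define Q where "Q = {z. a < Re z \<and> Re z < b \<and> \<psi> (Re z) < Im z \<and> Im z < \<psi> (Re z) + \<delta>}"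
  define \<Phi> where "\<Phi> p = Complex (fst p) (\<psi> (fst p) + snd p)" for p :: "real \<times> real"
  define I where "I = {a..b} \<times> {0..\<delta>}"
  \<comment> \<open>\<open>J\<close> consists of the two side walls and the top. The bottom of the
    box lies on the graph, which \<open>G\<close> never reaches.\<close>
  define J where "J = {a, b} \<times> {0..\<delta>} \<union> {a..b} \<times> {\<delta>}"
  have I: "compact I" "J \<subseteq> I" "compact J" using a b del unfolding I_def J_def
    by (auto intro!: compact_Un compact_Times)
  have Ix: "\<bar>fst p - x0\<bar> \<le> \<delta>" "0 \<le> snd p" "snd p \<le> \<delta>" if "p \<in> I" for p
    using that a b by (auto simp: I_def abs_le_iff)
  have Phi_r: "norm (\<Phi> p) < r" if "p \<in> I" for p
    unfolding \<Phi>_def using box(2)[OF Ix[OF that]] .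
  have Phi_cl: "\<Phi> p \<in> closure S" if "p \<in> I" for p
    using mem_closure_S_iff[of "\<Phi> p"] Phi_r[OF that] Ix[OF that] r_le by (simp add: \<Phi>_def)
  have "continuous_on I (\<lambda>p. \<psi> (fst p))"
    by (rule continuous_on_compose2[OF continuous_psi])
      (use Ix(1) x0d r_le in \<open>fastforce intro!: continuous_intros simp: abs_le_iff\<close>)+
  then have "continuous_on I (\<lambda>p. of_real (fst p) + \<i> * of_real (\<psi> (fst p) + snd p))"
    by (intro continuous_intros)
  moreover have "\<Phi> = (\<lambda>p. of_real (fst p) + \<i> * of_real (\<psi> (fst p) + snd p))"
    by (simp add: fun_eq_iff \<Phi>_def complex_eq_iff)
  ultimately have Phi_cont: "continuous_on I \<Phi>" by (simp only:)
  have Phi_ReIm: "z = \<Phi> (Re z, Im z - \<psi> (Re z))" for z by (simp add: \<Phi>_def complex_eq_iff)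
  have "compact (e ` \<Phi> ` J)"
  proof (intro compact_continuous_image)
    show "continuous_on (\<Phi> ` J) e"
      by (rule continuous_on_subset[OF e_cont]) (use Phi_r Phi_cl I(2) in auto)
    show "continuous_on J \<Phi>" by (rule continuous_on_subset[OF Phi_cont I(2)])
  qed (rule I(3))
  then have "open (- (e ` \<Phi> ` J))" by (simp add: compact_imp_closed open_Compl)
  moreover have "\<zeta> \<in> - (e ` \<Phi> ` J)"
  proof -
    have "e (\<Phi> p) \<noteq> \<zeta>" if p: "p \<in> J" for p
    proof (cases "snd p = 0")
      case True
      then have "fst p = a \<or> fst p = b" using p del by (auto simp: J_def)
      then show ?thesis using a(3) b(3) True by (auto simp: \<Phi>_def)
    next
      case False
      have pI: "p \<in> I" using p I(2) by blast
      then have "\<Phi> p \<in> S" using mem_S_iff[of "\<Phi> p"] Phi_r[OF pI] Ix[OF pI] False r_le by (simp add: \<Phi>_def)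
      then show ?thesis using e_eq[of "\<Phi> p"] g_disc Phi_r[OF pI] zeta by fastforce
    qed
    then show ?thesis by auto
  qed
  ultimately obtain \<epsilon> where eps: "0 < \<epsilon>" "ball \<zeta> \<epsilon> \<subseteq> - (e ` \<Phi> ` J)" by (rule openE)
  define C where "C = ball (0::complex) 1 \<inter> ball \<zeta> \<epsilon>"
  have GS: "G w \<in> S" "g (G w) = w" if "w \<in> C" for w using that G_mem g_G by (auto simp: C_def)
  have "convex C" unfolding C_def by (intro convex_Int convex_ball)
  then have "connected C" by (rule convex_connected)
  moreover have "continuous_on C G"
    using holomorphic_on_imp_continuous_on[OF G_holo] by (rule continuous_on_subset) (auto simp: C_def)
  ultimately have conn: "connected (G ` C)" using connected_continuous_image by blast
  have GO: "G w \<notin> \<Phi> ` J" if w: "w \<in> C" for w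
  proof
    assume *: "G w \<in> \<Phi> ` J"
    then have "norm (G w) < r" using Phi_r I(2) by auto
    then have "e (G w) = w" using e_eq GS[OF w] by simp
    then have "w \<in> e ` \<Phi> ` J" using * by (metis imageI)
    then show False using eps(2) w by (auto simp: C_def)
  qed
  have Qr: "norm z < r" if "z \<in> Q" for z
    using Phi_r[of "(Re z, Im z - \<psi> (Re z))"] that Phi_ReIm[of z] by (auto simp: Q_def I_def)
  have "open Q"
  proof -
    have "continuous_on (ball 0 1) (\<lambda>w. Im w - \<psi> (Re w))"
      using continuous_height continuous_on_subset ball_subset_cball by blast
    then have "open (ball 0 1 \<inter> (\<lambda>w. Im w - \<psi> (Re w)) -` {0<..<\<delta>})"
      by (rule continuous_open_preimage) auto
    moreover have "open {z. a < Re z}" "open {z. Re z < b}" by (auto intro!: open_Collect_less continuous_intros)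
    moreover have "Q = ball 0 1 \<inter> (\<lambda>w. Im w - \<psi> (Re w)) -` {0<..<\<delta>} \<inter> {z. a < Re z} \<inter> {z. Re z < b}"
      using Qr r_le by (fastforce simp: Q_def)
    ultimately show ?thesis by (metis open_Int)
  qed
  have frQ: "z \<in> \<Phi> ` J" if z: "z \<in> frontier Q" "z \<in> S" for z
  proof -
    have "Q \<subseteq> \<Phi> ` I"
    proof
      fix z assume "z \<in> Q"
      then have "(Re z, Im z - \<psi> (Re z)) \<in> I" by (auto simp: Q_def I_def)
      then show "z \<in> \<Phi> ` I" using Phi_ReIm[of z] by blast
    qed
    moreover have "closed (\<Phi> ` I)" by (intro compact_imp_closed compact_continuous_image Phi_cont I)
    ultimately have "closure Q \<subseteq> \<Phi> ` I" by (rule closure_minimal)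
    moreover have zQ: "z \<in> closure Q" "z \<notin> Q" using z \<open>open Q\<close> by (auto simp: frontier_def interior_open)
    ultimately obtain p where p: "p \<in> I" "z = \<Phi> p" by blast
    have "0 < snd p" using mem_S_iff[of z] z(2) Phi_r[OF p(1)] p r_le by (simp add: \<Phi>_def)
    then have "p \<in> J" using zQ(2) p by (cases p) (auto simp: \<Phi>_def Q_def I_def J_def)
    then show ?thesis using p by blast
  qed
  \<comment> \<open>Points of the box straight above \<open>q\<close> have images near
    \<open>\<zeta>\<close>. So the connected image of \<open>C\<close> under \<open>G\<close> meets
    the box and, avoiding \<open>J\<close>, stays in it.\<close>
  have "\<exists>w\<in>C. G w \<in> Q"
  proof -
    have "((\<lambda>t. e (\<Phi> (x0, t))) \<longlongrightarrow> \<zeta>) (at_right 0)"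
    proof -
      have "((\<lambda>t. \<Phi> (x0, t)) \<longlongrightarrow> \<Phi> (x0, 0)) (at_right 0)"
        unfolding \<Phi>_def fst_conv snd_conv by (intro tendsto_intros tendsto_Complex) 
      moreover have "\<Phi> (x0, 0) = q" by (simp add: \<Phi>_def qx)
      moreover have "\<forall>\<^sub>F t in at_right 0. \<Phi> (x0, t) \<in> closure S \<inter> ball 0 r \<and> \<Phi> (x0, t) \<noteq> q"
        using del a b Phi_r[of "(x0, _)"] Phi_cl[of "(x0, _)"]
        by (intro eventually_at_rightI[of 0 \<delta>]) (auto simp: I_def \<Phi>_def qx)
      ultimately have "filterlim (\<lambda>t. \<Phi> (x0, t)) (at q within closure S \<inter> ball 0 r) (at_right 0)"
        by (simp add: filterlim_at)
      from filterlim_compose[OF e_tendsto[of q] this] show ?thesis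
        using q by (simp add: \<zeta>_def frontier_def)
    qed
    then have "\<forall>\<^sub>F t in at_right 0. dist (e (\<Phi> (x0, t))) \<zeta> < \<epsilon>" using eps(1) by (simp add: tendsto_iff)
    moreover have "\<forall>\<^sub>F t in at_right 0. 0 < t \<and> t < \<delta>"
      using del by (intro eventually_at_rightI[of 0 \<delta>]) auto
    ultimately have "\<forall>\<^sub>F t in at_right 0. dist (e (\<Phi> (x0, t))) \<zeta> < \<epsilon> \<and> 0 < t \<and> t < \<delta>"
      by (rule eventually_conj)
    then obtain t where t: "dist (e (\<Phi> (x0, t))) \<zeta> < \<epsilon>" "0 < t" "t < \<delta>"
      using eventually_happens[of _ "at_right (0::real)"] by auto
    have tI: "(x0, t) \<in> I" using a b t by (auto simp: I_def)
    have tQ: "\<Phi> (x0, t) \<in> Q" using a b t by (auto simp: Q_def \<Phi>_def)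
    have tS: "\<Phi> (x0, t) \<in> S" using mem_S_iff[of "\<Phi> (x0, t)"] Phi_r[OF tI] t r_le by (simp add: \<Phi>_def)
    have "e (\<Phi> (x0, t)) = g (\<Phi> (x0, t))" using e_eq tS Phi_r[OF tI] by blast
    then have "g (\<Phi> (x0, t)) \<in> C" using t(1) g_disc[OF tS] by (simp add: C_def dist_commute)
    moreover have "G (g (\<Phi> (x0, t))) \<in> Q" using tQ G_g[OF tS] by simp
    ultimately show ?thesis by blast
  qed
  then have "G ` C \<inter> Q \<noteq> {}" by blast
  then have "G ` C \<subseteq> Q"
    using connected_Int_frontier[OF conn, of Q] frQ GO GS(1) by blast
  have "norm (G w - q) < \<eta>" if "norm w < 1" "norm (w - e q) < \<epsilon>" for w
  proof -
    have "w \<in> C" using that by (simp add: C_def \<zeta>_def dist_norm norm_minus_commute)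
    then have "G w \<in> Q" using \<open>G ` C \<subseteq> Q\<close> by blast
    then have "norm (\<Phi> (Re (G w), Im (G w) - \<psi> (Re (G w))) - q) < \<eta>'"
      unfolding \<Phi>_def fst_conv snd_conv using a b by (intro box(1)) (auto simp: Q_def abs_le_iff)
    then show ?thesis using Phi_ReIm[of "G w"] eta' by simp
  qed
  with eps(1) show thesis using that by blast
qed

end

section \<open>Reflection and isolated critical points\<close>

text \<open>Only the imaginary part is bounded, so Cauchy's estimate is applied to
  \<open>exp (\<i> * h w / m)\<close>, whose modulus lies between \<open>exp (- 1)\<close> and
  \<open>exp 1\<close>; the lower bound recovers the derivative of \<open>h\<close>.\<close>

lemma norm_deriv_le_of_bounded_Im:
  assumes h: "h holomorphic_on ball z s" and r: "0 < r" "r < s" and m: "0 < m"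
    and b: "\<And>w. w \<in> ball z s \<Longrightarrow> \<bar>Im (h w)\<bar> \<le> m"
  shows "norm (deriv h z) \<le> exp 2 * m / r"
proof -
  define E where "E w = exp (\<i> * h w / of_real m)" for w
  have nE: "norm (E w) = exp (- Im (h w) / m)" for w by (simp add: E_def)
  have E_le: "exp (- 1) \<le> norm (E w)" "norm (E w) \<le> exp 1" if "w \<in> ball z s" for w
    using b[OF that] m by (simp_all add: nE field_simps abs_le_iff)
  have hE: "E holomorphic_on ball z s" unfolding E_def using h m by (intro holomorphic_intros) auto
  have sub: "cball z r \<subseteq> ball z s" using r by auto
  have zb: "z \<in> ball z s" using r by simp
  have "norm ((deriv ^^ 1) E z) \<le> fact 1 * exp 1 / r ^ 1"
  proof (rule Cauchy_inequality[OF _ _ r(1)])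
    show "E holomorphic_on ball z r" by (rule holomorphic_on_subset[OF hE]) (use r in auto)
    show "continuous_on (cball z r) E"
      using holomorphic_on_imp_continuous_on[OF hE] sub by (rule continuous_on_subset)
    show "norm (E x) \<le> exp 1" if "norm (z - x) = r" for x
      using that r by (intro E_le) (auto simp: dist_norm)
  qed
  then have 1: "norm (deriv E z) \<le> exp 1 / r" by simp
  have "(h has_field_derivative deriv h z) (at z)" using h zb holomorphic_derivI by blast
  then have "(E has_field_derivative E z * (\<i> * deriv h z / of_real m)) (at z)"
    unfolding E_def using m by (auto intro!: derivative_eq_intros)
  then have "deriv E z = E z * (\<i> * deriv h z / of_real m)" by (rule DERIV_imp_deriv)
  then have 2: "norm (deriv E z) = norm (E z) * (norm (deriv h z) / m)"
    using m by (simp add: norm_mult norm_divide)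
  have "exp (- 1) * (norm (deriv h z) / m) \<le> norm (E z) * (norm (deriv h z) / m)"
    using E_le(1)[OF zb] m by (intro mult_right_mono) auto
  then have "exp (- 1) * (norm (deriv h z) / m) \<le> exp 1 / r" using 1 2 by linarith
  note 3 = this
  have "norm (deriv h z) / m = exp 1 * (exp (- 1) * (norm (deriv h z) / m))" by (simp add: exp_minus)
  also have "\<dots> \<le> exp 1 * (exp 1 / r)" using 3 by (rule mult_left_mono) simp
  also have "\<dots> = exp 2 / r" by (simp flip: exp_add)
  finally show ?thesis using m by (simp add: pos_divide_le_eq mult.commute)
qed

text \<open>Reflection needs \<open>h\<close> itself to be continuous up to the real axis, while
  only \<open>Im h\<close> is known to tend to 0. A quadratic barrier improves this to a bound
  \<open>C * Im w\<close>; then \<open>deriv h\<close> is bounded, and \<open>h\<close> is Lipschitz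
  and extends, with real values on the axis.\<close>

lemma schwarz_reflection_Im:
  fixes h :: "complex \<Rightarrow> complex"
  assumes \<rho>: "0 < \<rho>" and h: "h holomorphic_on {w. norm w < \<rho> \<and> 0 < Im w}"
    and decay: "\<And>e. 0 < e \<Longrightarrow> \<exists>\<delta>>0. \<forall>w. norm w < \<rho> \<longrightarrow> 0 < Im w \<longrightarrow> Im w < \<delta> \<longrightarrow> \<bar>Im (h w)\<bar> < e"
    and bdd: "\<And>w. norm w < \<rho> \<Longrightarrow> 0 < Im w \<Longrightarrow> \<bar>Im (h w)\<bar> \<le> M"
  obtains \<rho>' H where "0 < \<rho>'" "\<rho>' \<le> \<rho>" "H holomorphic_on ball 0 \<rho>'"
    "\<And>w. norm w < \<rho>' \<Longrightarrow> 0 < Im w \<Longrightarrow> H w = h w"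
    "\<And>w. norm w < \<rho>' \<Longrightarrow> Im w = 0 \<Longrightarrow> Im (H w) = 0"
proof -
  define U where "U = {w. norm w < \<rho> \<and> 0 < Im w}"
  have "U = ball 0 \<rho> \<inter> {w. 0 < Im w}" by (auto simp: U_def)
  then have "open U" by (simp add: open_Int open_halfspace_Im_gt)
  define R where "R = \<rho> / 2"
  have R: "0 < R" using \<rho> by (simp add: R_def)
  have "\<bar>Im (h (\<i> * of_real R))\<bar> \<le> M" using R by (intro bdd) (auto simp: norm_mult R_def)
  then have M: "0 \<le> M" by linarith
  define C where "C = 2 * M / R"
  have lin: "\<bar>Im (h (Complex x y))\<bar> \<le> C * y" if xy: "\<bar>x\<bar> < R" "0 < y" "y < R" for x y
  proof -
    \<comment> \<open>In the half disc \<open>Re b\<close> dominates the squared distance to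
      \<open>x\<close>, so it is at least \<open>R\<^sup>2\<close> on the arc, while at height
      \<open>y\<close> above \<open>x\<close> it is at most \<open>2 * R * y\<close>.\<close>
    define b where "b w = (w - of_real x)\<^sup>2 - 2 * \<i> * of_real R * (w - of_real x)" for w
    have Reb: "Re (b w) = (Re w - x)\<^sup>2 - (Im w)\<^sup>2 + 2 * R * Im w" for w
      by (simp add: b_def power2_eq_square)
    define D where "D = ball (of_real x) R \<inter> {w. 0 < Im w}"
    have D: "open D" "bounded D" by (auto simp: D_def open_Int bounded_Int open_halfspace_Im_gt)
    have DU: "D \<subseteq> U"
    proof
      fix w assume "w \<in> D"
      then have w: "norm (w - of_real x) < R" "0 < Im w" by (auto simp: D_def dist_norm norm_minus_commute)
      have "norm w \<le> norm (complex_of_real x) + norm (w - of_real x)"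
        using norm_triangle_ineq[of "of_real x" "w - of_real x"] by simp
      then show "w \<in> U" using w xy by (simp add: U_def R_def)
    qed
    have ImR: "Im w < R" if "w \<in> D" for w
      using that abs_Im_le_cmod[of "w - of_real x"] by (auto simp: D_def dist_norm norm_minus_commute)
    have Reb0: "0 \<le> Re (b w)" "(norm (w - of_real x))\<^sup>2 \<le> Re (b w)" if w: "w \<in> D" for w
    proof -
      have "Im w * Im w \<le> R * Im w" using ImR[OF w] w by (intro mult_right_mono) (auto simp: D_def)
      then show "(norm (w - of_real x))\<^sup>2 \<le> Re (b w)" unfolding Reb cmod_power2 by (simp add: power2_eq_square)
      then show "0 \<le> Re (b w)" using zero_le_power2 order_trans by blast
    qed
    have half: "\<sigma> * Im (h (Complex x y)) \<le> C * y" if sig: "\<bar>\<sigma>\<bar> = 1" for \<sigma> :: real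
    proof -
      define F where "F w = - \<i> * of_real \<sigma> * h w - of_real (M / R\<^sup>2) * b w" for w
      have ReF: "Re (F w) = \<sigma> * Im (h w) - M / R\<^sup>2 * Re (b w)" for w by (simp add: F_def)
      have sl: "\<sigma> * v \<le> \<bar>v\<bar>" for v using sig by (metis abs_ge_self abs_mult mult_1)
      have zD: "Complex x y \<in> D"
      proof -
        have "Complex x y - of_real x = \<i> * of_real y" by (simp add: complex_eq_iff)
        then have "norm (Complex x y - of_real x) = y" using xy by (simp add: norm_mult)
        then show ?thesis using xy by (simp add: D_def dist_norm norm_minus_commute)
      qed
      have "Re (F (Complex x y)) \<le> 0"
      proof (rule Re_le_of_eventually_at_frontier[OF D _ _ zD])
        show "F holomorphic_on D" unfolding F_def b_def
          by (intro holomorphic_intros holomorphic_on_subset[OF h[folded U_def] DU])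
        fix \<xi> and e :: real assume xi: "\<xi> \<in> frontier D" and e: "0 < e"
        have ev: "\<forall>\<^sub>F w in at \<xi> within D. w \<in> D" by (simp add: eventually_at_filter)
        have xcl: "\<xi> \<in> closure D" "\<xi> \<notin> D" using xi D(1) by (auto simp: frontier_def interior_open)
        have "closure D \<subseteq> cball (of_real x) R \<inter> {w. 0 \<le> Im w}"
          by (rule closure_minimal) (auto simp: D_def closed_Int closed_halfspace_Im_ge)
        then have xi2: "norm (\<xi> - of_real x) \<le> R" "0 \<le> Im \<xi>"
          using xcl(1) by (auto simp: dist_norm norm_minus_commute)
        show "\<forall>\<^sub>F w in at \<xi> within D. Re (F w) \<le> e"
        proof (cases "Im \<xi> = 0")
          case True
          obtain \<delta> where del: "\<delta> > 0" "\<And>w. w \<in> U \<Longrightarrow> Im w < \<delta> \<Longrightarrow> \<bar>Im (h w)\<bar> < e"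
            using decay[OF e] by (auto simp: U_def)
          have "(Im \<longlongrightarrow> Im \<xi>) (at \<xi> within D)" by (intro tendsto_intros)
          then have "\<forall>\<^sub>F w in at \<xi> within D. Im w < \<delta>"
            using del(1) True by (intro order_tendstoD(2)) auto
          with ev show ?thesis
          proof eventually_elim
            case (elim w)
            have "0 \<le> M / R\<^sup>2 * Re (b w)" using Reb0(1)[OF elim(1)] M by simp
            moreover have "\<sigma> * Im (h w) < e" using sl[of "Im (h w)"] del(2)[of w] elim DU by force
            ultimately show ?case unfolding ReF by linarith
          qed
        next
          case False
          then have nR: "norm (\<xi> - of_real x) = R" using xi2 xcl(2) by (auto simp: D_def dist_norm norm_minus_commute)
          have lim: "((\<lambda>w. M - M / R\<^sup>2 * (norm (w - of_real x))\<^sup>2) \<longlongrightarrow> M - M / R\<^sup>2 * (norm (\<xi> - of_real x))\<^sup>2) (at \<xi> within D)"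
            by (intro tendsto_intros)
          have "M - M / R\<^sup>2 * (norm (\<xi> - of_real x))\<^sup>2 < e" using e R by (simp add: nR)
          from order_tendstoD(2)[OF lim this] ev show ?thesis
          proof eventually_elim
            case (elim w)
            have "M / R\<^sup>2 * (norm (w - of_real x))\<^sup>2 \<le> M / R\<^sup>2 * Re (b w)"
              using Reb0(2)[OF elim(2)] M by (intro mult_left_mono) auto
            moreover have "\<sigma> * Im (h w) \<le> M" using sl[of "Im (h w)"] bdd[of w] elim DU by (force simp: U_def)
            ultimately show ?case using elim(1) unfolding ReF by linarith
          qed
        qed
      qed
      then have "\<sigma> * Im (h (Complex x y)) \<le> M / R\<^sup>2 * (2 * R * y - y\<^sup>2)" by (simp add: ReF Reb algebra_simps)
      also have "\<dots> \<le> M / R\<^sup>2 * (2 * R * y)" using M by (intro mult_left_mono) auto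
      also have "\<dots> = C * y" using R by (simp add: C_def power2_eq_square)
      finally show ?thesis .
    qed
    show ?thesis using half[of 1] half[of "-1"] by (simp add: abs_le_iff)
  qed
  have C: "0 \<le> C" using M R by (simp add: C_def)
  \<comment> \<open>The derivative is estimated on a disc whose radius is a fixed fraction of
    \<open>Im w\<close>, which cancels against the linear bound for \<open>Im h\<close>.
    \<open>C + 1\<close> replaces \<open>C\<close> to keep that bound positive.\<close>
  define B where "B = exp 2 * (8 * (C + 1))"
  define T where "T = {w. norm w < R / 2 \<and> 0 < Im w}"
  have TU: "T \<subseteq> U" using R by (auto simp: T_def U_def R_def)
  have T_eq: "T = ball 0 (R / 2) \<inter> {w. 0 < Im w}" by (auto simp: T_def)
  have dB: "norm (deriv h w) \<le> B" if w: "w \<in> T" for w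
  proof -
    define y where "y = Im w"
    have y: "0 < y" "y < R / 2" using w abs_Im_le_cmod[of w] by (auto simp: T_def y_def)
    have inb: "\<bar>Re v\<bar> < R \<and> 0 < Im v \<and> Im v < 3/2 * y" if "v \<in> ball w (y / 2)" for v
    proof -
      have "norm (v - w) < y / 2" using that by (simp add: dist_norm norm_minus_commute)
      moreover have "\<bar>Re w\<bar> < R / 2" using w abs_Re_le_cmod[of w] by (simp add: T_def)
      ultimately show ?thesis
        using abs_Re_le_cmod[of "v - w"] abs_Im_le_cmod[of "v - w"] y by (simp add: y_def abs_le_iff abs_less_iff) linarith
    qed
    have vU: "v \<in> U" if "v \<in> ball w (y / 2)" for v
    proof -
      have "norm v \<le> norm w + norm (v - w)" using norm_triangle_ineq[of w "v - w"] by simp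
      moreover have "norm (v - w) < y / 2" using that by (simp add: dist_norm norm_minus_commute)
      ultimately show ?thesis using inb[OF that] w y by (simp add: U_def T_def R_def)
    qed
    have "norm (deriv h w) \<le> exp 2 * (2 * (C + 1) * y) / (y / 4)"
    proof (rule norm_deriv_le_of_bounded_Im[of h w "y / 2"])
      show "h holomorphic_on ball w (y / 2)"
        by (rule holomorphic_on_subset[OF h[folded U_def]]) (use vU in blast)
      fix v assume v: "v \<in> ball w (y / 2)"
      have "\<bar>Im (h (Complex (Re v) (Im v)))\<bar> \<le> C * Im v"
        using inb[OF v] y by (intro lin) auto
      also have "\<dots> \<le> C * (3/2 * y)" using inb[OF v] C by (intro mult_left_mono) auto
      also have "\<dots> \<le> 2 * (C + 1) * y" using C y by (simp add: algebra_simps)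
      finally show "\<bar>Im (h v)\<bar> \<le> 2 * (C + 1) * y" by simp
    qed (use y C in auto)
    also have "\<dots> = B" using y by (simp add: B_def)
    finally show ?thesis .
  qed
  have "convex T" unfolding T_eq by (intro convex_Int convex_ball convex_halfspace_Im_gt)
  have "B-lipschitz_on T h"
  proof (rule lipschitz_onI)
    show "0 \<le> B" using C by (simp add: B_def)
    fix v w assume vw: "v \<in> T" "w \<in> T"
    have "norm (h v - h w) \<le> B * norm (v - w)"
    proof (rule field_differentiable_bound[OF \<open>convex T\<close>, of h "deriv h"])
      show "(h has_field_derivative deriv h z) (at z within T)" if "z \<in> T" for z
        using holomorphic_derivI[OF h[folded U_def] \<open>open U\<close>] that TU by blast
    qed (use vw dB in auto)
    then show "dist (h v) (h w) \<le> B * dist v w" by (simp add: dist_norm)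
  qed
  then have "uniformly_continuous_on T h" by (rule lipschitz_on_uniformly_continuous)
  then obtain k where k: "uniformly_continuous_on (closure T) k" "\<And>w. w \<in> T \<Longrightarrow> h w = k w"
    using uniformly_continuous_on_extension_on_closure by metis
  have clT: "w \<in> closure T" if w: "norm w < R / 2" "0 \<le> Im w" for w
  proof (unfold closure_approachable, intro allI impI)
    fix e :: real assume "0 < e"
    define d where "d = min e (R / 2 - norm w) / 2"
    have d: "0 < d" "d < e" "d < R / 2 - norm w" using \<open>0 < e\<close> w by (auto simp: d_def min_def)
    have "norm (w + \<i> * of_real d) \<le> norm w + d"
      using norm_triangle_ineq[of w "\<i> * of_real d"] d by (simp add: norm_mult)
    then have "w + \<i> * of_real d \<in> T" using d w by (simp add: T_def)
    moreover have "dist (w + \<i> * of_real d) w < e" using d by (simp add: dist_norm norm_mult)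
    ultimately show "\<exists>v\<in>T. dist v w < e" by blast
  qed
  have kc: "continuous_on (closure T) k" using k(1) by (rule uniformly_continuous_imp_continuous)
  have kreal: "Im (k w) = 0" if w: "norm w < R / 2" "Im w = 0" for w
  proof -
    have wcl: "w \<in> closure T" "w \<notin> T" using clT[of w] w by (auto simp: T_def)
    then have nb: "at w within T \<noteq> bot" by (simp add: closure_def trivial_limit_within)
    have "(k \<longlongrightarrow> k w) (at w within T)"
    proof (rule tendsto_within_subset[OF _ closure_subset])
      show "(k \<longlongrightarrow> k w) (at w within closure T)" using kc wcl(1) by (simp add: continuous_on_def)
    qed
    then have "((\<lambda>v. Im (k v)) \<longlongrightarrow> Im (k w)) (at w within T)" by (rule tendsto_Im)
    moreover have "((\<lambda>v. Im (k v)) \<longlongrightarrow> 0) (at w within T)"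
    proof (rule tendstoI)
      fix e :: real assume "0 < e"
      from decay[OF this] obtain \<delta> where del: "\<delta> > 0" "\<And>v. v \<in> U \<Longrightarrow> Im v < \<delta> \<Longrightarrow> \<bar>Im (h v)\<bar> < e"
        by (auto simp: U_def)
      have "(Im \<longlongrightarrow> Im w) (at w within T)" by (intro tendsto_intros)
      then have "\<forall>\<^sub>F v in at w within T. Im v < \<delta>" using del(1) w by (intro order_tendstoD(2)) auto
      moreover have "\<forall>\<^sub>F v in at w within T. v \<in> T" by (simp add: eventually_at_filter)
      ultimately show "\<forall>\<^sub>F v in at w within T. dist (Im (k v)) 0 < e"
        by eventually_elim (use del(2) TU k(2) in force)
    qed
    ultimately show ?thesis using tendsto_unique[OF nb] by blast
  qed
  define H where "H w = (if 0 \<le> Im w then k w else cnj (k (cnj w)))" for w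
  have "H holomorphic_on ball 0 (R / 2)"
    unfolding H_def
  proof (rule Schwarz_reflection)
    show "cnj ` ball 0 (R / 2) \<subseteq> ball 0 (R / 2)" by auto
    have "h holomorphic_on ball 0 (R / 2) \<inter> {z. 0 < Im z}"
      by (rule holomorphic_on_subset[OF h[folded U_def] TU[unfolded T_eq]])
    then show "k holomorphic_on ball 0 (R / 2) \<inter> {z. 0 < Im z}"
      by (rule holomorphic_transform) (use k(2) T_eq in blast)
    show "continuous_on (ball 0 (R / 2) \<inter> {z. 0 \<le> Im z}) k"
      by (rule continuous_on_subset[OF kc]) (use clT in auto)
    show "k z \<in> \<real>" if "z \<in> ball 0 (R / 2)" "z \<in> \<real>" for z
      using kreal[of z] that by (simp add: complex_is_Real_iff)
  qed auto
  moreover have "H w = h w" if "norm w < R / 2" "0 < Im w" for w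
    using k(2)[of w] that by (simp add: H_def T_def)
  moreover have "Im (H w) = 0" if "norm w < R / 2" "Im w = 0" for w
    using kreal[OF that] that by (simp add: H_def)
  ultimately show thesis using that[of "R / 2" H] R \<rho> by (simp add: R_def)
qed

text \<open>On the real axis \<open>H\<close> is real, so \<open>H'\<close> is almost real there and \<open>Im H\<close> has the sign of \<open>Re H'\<close> above.\<close>

lemma one_signed_above_regular_point:
  assumes "0 < \<rho>" and H: "H holomorphic_on ball 0 \<rho>"
    and real: "\<And>w. norm w < \<rho> \<Longrightarrow> Im w = 0 \<Longrightarrow> Im (H w) = 0"
    and t: "norm t < \<rho>" "Im t = 0" and d: "deriv H t \<noteq> 0"
  obtains s where "0 < s"
    "(\<forall>w\<in>ball t s. 0 < Im w \<longrightarrow> 0 < Im (H w)) \<or> (\<forall>w\<in>ball t s. 0 < Im w \<longrightarrow> Im (H w) < 0)"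
proof -
  define c where "c = deriv H t"
  have c0: "0 < norm c" using d by (simp add: c_def)
  have "continuous_on (ball 0 \<rho>) (deriv H)"
    using holomorphic_deriv[OF H open_ball] by (rule holomorphic_on_imp_continuous_on)
  then have "(deriv H \<longlongrightarrow> c) (at t)"
    using t unfolding c_def by (metis at_within_open continuous_on_def mem_ball_0 open_ball)
  then have "\<forall>\<^sub>F w in at t. dist (deriv H w) c < norm c / 4"
    by (rule tendstoD) (use c0 in simp)
  then obtain s0 where s0: "0 < s0" "\<And>w. w \<noteq> t \<Longrightarrow> dist w t < s0 \<Longrightarrow> dist (deriv H w) c < norm c / 4"
    unfolding eventually_at by auto
  define s where "s = min s0 (\<rho> - norm t)"
  have s: "0 < s" "s \<le> s0" "s \<le> \<rho> - norm t" using s0 t by (auto simp: s_def)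
  have sub: "norm w < \<rho>" if "w \<in> ball t s" for w
    using that s norm_triangle_ineq[of t "w - t"] by (simp add: dist_norm norm_minus_commute)
  have est: "norm (H v - H w - c * (v - w)) \<le> norm c / 4 * norm (v - w)"
    if vw: "v \<in> ball t s" "w \<in> ball t s" for v w
  proof -
    have "norm ((H v - c * v) - (H w - c * w)) \<le> norm c / 4 * norm (v - w)"
    proof (rule field_differentiable_bound[OF convex_ball[of t s]])
      fix z assume z: "z \<in> ball t s"
      have "(H has_field_derivative deriv H z) (at z within ball t s)"
        using holomorphic_derivI[OF H open_ball] sub[OF z] by simp
      then show "((\<lambda>v. H v - c * v) has_field_derivative deriv H z - c) (at z within ball t s)"
        by (auto intro!: derivative_eq_intros)
      show "norm (deriv H z - c) \<le> norm c / 4"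
        using s0(2)[of z] z s by (cases "z = t") (auto simp: dist_norm norm_minus_commute c_def)
    qed (use vw in auto)
    then show ?thesis by (simp add: algebra_simps)
  qed
  \<comment> \<open>\<open>H\<close> is real at \<open>t\<close> and at \<open>t + s / 2\<close>, so
    \<open>c\<close> is almost real. This leaves \<open>\<bar>Re c\<bar>\<close> above
    \<open>norm c / 4\<close>, the relative error of the linear approximation.\<close>
  have Imc: "\<bar>Im c\<bar> \<le> norm c / 4"
  proof -
    define v where "v = t + of_real (s / 2)"
    have nv: "norm (v - t) = s / 2" using s by (simp add: v_def)
    then have "v \<in> ball t s" using s by (simp add: dist_norm norm_minus_commute)
    moreover have "t \<in> ball t s" using s by simp
    ultimately have "norm (H v - H t - c * (v - t)) \<le> norm c / 4 * (s / 2)"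
      and r: "Im (H v) = 0" "Im (H t) = 0"
      using est[of v t] nv real[of v] real[of t] sub t(2) by (auto simp: v_def)
    then have "\<bar>Im (H v - H t - c * (v - t))\<bar> \<le> norm c / 4 * (s / 2)"
      using abs_Im_le_cmod order_trans by blast
    moreover have "Im (H v - H t - c * (v - t)) = - (Im c * (s / 2))" using r by (simp add: v_def)
    ultimately have "\<bar>Im c\<bar> * (s / 2) \<le> norm c / 4 * (s / 2)" using s by (simp add: abs_mult)
    then show ?thesis using s by simp
  qed
  have Rec: "norm c / 4 < \<bar>Re c\<bar>" using cmod_le[of c] Imc c0 by linarith
  have main: "\<bar>Im (H w) - Re c * Im w\<bar> \<le> norm c / 4 * Im w" if w: "w \<in> ball t s" "0 < Im w" for w
  proof -
    define v where "v = complex_of_real (Re w)"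
    have wv: "w - v = \<i> * of_real (Im w)" by (simp add: v_def complex_eq_iff)
    then have n: "norm (w - v) = Im w" using w by (simp add: norm_mult)
    have "norm (v - t) \<le> norm (w - t)"
    proof -
      have "v - t = of_real (Re (w - t))" using t by (simp add: v_def complex_eq_iff)
      then have "norm (v - t) = \<bar>Re (w - t)\<bar>" by (simp only: norm_of_real)
      then show ?thesis using abs_Re_le_cmod[of "w - t"] by (simp only:)
    qed
    then have vb: "v \<in> ball t s" using w by (simp add: dist_norm norm_minus_commute)
    have "Im (H v) = 0" using real[of v] sub[OF vb] by (simp add: v_def)
    then have "Im (H w - H v - c * (w - v)) = Im (H w) - Re c * Im w" unfolding wv by simp
    moreover have "\<bar>Im (H w - H v - c * (w - v))\<bar> \<le> norm c / 4 * Im w"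
      using abs_Im_le_cmod[of "H w - H v - c * (w - v)"] est[OF w(1) vb] unfolding n by linarith
    ultimately show ?thesis by (simp only:)
  qed
  show thesis
  proof (rule that[OF s(1)])
    show "(\<forall>w\<in>ball t s. 0 < Im w \<longrightarrow> 0 < Im (H w)) \<or> (\<forall>w\<in>ball t s. 0 < Im w \<longrightarrow> Im (H w) < 0)"
    proof (cases "0 < Re c")
      case True
      have "0 < Im (H w)" if "w \<in> ball t s" "0 < Im w" for w
      proof -
        have "norm c / 4 * Im w < Re c * Im w" using Rec True that by (intro mult_strict_right_mono) auto
        then show ?thesis using main[OF that] by linarith
      qed
      then show ?thesis by blast
    next
      case False
      have "Im (H w) < 0" if "w \<in> ball t s" "0 < Im w" for w
      proof -
        have "norm c / 4 * Im w < (- Re c) * Im w" using Rec False that by (intro mult_strict_right_mono) auto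
        then show ?thesis using main[OF that] by linarith
      qed
      then show ?thesis by blast
    qed
  qed
qed

context graph_domain_extended
begin

lemma connected_S: "connected S"
proof -
  have "S = G ` ball 0 1"
  proof
    show "S \<subseteq> G ` ball 0 1"
    proof
      fix z assume "z \<in> S"
      then show "z \<in> G ` ball 0 1" using g_disc[of z] G_g[of z] by (metis imageI mem_ball_0)
    qed
  qed (use G_mem in auto)
  moreover have "connected (G ` ball 0 1)"
    using holomorphic_on_imp_continuous_on[OF G_holo] by (intro connected_continuous_image) auto
  ultimately show ?thesis by simp
qed

lemma zero_in_frontier: "0 \<in> frontier S" "norm (0::complex) < r"
  using mem_frontier_S_iff[of 0] psi_0 r_pos by auto

text \<open>Boundary values of \<open>Im f\<close> are given only at frontier points in the unit
  disc, hence the restriction \<open>norm (G w) \<le> \<eta>\<close>. The points of that smaller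
  disc with \<open>\<bar>Im (f z)\<bar> \<ge> c\<close> form a compact subset of \<open>S\<close>,
  on which \<open>norm g\<close> has a maximum below 1.\<close>

lemma Im_f_G_decay:
  assumes f: "f holomorphic_on S" and c: "0 < c" and \<eta>: "\<eta> < 1"
    and f0: "\<And>\<xi>. \<xi> \<in> frontier S \<Longrightarrow> norm \<xi> < 1 \<Longrightarrow> ((\<lambda>z. Im (f z)) \<longlongrightarrow> 0) (at \<xi> within S)"
  obtains m where "m < 1" "\<And>w. m < norm w \<Longrightarrow> norm w < 1 \<Longrightarrow> norm (G w) \<le> \<eta> \<Longrightarrow> \<bar>Im (f (G w))\<bar> < c"
proof -
  define K where "K = {z \<in> S \<inter> cball 0 \<eta>. c \<le> \<bar>Im (f z)\<bar>}"
  have "closed K" unfolding K_def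
  proof (rule closed_superlevel_set)
    show "continuous_on S (\<lambda>z. \<bar>Im (f z)\<bar>)"
      by (intro continuous_intros holomorphic_on_imp_continuous_on f)
    fix \<xi> assume xi: "\<xi> \<in> closure S" "\<xi> \<in> cball 0 \<eta>" "\<xi> \<notin> S"
    then have "\<xi> \<in> frontier S" "norm \<xi> < 1" using open_S \<eta> by (auto simp: frontier_def interior_open)
    then have "((\<lambda>z. \<bar>Im (f z)\<bar>) \<longlongrightarrow> \<bar>0\<bar>) (at \<xi> within S)" by (intro tendsto_rabs f0)
    then show "\<forall>\<^sub>F z in at \<xi> within S. \<bar>Im (f z)\<bar> < c" using c by (intro order_tendstoD(2)) auto
  qed simp
  moreover have "bounded K" by (rule bounded_subset[of "cball 0 \<eta>"]) (auto simp: K_def)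
  ultimately have K: "compact K" by (simp add: compact_eq_bounded_closed)
  show thesis
  proof (cases "K = {}")
    case True
    have "\<bar>Im (f (G w))\<bar> < c" if "norm w < 1" "norm (G w) \<le> \<eta>" for w
    proof (rule ccontr)
      assume "\<not> \<bar>Im (f (G w))\<bar> < c"
      then have "G w \<in> K" using that G_mem by (simp add: K_def)
      with True show False by simp
    qed
    then show thesis using that[of 0] by simp
  next
    case False
    have "continuous_on K (\<lambda>z. norm (g z))"
      by (intro continuous_on_norm continuous_on_subset[OF holomorphic_on_imp_continuous_on[OF g_holo]])
        (auto simp: K_def)
    then obtain z0 where z0: "z0 \<in> K" "\<And>z. z \<in> K \<Longrightarrow> norm (g z) \<le> norm (g z0)"
      using continuous_attains_sup[OF K False] by blast
    show thesis
    proof (rule that[of "norm (g z0)"])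
      show "norm (g z0) < 1" using z0(1) g_disc by (auto simp: K_def)
      fix w assume w: "norm (g z0) < norm w" "norm w < 1" "norm (G w) \<le> \<eta>"
      show "\<bar>Im (f (G w))\<bar> < c"
      proof (rule ccontr)
        assume "\<not> \<bar>Im (f (G w))\<bar> < c"
        then have "G w \<in> K" using w G_mem by (simp add: K_def)
        then show False using z0(2)[of "G w"] g_G[OF w(2)] w by simp
      qed
    qed
  qed
qed

text \<open>A point of the disc on the radius to the common value, close to the circle, has its
  image under \<open>G\<close> near both \<open>p\<close> and \<open>q\<close>.\<close>

lemma e_inj:
  assumes "p \<in> frontier S" "norm p < r" "q \<in> frontier S" "norm q < r" "e p = e q"
  shows "p = q"
proof (rule ccontr)
  assume "p \<noteq> q"
  define \<eta> where "\<eta> = norm (p - q) / 2"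
  have eta: "0 < \<eta>" using \<open>p \<noteq> q\<close> by (simp add: \<eta>_def)
  obtain a where a: "0 < a" "\<And>w. norm w < 1 \<Longrightarrow> norm (w - e p) < a \<Longrightarrow> norm (G w - p) < \<eta>"
    using G_tendsto[OF assms(1,2) eta] by metis
  obtain b where b: "0 < b" "\<And>w. norm w < 1 \<Longrightarrow> norm (w - e q) < b \<Longrightarrow> norm (G w - q) < \<eta>"
    using G_tendsto[OF assms(3,4) eta] by metis
  define s where "s = min 1 (min a b) / 2"
  have s: "0 < s" "s < 1" "s < a" "s < b" using a(1) b(1) by (auto simp: s_def min_def)
  define w where "w = of_real (1 - s) * e p"
  have ne: "norm (e p) = 1" using norm_e assms by blast
  have "norm w = \<bar>1 - s\<bar>" unfolding w_def norm_mult norm_of_real ne by simp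
  then have "norm w < 1" using s by simp
  moreover have "norm (w - e p) = s"
  proof -
    have "w - e p = - of_real s * e p" by (simp add: w_def algebra_simps)
    then show ?thesis using s ne by (simp add: norm_mult)
  qed
  ultimately have "norm (G w - p) < \<eta>" "norm (G w - q) < \<eta>" using a(2) b(2) s assms(5) by auto
  then have "norm (p - q) < 2 * \<eta>" using norm_triangle_ineq4[of "G w - q" "G w - p"] by simp
  then show False by (simp add: \<eta>_def)
qed

text \<open>In half-plane coordinates, \<open>H\<close> is the reflected extension of
  \<open>f \<circ> G \<circ> m\<close>. The map \<open>T = mi \<circ> g\<close> is injective with
  nonzero derivative, so it sends critical points in \<open>S\<close> one to one to zeros of
  \<open>deriv H\<close>. On the frontier \<open>mi \<circ> e\<close> takes its place: where its
  value is no zero of \<open>deriv H\<close>, the function \<open>Im H\<close> has one sign above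
  it, and so has \<open>Im f\<close> nearby.\<close>

lemma locally_finite:
  assumes f: "f holomorphic_on S" and nc: "\<not> f constant_on S"
    and f0: "\<And>\<xi>. \<xi> \<in> frontier S \<Longrightarrow> norm \<xi> < 1 \<Longrightarrow> ((\<lambda>z. Im (f z)) \<longlongrightarrow> 0) (at \<xi> within S)"
  obtains d where "0 < d" "finite {z \<in> S. norm z < d \<and> deriv f z = 0}"
    "finite {q \<in> frontier S. norm q < d \<and>
      \<not> (\<exists>s>0. (\<forall>z\<in>S. dist z q < s \<longrightarrow> 0 < Im (f z)) \<or> (\<forall>z\<in>S. dist z q < s \<longrightarrow> Im (f z) < 0))}"
proof -

  \<comment> \<open>Half-plane coordinates at the image of 0\<close>
  note zero = zero_in_frontier
  define \<zeta> where "\<zeta> = e 0"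
  have zeta: "norm \<zeta> = 1" using norm_e[OF zero] by (simp add: \<zeta>_def)
  have zeta0: "\<zeta> \<noteq> 0" using zeta by auto
  \<comment> \<open>The bound 1/2 keeps \<open>G w\<close> well inside the unit disc, where the
    boundary values of \<open>Im f\<close> are known.\<close>
  obtain \<epsilon> where eps: "0 < \<epsilon>" "\<And>w. norm w < 1 \<Longrightarrow> norm (w - \<zeta>) < \<epsilon> \<Longrightarrow> norm (G w - 0) < 1/2"
    using G_tendsto[OF zero, of "1/2"] unfolding \<zeta>_def by auto
  \<comment> \<open>The Cayley transform from the upper half-plane to the disc that sends 0 to
    \<open>\<zeta>\<close>; \<open>mi\<close> is its inverse.\<close>
  define m where "m w = \<zeta> * (\<i> - w) / (\<i> + w)" for w
  define mi where "mi v = \<i> * (\<zeta> - v) / (\<zeta> + v)" for v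
  have iw: "1 \<le> norm (\<i> + w)" "\<i> + w \<noteq> 0" if "0 \<le> Im w" for w
  proof -
    show "1 \<le> norm (\<i> + w)" using abs_Im_le_cmod[of "\<i> + w"] that by simp
    then show "\<i> + w \<noteq> 0" by auto
  qed
  have m_norm: "(norm (m w))\<^sup>2 = 1 - 4 * Im w / (norm (\<i> + w))\<^sup>2" if "0 \<le> Im w" for w
  proof -
    have "(norm (m w))\<^sup>2 = (norm (\<i> - w))\<^sup>2 / (norm (\<i> + w))\<^sup>2"
      by (simp add: m_def norm_mult norm_divide zeta power_divide)
    moreover have "(norm (\<i> - w))\<^sup>2 = (norm (\<i> + w))\<^sup>2 - 4 * Im w"
      unfolding cmod_power2 by (simp add: power2_eq_square algebra_simps)
    ultimately show ?thesis using iw[OF that] by (simp add: diff_divide_distrib)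
  qed
  have m_disc: "norm (m w) < 1" if "0 < Im w" for w
  proof -
    have "0 < 4 * Im w / (norm (\<i> + w))\<^sup>2" using that iw[of w] by (intro divide_pos_pos) auto
    then have "(norm (m w))\<^sup>2 < 1\<^sup>2" using m_norm[of w] that by simp
    then show ?thesis by (rule power2_less_imp_less) simp
  qed
  have m_near: "norm (m w - \<zeta>) \<le> 2 * norm w" if "0 \<le> Im w" for w
  proof -
    have "m w - \<zeta> = - 2 * \<zeta> * w / (\<i> + w)" using iw[OF that] by (simp add: m_def field_simps)
    then have "norm (m w - \<zeta>) = 2 * norm w / norm (\<i> + w)" by (simp add: norm_mult norm_divide zeta)
    also have "\<dots> \<le> 2 * norm w / 1" using iw[OF that] by (intro divide_left_mono) auto
    finally show ?thesis by simp
  qed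
  have m_bdry: "1 - 4 * Im w \<le> norm (m w)" if "0 < Im w" for w
  proof -
    have "4 * Im w / (norm (\<i> + w))\<^sup>2 \<le> 4 * Im w / 1"
      using that iw[of w] by (intro divide_left_mono) auto
    then have "1 - 4 * Im w \<le> (norm (m w))\<^sup>2" using m_norm[of w] that by simp
    also have "\<dots> \<le> norm (m w)" using m_disc[OF that] by (simp add: power2_eq_square mult_left_le)
    finally show ?thesis .
  qed
  have m_mi: "m (mi v) = v" if "\<zeta> + v \<noteq> 0" for v
  proof -
    have "\<i> - mi v = 2 * \<i> * v / (\<zeta> + v)" "\<i> + mi v = 2 * \<i> * \<zeta> / (\<zeta> + v)"
      using that by (simp_all add: mi_def field_simps)
    then show ?thesis using that zeta0 by (simp add: m_def)
  qed
  have Im_mi: "Im (mi v) = (1 - (norm v)\<^sup>2) / (norm (\<zeta> + v))\<^sup>2" for v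
  proof -
    have "(Re \<zeta>)\<^sup>2 + (Im \<zeta>)\<^sup>2 = 1" using zeta cmod_power2[of \<zeta>] by simp
    then have "Re \<zeta> * Re \<zeta> + Im \<zeta> * Im \<zeta> = 1" by (simp add: power2_eq_square)
    then show ?thesis
      unfolding mi_def Im_divide cmod_power2
      by (simp add: power2_eq_square) (simp add: algebra_simps)
  qed

  \<comment> \<open>Transport of \<open>f\<close> to the half-plane and reflection\<close>
  define h where "h w = f (G (m w))" for w
  define \<rho> where "\<rho> = \<epsilon> / 2"
  have rho: "0 < \<rho>" using eps by (simp add: \<rho>_def)
  have m_eps: "norm (m w - \<zeta>) < \<epsilon>" if "norm w < \<rho>" "0 < Im w" for w
    using m_near[of w] that by (simp add: \<rho>_def)
  have Gm: "norm (G (m w)) \<le> 1/2" if "norm w < \<rho>" "0 < Im w" for w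
    using eps(2)[OF m_disc[OF that(2)] m_eps[OF that]] by simp
  have fG: "(f \<circ> G) holomorphic_on ball 0 1"
    using G_mem by (intro holomorphic_on_compose_gen[OF G_holo f]) auto
  have h_hol: "h holomorphic_on {w. norm w < \<rho> \<and> 0 < Im w}"
  proof -
    have "m holomorphic_on {w. norm w < \<rho> \<and> 0 < Im w}"
      unfolding m_def using iw by (intro holomorphic_intros) auto
    moreover have "m ` {w. norm w < \<rho> \<and> 0 < Im w} \<subseteq> ball 0 1" using m_disc by auto
    ultimately have "((f \<circ> G) \<circ> m) holomorphic_on {w. norm w < \<rho> \<and> 0 < Im w}"
      using holomorphic_on_compose_gen fG by blast
    then show ?thesis unfolding h_def[abs_def] o_def .
  qed
  have decay: "\<exists>\<delta>>0. \<forall>w. norm w < \<rho> \<longrightarrow> 0 < Im w \<longrightarrow> Im w < \<delta> \<longrightarrow> \<bar>Im (h w)\<bar> < c" if c: "0 < c" for c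
  proof -
    obtain \<mu> where mu: "\<mu> < 1" "\<And>w. \<mu> < norm w \<Longrightarrow> norm w < 1 \<Longrightarrow> norm (G w) \<le> 1/2 \<Longrightarrow> \<bar>Im (f (G w))\<bar> < c"
      using Im_f_G_decay[OF f c _ f0, of "1/2"] by auto
    have "\<bar>Im (h w)\<bar> < c" if w: "norm w < \<rho>" "0 < Im w" "Im w < (1 - \<mu>) / 4" for w
      unfolding h_def using w m_bdry[of w] m_disc[of w] Gm[of w] by (intro mu(2)) auto
    then show ?thesis using mu(1) by (intro exI[of _ "(1 - \<mu>) / 4"]) auto
  qed
  have "\<exists>M. \<forall>w. norm w < \<rho> \<longrightarrow> 0 < Im w \<longrightarrow> \<bar>Im (h w)\<bar> \<le> M"
  proof -
    obtain \<mu> where mu: "\<mu> < 1" "\<And>w. \<mu> < norm w \<Longrightarrow> norm w < 1 \<Longrightarrow> norm (G w) \<le> 1/2 \<Longrightarrow> \<bar>Im (f (G w))\<bar> < 1"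
      using Im_f_G_decay[OF f zero_less_one _ f0, of "1/2"] by auto
    have "continuous_on (cball 0 \<mu>) (f \<circ> G)"
      using holomorphic_on_imp_continuous_on[OF fG] by (rule continuous_on_subset) (use mu in auto)
    then have "bounded ((f \<circ> G) ` cball 0 \<mu>)" by (intro compact_imp_bounded compact_continuous_image) auto
    then obtain M where "\<forall>x\<in>(f \<circ> G) ` cball 0 \<mu>. norm x \<le> M" unfolding bounded_iff by blast
    then have M: "norm (f (G v)) \<le> M" if "norm v \<le> \<mu>" for v using that by auto
    have "\<bar>Im (h w)\<bar> \<le> max 1 M" if w: "norm w < \<rho>" "0 < Im w" for w
    proof (cases "norm (m w) \<le> \<mu>")
      case True
      then show ?thesis using M abs_Im_le_cmod[of "f (G (m w))"] unfolding h_def by force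
    next
      case False
      then have "\<bar>Im (f (G (m w)))\<bar> < 1" using m_disc[OF w(2)] Gm[OF w] by (intro mu(2)) auto
      then show ?thesis unfolding h_def by simp
    qed
    then show ?thesis by blast
  qed
  then obtain M where M: "\<And>w. norm w < \<rho> \<Longrightarrow> 0 < Im w \<Longrightarrow> \<bar>Im (h w)\<bar> \<le> M" by blast
  obtain \<rho>' H where rho': "0 < \<rho>'" "\<rho>' \<le> \<rho>" and H: "H holomorphic_on ball 0 \<rho>'"
    and Hh: "\<And>w. norm w < \<rho>' \<Longrightarrow> 0 < Im w \<Longrightarrow> H w = h w"
    and Hreal: "\<And>w. norm w < \<rho>' \<Longrightarrow> Im w = 0 \<Longrightarrow> Im (H w) = 0"
    using schwarz_reflection_Im[OF rho h_hol decay M] by metis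

  \<comment> \<open>Half-plane coordinates on the domain near 0\<close>
  define T where "T z = mi (g z)" for z
  have zg: "\<zeta> + g z \<noteq> 0" if "z \<in> S" for z
    using g_disc[OF that] zeta by (metis add_eq_0_iff less_irrefl norm_minus_cancel)
  have ImT: "0 < Im (T z)" if "z \<in> S" for z
    unfolding T_def Im_mi using g_disc[OF that] zg[OF that] by (intro divide_pos_pos) (auto simp: power_less_one_iff)
  have HT: "H (T z) = f z" if "z \<in> S" "norm (T z) < \<rho>'" for z
    using Hh[OF that(2) ImT[OF that(1)]] m_mi[OF zg[OF that(1)]] G_g[OF that(1)] by (simp add: h_def T_def)
  have T_hol: "T holomorphic_on S" unfolding T_def mi_def by (intro holomorphic_intros g_holo zg)
  have T_inj: "inj_on T S"
  proof (rule inj_onI)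
    fix x y assume xy: "x \<in> S" "y \<in> S" "T x = T y"
    have "m (T x) = g x" "m (T y) = g y" unfolding T_def using m_mi zg xy(1,2) by blast+
    then have "g x = g y" using xy(3) by simp
    then show "x = y" using G_g xy by metis
  qed
  define U where "U = {z \<in> S. norm (T z) < \<rho>'}"
  have "open U"
  proof -
    have "U = S \<inter> T -` ball 0 \<rho>'" by (auto simp: U_def)
    then show ?thesis
      using continuous_open_preimage[OF holomorphic_on_imp_continuous_on[OF T_hol] open_S open_ball] by simp
  qed
  have mi_tendsto: "((\<lambda>z. mi (k z)) \<longlongrightarrow> mi v) F" if "(k \<longlongrightarrow> v) F" "\<zeta> + v \<noteq> 0" for k v and F :: "complex filter"
    unfolding mi_def using that by (intro tendsto_intros)
  have z2: "\<zeta> + \<zeta> \<noteq> 0" using zeta0 by simp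
  have "((\<lambda>z. mi (e z)) \<longlongrightarrow> mi \<zeta>) (at 0 within closure S \<inter> ball 0 r)"
    using e_tendsto[of 0] zero z2 by (intro mi_tendsto) (auto simp: \<zeta>_def frontier_def)
  moreover have "mi \<zeta> = 0" by (simp add: mi_def)
  ultimately have "\<forall>\<^sub>F z in at 0 within closure S \<inter> ball 0 r. dist (mi (e z)) 0 < \<rho>' / 2"
    using rho'(1) tendstoD[of "\<lambda>z. mi (e z)" 0 _ "\<rho>' / 2"] by simp
  moreover have "\<forall>\<^sub>F z in at 0 within closure S \<inter> ball 0 r. dist (e z) \<zeta> < 1"
    unfolding \<zeta>_def by (rule tendstoD[OF e_tendsto]) (use zero in \<open>auto simp: frontier_def\<close>)
  ultimately have "\<forall>\<^sub>F z in at 0 within closure S \<inter> ball 0 r. dist (mi (e z)) 0 < \<rho>' / 2 \<and> dist (e z) \<zeta> < 1"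
    by (rule eventually_conj)
  \<comment> \<open>The pole of \<open>mi\<close> is \<open>- \<zeta>\<close>, at distance 2 from
    \<open>\<zeta>\<close>; the condition \<open>dist (e z) \<zeta> < 1\<close> keeps clear of
    it.\<close>
  then obtain d0 where d0: "0 < d0"
    "\<And>z. z \<in> closure S \<Longrightarrow> norm z < r \<Longrightarrow> z \<noteq> 0 \<Longrightarrow> norm z < d0 \<Longrightarrow> norm (mi (e z)) < \<rho>' / 2 \<and> dist (e z) \<zeta> < 1"
    unfolding eventually_at by auto
  define d where "d = min d0 r"
  have d: "0 < d" "d \<le> d0" "d \<le> r" using d0 r_pos by (auto simp: d_def)
  have near: "norm (mi (e z)) < \<rho>' / 2" "\<zeta> + e z \<noteq> 0" if "z \<in> closure S" "norm z < d" for z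
  proof -
    have *: "norm (mi (e z)) < \<rho>' / 2 \<and> dist (e z) \<zeta> < 1"
    proof (cases "z = 0")
      case True
      then show ?thesis using rho' \<open>mi \<zeta> = 0\<close> by (simp add: \<zeta>_def)
    next
      case False
      then show ?thesis using d0(2)[OF that(1) _ False] that d by simp
    qed
    then show "norm (mi (e z)) < \<rho>' / 2" by blast
    show "\<zeta> + e z \<noteq> 0"
    proof
      assume "\<zeta> + e z = 0"
      then have "e z = - \<zeta>" by (simp add: add_eq_0_iff)
      then have "dist (e z) \<zeta> = norm (- (2 * \<zeta>))" by (simp add: dist_norm)
      also have "\<dots> = 2" by (simp only: norm_minus_cancel norm_mult zeta) simp
      finally show False using * by simp
    qed
  qed
  have T_small: "norm (T z) < \<rho>' / 2" if "z \<in> S" "norm z < d" for z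
    using near(1)[of z] that e_eq[of z] d closure_subset[of S] by (auto simp: T_def)
  have ex_U: "U \<noteq> {}"
  proof -
    have "\<i> * of_real (d / 2) \<in> S"
      using mem_S_iff[of "\<i> * of_real (d / 2)"] psi_0 d r_le by (simp add: norm_mult)
    moreover have "norm (\<i> * complex_of_real (d / 2)) < d" using d by (simp add: norm_mult)
    ultimately have "\<i> * of_real (d / 2) \<in> U" using T_small rho' by (force simp: U_def)
    then show ?thesis by blast
  qed

  \<comment> \<open>Finiteness of the zeros of \<open>deriv H\<close> and its consequences\<close>
  define Z where "Z = {w \<in> cball 0 (\<rho>' / 2). deriv H w = 0}"
  \<comment> \<open>The finiteness of zeros in a compact set requires a nonconstant function. If
    \<open>deriv H\<close> is constantly 0, then \<open>f\<close> is constant on the open set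
    \<open>U\<close> and, by continuation, on the connected \<open>S\<close>; any other constant has
    no zeros.\<close>
  have "finite Z"
  proof (cases "deriv H constant_on ball 0 \<rho>'")
    case False
    show ?thesis unfolding Z_def
      using rho' by (intro holomorphic_compact_finite_zeros[OF holomorphic_deriv[OF H open_ball] open_ball _ _ _ False]) auto
  next
    case True
    then obtain c where c: "\<And>w. w \<in> ball 0 \<rho>' \<Longrightarrow> deriv H w = c" unfolding constant_on_def by blast
    have "c \<noteq> 0"
    proof
      assume "c = 0"
      then have "(H has_field_derivative 0) (at w within ball 0 \<rho>')" if "w \<in> ball 0 \<rho>'" for w
        using holomorphic_derivI[OF H open_ball that] c[OF that] by simp
      then have "\<exists>a. \<forall>w\<in>ball 0 \<rho>'. H w = a"
        using has_field_derivative_zero_constant[OF convex_ball] by blast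
      then obtain a where a: "\<And>w. w \<in> ball 0 \<rho>' \<Longrightarrow> H w = a" by blast
      have fa: "f z = a" if "z \<in> U" for z using HT[of z] a[of "T z"] that by (simp add: U_def)
      obtain u where u: "u \<in> U" using ex_U by blast
      have "f z - a = 0" if "z \<in> S" for z
      proof (rule analytic_continuation[where f = "\<lambda>z. f z - a" and S = S and U = U and \<xi> = u])
        show "(\<lambda>z. f z - a) holomorphic_on S" by (intro holomorphic_intros f)
        show "u islimpt U" using u \<open>open U\<close> interior_limit_point interior_open by blast
      qed (use that u fa open_S connected_S in \<open>auto simp: U_def\<close>)
      then have "f constant_on S" unfolding constant_on_def by auto
      with nc show False by blast
    qed
    then have "Z = {}" using c rho' by (auto simp: Z_def)
    then show ?thesis by simp
  qed
  have 1: "finite {z \<in> S. norm z < d \<and> deriv f z = 0}"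
  proof (rule finite_subset)
    show "{z \<in> S. norm z < d \<and> deriv f z = 0} \<subseteq> T -` Z \<inter> S"
    proof
      fix z assume "z \<in> {z \<in> S. norm z < d \<and> deriv f z = 0}"
      then have z: "z \<in> S" "norm z < d" "deriv f z = 0" by auto
      have Tz: "norm (T z) < \<rho>' / 2" by (rule T_small[OF z(1,2)])
      then have zU: "z \<in> U" using z rho' by (simp add: U_def)
      have dT: "(T has_field_derivative deriv T z) (at z)" using holomorphic_derivI[OF T_hol open_S z(1)] .
      have dH: "(H has_field_derivative deriv H (T z)) (at (T z))"
        using Tz rho' by (intro holomorphic_derivI[OF H open_ball]) auto
      have "((\<lambda>x. H (T x)) has_field_derivative deriv H (T z) * deriv T z) (at z)"
        using DERIV_chain2[OF dH dT] .
      then have "(f has_field_derivative deriv H (T z) * deriv T z) (at z)"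
        by (rule has_field_derivative_transform_within_open[OF _ \<open>open U\<close> zU]) (use HT in \<open>auto simp: U_def\<close>)
      then have "deriv H (T z) * deriv T z = 0" using z(3) DERIV_imp_deriv by metis
      moreover have "deriv T z \<noteq> 0"
        using holomorphic_injective_imp_regular[OF T_hol open_S T_inj z(1)] .
      ultimately show "z \<in> T -` Z \<inter> S" using Tz z by (simp add: Z_def)
    qed
    show "finite (T -` Z \<inter> S)" using \<open>finite Z\<close> T_inj by (rule finite_vimage_IntI)
  qed
  define F where "F = {q \<in> frontier S. norm q < d}"
  have 2: "finite {q \<in> frontier S. norm q < d \<and>
      \<not> (\<exists>s>0. (\<forall>z\<in>S. dist z q < s \<longrightarrow> 0 < Im (f z)) \<or> (\<forall>z\<in>S. dist z q < s \<longrightarrow> Im (f z) < 0))}" (is "finite ?B")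
  proof (rule finite_subset[of _ "(mi \<circ> e) -` Z \<inter> F"])
    have "inj_on (mi \<circ> e) F"
    proof (rule inj_onI)
      fix x y assume xy: "x \<in> F" "y \<in> F" "(mi \<circ> e) x = (mi \<circ> e) y"
      have "\<zeta> + e x \<noteq> 0" "\<zeta> + e y \<noteq> 0" using xy near(2) by (auto simp: F_def frontier_def)
      then have "m (mi (e x)) = e x" "m (mi (e y)) = e y" using m_mi by blast+
      moreover have "mi (e x) = mi (e y)" using xy(3) by (simp only: comp_apply)
      ultimately have "e x = e y" by metis
      then show "x = y" using e_inj[of x y] xy d by (simp add: F_def)
    qed
    then show "finite ((mi \<circ> e) -` Z \<inter> F)" by (rule finite_vimage_IntI[OF \<open>finite Z\<close>])
    show "?B \<subseteq> (mi \<circ> e) -` Z \<inter> F"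
    proof
      fix q assume qB: "q \<in> ?B"
      then have q: "q \<in> frontier S" "norm q < d" by auto
      then have qc: "q \<in> closure S" by (simp add: frontier_def)
      define t where "t = mi (e q)"
      have t: "norm t < \<rho>' / 2" "Im t = 0"
        using near(1)[OF qc q(2)] norm_e[OF q(1)] q d by (simp_all add: t_def Im_mi)
      have "deriv H t = 0"
      proof (rule ccontr)
        assume dH: "deriv H t \<noteq> 0"
        obtain s where s: "0 < s"
          "(\<forall>w\<in>ball t s. 0 < Im w \<longrightarrow> 0 < Im (H w)) \<or> (\<forall>w\<in>ball t s. 0 < Im w \<longrightarrow> Im (H w) < 0)"
          using one_signed_above_regular_point[OF rho'(1) H Hreal _ t(2) dH] t(1) rho' by auto
        have "(g \<longlongrightarrow> e q) (at q within S)" using q d by (intro g_tendsto qc) auto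
        then have "((\<lambda>z. mi (g z)) \<longlongrightarrow> t) (at q within S)"
          unfolding t_def using near(2)[OF qc q(2)] by (rule mi_tendsto)
        then have "\<forall>\<^sub>F z in at q within S. dist (T z) t < min s (\<rho>' / 2)"
          using tendstoD[of "\<lambda>z. mi (g z)" t _ "min s (\<rho>' / 2)"] s(1) rho' by (simp add: T_def)
        then obtain k where k: "0 < k" "\<And>z. z \<in> S \<Longrightarrow> z \<noteq> q \<Longrightarrow> dist z q < k \<Longrightarrow> dist (T z) t < min s (\<rho>' / 2)"
          unfolding eventually_at by auto
        have qS: "q \<notin> S" using q(1) open_S by (simp add: frontier_def interior_open)
        have kz: "T z \<in> ball t s" "H (T z) = f z" if "z \<in> S" "dist z q < k" for z
        proof -
          have *: "dist (T z) t < min s (\<rho>' / 2)" using k(2)[OF that(1) _ that(2)] that(1) qS by blast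
          then show "T z \<in> ball t s" by (simp add: dist_commute)
          have "norm (T z) \<le> norm t + dist (T z) t" using norm_triangle_ineq[of t "T z - t"] by (simp add: dist_norm)
          then show "H (T z) = f z" using * t by (intro HT[OF that(1)]) auto
        qed
        have "\<exists>s>0. (\<forall>z\<in>S. dist z q < s \<longrightarrow> 0 < Im (f z)) \<or> (\<forall>z\<in>S. dist z q < s \<longrightarrow> Im (f z) < 0)"
          using s(2) k(1) kz ImT by (metis)
        then show False using qB by blast
      qed
      then show "q \<in> (mi \<circ> e) -` Z \<inter> F" using t q by (simp add: Z_def F_def t_def)
    qed
  qed
  show thesis by (rule that[OF d(1) 1 2])
qed

end

section \<open>The critical set\<close>

lemma closure_affine_preimage:
  fixes p s :: complex
  assumes "s \<noteq> 0"
  shows "\<xi> \<in> closure {w. p + s * w \<in> S} \<longleftrightarrow> p + s * \<xi> \<in> closure S"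
proof -
  have d: "dist (p + s * w) (p + s * \<xi>) = norm s * dist w \<xi>" for w
    by (simp add: dist_norm norm_mult flip: right_diff_distrib)
  show ?thesis
  proof
    assume l: "\<xi> \<in> closure {w. p + s * w \<in> S}"
    show "p + s * \<xi> \<in> closure S"
      unfolding closure_approachable
    proof (intro allI impI)
      fix e :: real assume "0 < e"
      then have "0 < e / norm s" using assms by simp
      then obtain w where "p + s * w \<in> S" "dist w \<xi> < e / norm s"
        using l unfolding closure_approachable by blast
      then show "\<exists>y\<in>S. dist y (p + s * \<xi>) < e"
        using assms d[of w] by (intro bexI[of _ "p + s * w"]) (simp_all add: field_simps)
    qed
  next
    assume r: "p + s * \<xi> \<in> closure S"
    show "\<xi> \<in> closure {w. p + s * w \<in> S}"
      unfolding closure_approachable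
    proof (intro allI impI)
      fix e :: real assume "0 < e"
      then have "0 < norm s * e" using assms by simp
      then obtain y where y: "y \<in> S" "dist y (p + s * \<xi>) < norm s * e"
        using r unfolding closure_approachable by blast
      have py: "p + s * ((y - p) / s) = y" using assms by simp
      then have "norm s * dist ((y - p) / s) \<xi> < norm s * e" using y d[of "(y - p) / s"] by simp
      then have "dist ((y - p) / s) \<xi> < e" using assms by simp
      with y py show "\<exists>w\<in>{w. p + s * w \<in> S}. dist w \<xi> < e" by (intro bexI[of _ "(y - p) / s"]) simp_all
    qed
  qed
qed

lemma open_affine_preimage: "open S \<Longrightarrow> open {w::complex. p + s * w \<in> S}"
  using open_vimage[of S "\<lambda>w. p + s * w"] by (simp add: vimage_def continuous_intros)

lemma frontier_affine_preimage:
  fixes p s :: complex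
  assumes "s \<noteq> 0" "open S"
  shows "\<xi> \<in> frontier {w. p + s * w \<in> S} \<longleftrightarrow> p + s * \<xi> \<in> frontier S"
  using closure_affine_preimage[OF assms(1)] open_affine_preimage[OF assms(2)] assms(2)
  by (simp add: frontier_def interior_open)

lemma frontier_Int_open:
  assumes "open A" "open B" "z \<in> B"
  shows "z \<in> frontier (A \<inter> B) \<longleftrightarrow> z \<in> frontier A"
proof -
  have "z \<in> closure (A \<inter> B) \<longleftrightarrow> z \<in> closure A"
    using assms(3) open_Int_closure_subset[OF assms(2), of A] closure_mono[of "A \<inter> B" A]
    by (auto simp: Int_commute)
  then show ?thesis using assms by (auto simp: frontier_def interior_open open_Int)
qed

lemma filterlim_affine_at_within:
  fixes p s :: complex
  assumes "s \<noteq> 0"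
  shows "filterlim (\<lambda>w. p + s * w) (at (p + s * \<xi>) within S) (at \<xi> within {w. p + s * w \<in> S})"
  unfolding filterlim_at
proof
  show "((\<lambda>w. p + s * w) \<longlongrightarrow> p + s * \<xi>) (at \<xi> within {w. p + s * w \<in> S})" by (intro tendsto_intros)
  show "\<forall>\<^sub>F w in at \<xi> within {w. p + s * w \<in> S}. p + s * w \<in> S \<and> p + s * w \<noteq> p + s * \<xi>"
    using assms by (simp add: eventually_at_filter)
qed

lemma
  fixes p s :: complex
  assumes "f holomorphic_on S" "open S"
  shows holomorphic_affine: "(\<lambda>w. f (p + s * w)) holomorphic_on {w. p + s * w \<in> S}"
    and deriv_affine: "p + s * w \<in> S \<Longrightarrow> deriv (\<lambda>w. f (p + s * w)) w = s * deriv f (p + s * w)"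
proof -
  have D: "((\<lambda>w. f (p + s * w)) has_field_derivative deriv f (p + s * w) * s) (at w)" if "p + s * w \<in> S" for w
    by (rule DERIV_chain2[where f = f]) (use holomorphic_derivI[OF assms that] in \<open>auto intro!: derivative_eq_intros\<close>)
  then show "(\<lambda>w. f (p + s * w)) holomorphic_on {w. p + s * w \<in> S}"
    unfolding holomorphic_on_open[OF open_affine_preimage[OF assms(2)]] by blast
  show "deriv (\<lambda>w. f (p + s * w)) w = s * deriv f (p + s * w)" if "p + s * w \<in> S"
    using DERIV_imp_deriv[OF D[OF that]] by (simp only: mult.commute)
qed

lemma C1_DMO_domain_local_graph:
  assumes dom: "C1_DMO_domain_in (ball 0 1) \<Omega>" and p: "p \<in> frontier \<Omega>" "norm p < 1"
  obtains s \<psi> L c \<epsilon> where "s \<noteq> 0" "graph_domain {w. p + s * w \<in> \<Omega> \<inter> ball 0 1} \<psi> L"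
    "\<And>w. norm w < 1 \<Longrightarrow> norm (p + s * w) < 1"
    "\<And>k. 0 \<le> \<epsilon> k" "summable \<epsilon>"
    "\<And>(k::nat) x. \<bar>x\<bar> \<le> (1/2)^k \<Longrightarrow> \<bar>\<psi> x - c k * x\<bar> \<le> \<epsilon> k * (1/2)^k"
proof -
  have "open \<Omega>" using dom by (simp add: C1_DMO_domain_in_def)
  have "p \<in> frontier \<Omega> \<inter> ball 0 1" using p by simp
  then obtain c0 s0 where ps: "p \<in> ball c0 (norm s0)" and "C1_DMO_graph {w. c0 + s0 * w \<in> \<Omega>}"
    using dom unfolding C1_DMO_domain_in_def by blast
  then obtain \<phi> where prof: "C1_DMO_profile \<phi>"
    and gr: "{w. c0 + s0 * w \<in> \<Omega>} \<inter> ball 0 1 = {z. Im z > \<phi> (Re z)} \<inter> ball 0 1"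
    and fr: "frontier {w. c0 + s0 * w \<in> \<Omega>} \<inter> ball 0 1 = {z. Im z = \<phi> (Re z)} \<inter> ball 0 1"
    unfolding C1_DMO_graph_def by blast
  have s0: "s0 \<noteq> 0" using ps by auto
  define q where "q = (p - c0) / s0"
  have pq: "p = c0 + s0 * q" using s0 by (simp add: q_def)
  have q1: "norm q < 1" using ps s0 by (simp add: q_def norm_divide dist_norm norm_minus_commute)
  have "q \<in> frontier {w. c0 + s0 * w \<in> \<Omega>}"
    unfolding frontier_affine_preimage[OF s0 \<open>open \<Omega>\<close>] pq[symmetric] by (rule p(1))
  then have "q \<in> {z. Im z = \<phi> (Re z)} \<inter> ball 0 1" unfolding fr[symmetric] using q1 by simp
  then have Imq: "Im q = \<phi> (Re q)" by simp
  define x where "x = Re q"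
  have x1: "\<bar>x\<bar> < 1" using abs_Re_le_cmod[of q] q1 by (simp add: x_def)
  \<comment> \<open>The first bound keeps the rescaled unit disc inside the given graph disc, the
    second inside \<open>ball 0 1\<close>.\<close>
  define R where "R = min (1 - norm q) ((1 - norm p) / norm s0)"
  have R: "0 < R" using q1 p(2) s0 by (simp add: R_def)
  obtain \<sigma> c \<epsilon> where sig: "0 < \<sigma>" "\<sigma> < R" "\<bar>x\<bar> + \<sigma> < 1" and eps: "\<And>k. 0 \<le> \<epsilon> k" "summable \<epsilon>"
    and dini: "\<And>(k::nat) t. \<bar>t\<bar> \<le> (1/2)^k \<Longrightarrow>
      \<bar>(\<phi> (x + \<sigma> * t) - \<phi> x) / \<sigma> - c k * t\<bar> \<le> \<epsilon> k * (1/2)^k"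
    using C1_DMO_profile_local[OF prof x1 R] by metis
  obtain g where \<phi>: "\<And>x. x \<in> {-1..1} \<Longrightarrow> (\<phi> has_real_derivative g x) (at x within {-1..1})"
    and g: "continuous_on {-1..1} g"
    using prof unfolding C1_DMO_profile_def by blast
  obtain L where "\<forall>y\<in>g ` {-1..1}. norm y \<le> L"
    using compact_imp_bounded[OF compact_continuous_image[OF g compact_Icc]] unfolding bounded_iff by blast
  then have L: "norm (g y) \<le> L" if "y \<in> {-1..1}" for y using that by blast
  have L0: "0 \<le> L" using L[of 0] norm_ge_zero[of "g 0"] by simp
  have phi_lip: "\<bar>\<phi> a - \<phi> b\<bar> \<le> L * \<bar>a - b\<bar>" if "a \<in> {-1..1}" "b \<in> {-1..1}" for a b
    using field_differentiable_bound[OF convex_real_interval(5) \<phi> L that] by simp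
  define \<psi> where "\<psi> t = (\<phi> (x + \<sigma> * t) - \<phi> x) / \<sigma>" for t
  define s where "s = s0 * of_real \<sigma>"
  have s: "s \<noteq> 0" using s0 sig(1) by (simp add: s_def)
  have inside: "norm (q + of_real \<sigma> * w) < 1" "norm (p + s * w) < 1" if w: "norm w < 1" for w
  proof -
    have sw: "\<sigma> * norm w \<le> \<sigma>" using w sig(1) by (simp add: mult_left_le)
    have "norm (q + of_real \<sigma> * w) \<le> norm q + \<sigma> * norm w"
      using norm_triangle_ineq[of q "of_real \<sigma> * w"] sig(1) by (simp add: norm_mult)
    then show "norm (q + of_real \<sigma> * w) < 1" using sw sig(2) by (simp add: R_def)
    have "\<sigma> < (1 - norm p) / norm s0" using sig(2) by (simp add: R_def)
    then have "norm s0 * \<sigma> < 1 - norm p" using s0 by (simp add: pos_less_divide_eq mult.commute)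
    moreover have "norm s0 * (\<sigma> * norm w) \<le> norm s0 * \<sigma>" using sw by (intro mult_left_mono) auto
    moreover have "norm (p + s * w) \<le> norm p + norm s0 * (\<sigma> * norm w)"
      using norm_triangle_ineq[of p "s * w"] sig(1) by (simp add: norm_mult s_def mult.assoc)
    ultimately show "norm (p + s * w) < 1" by linarith
  qed
  have range: "x + \<sigma> * t \<in> {-1..1}" if "\<bar>t\<bar> \<le> 1" for t
  proof -
    have "\<bar>\<sigma> * t\<bar> \<le> \<sigma>" using that sig(1) by (simp add: abs_mult mult_left_le)
    then show ?thesis using sig(3) by (simp add: abs_le_iff) linarith
  qed
  have "graph_domain {w. p + s * w \<in> \<Omega> \<inter> ball 0 1} \<psi> L"
  proof
    show "open {w. p + s * w \<in> \<Omega> \<inter> ball 0 1}"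
      using \<open>open \<Omega>\<close> by (intro open_affine_preimage open_Int) auto
    show "0 \<le> L" by fact
    show "\<psi> 0 = 0" by (simp add: \<psi>_def)
    show "\<bar>\<psi> a - \<psi> b\<bar> \<le> L * \<bar>a - b\<bar>" if "\<bar>a\<bar> \<le> 1" "\<bar>b\<bar> \<le> 1" for a b
    proof -
      have "\<psi> a - \<psi> b = (\<phi> (x + \<sigma> * a) - \<phi> (x + \<sigma> * b)) / \<sigma>" by (simp add: \<psi>_def diff_divide_distrib)
      moreover have "\<bar>\<phi> (x + \<sigma> * a) - \<phi> (x + \<sigma> * b)\<bar> \<le> L * \<bar>\<sigma> * (a - b)\<bar>"
        using phi_lip[OF range[OF that(1)] range[OF that(2)]] by (simp add: algebra_simps)
      ultimately show ?thesis using sig(1) by (simp add: abs_mult pos_divide_le_eq mult_ac)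
    qed
    show "w \<in> {w. p + s * w \<in> \<Omega> \<inter> ball 0 1} \<longleftrightarrow> \<psi> (Re w) < Im w" if w: "norm w < 1" for w
    proof -
      have "p + s * w = c0 + s0 * (q + of_real \<sigma> * w)" by (simp add: pq s_def algebra_simps)
      then have "w \<in> {w. p + s * w \<in> \<Omega> \<inter> ball 0 1} \<longleftrightarrow> q + of_real \<sigma> * w \<in> {w. c0 + s0 * w \<in> \<Omega>} \<inter> ball 0 1"
        using inside[OF w] by simp
      also have "\<dots> \<longleftrightarrow> \<phi> (x + \<sigma> * Re w) < \<phi> x + \<sigma> * Im w"
        unfolding gr using inside[OF w] Imq by (simp add: x_def)
      also have "\<dots> \<longleftrightarrow> \<psi> (Re w) < Im w"
        using sig(1) by (auto simp: \<psi>_def pos_divide_less_eq mult.commute)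
      finally show ?thesis .
    qed
  qed
  then show thesis using that[of s \<psi> L \<epsilon> c] s inside(2) eps dini unfolding \<psi>_def by blast
qed

text \<open>The affine change of variables multiplies the derivative by the nonzero constant
  \<open>s\<close>, so a limit 0 at \<open>p\<close> would carry over to the graph
  coordinates.\<close>

lemma hopf_C1_DMO:
  assumes dom: "C1_DMO_domain_in (ball 0 1) \<Omega>" and p: "p \<in> frontier \<Omega>" "norm p < 1"
  defines "S \<equiv> \<Omega> \<inter> ball 0 1"
  assumes f: "f holomorphic_on S" and f0: "((\<lambda>z. Im (f z)) \<longlongrightarrow> 0) (at p within S)"
    and d: "0 < d" "\<And>z. z \<in> S \<Longrightarrow> dist z p < d \<Longrightarrow> 0 < Im (f z)"
  shows "\<not> (deriv f \<longlongrightarrow> 0) (at p within S)"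
proof
  assume lim: "(deriv f \<longlongrightarrow> 0) (at p within S)"
  obtain s \<psi> L c \<epsilon> where s: "s \<noteq> 0" and gd: "graph_domain {w. p + s * w \<in> S} \<psi> L"
    and eps: "\<And>k. 0 \<le> \<epsilon> k" "summable \<epsilon>"
    and dini: "\<And>(k::nat) x. \<bar>x\<bar> \<le> (1/2)^k \<Longrightarrow> \<bar>\<psi> x - c k * x\<bar> \<le> \<epsilon> k * (1/2)^k"
    using C1_DMO_domain_local_graph[OF dom p] unfolding S_def by metis
  interpret graph_domain "{w. p + s * w \<in> S}" \<psi> L by fact
  have "open S" using dom by (auto simp: S_def C1_DMO_domain_in_def open_Int)
  have fl: "filterlim (\<lambda>w. p + s * w) (at p within S) (at 0 within {w. p + s * w \<in> S})"
    using filterlim_affine_at_within[OF s, of p 0 S] by simp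
  have "\<not> (deriv (\<lambda>w. f (p + s * w)) \<longlongrightarrow> 0) (at 0 within {w. p + s * w \<in> S})"
  proof (rule hopf_boundary[OF open_S continuous_psi mem_S_iff L_nonneg abs_psi_le eps dini
        holomorphic_affine[OF f \<open>open S\<close>]])
    show "0 < d / norm s" using d(1) s by simp
    show "0 < Im (f (p + s * z))" if "z \<in> {w. p + s * w \<in> S}" "norm z < d / norm s" for z
    proof (rule d(2))
      have "norm s * norm z < d" using that(2) s by (simp add: pos_less_divide_eq mult.commute)
      then show "dist (p + s * z) p < d" by (simp add: dist_norm norm_mult)
    qed (use that in simp)
    show "((\<lambda>z. Im (f (p + s * z))) \<longlongrightarrow> 0) (at 0 within {w. p + s * w \<in> S})"
      by (rule filterlim_compose[OF f0 fl])
  qed auto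
  moreover have "(deriv (\<lambda>w. f (p + s * w)) \<longlongrightarrow> 0) (at 0 within {w. p + s * w \<in> S})"
  proof -
    have "((\<lambda>w. s * deriv f (p + s * w)) \<longlongrightarrow> s * 0) (at 0 within {w. p + s * w \<in> S})"
      by (intro tendsto_intros filterlim_compose[OF lim fl])
    moreover have "\<forall>\<^sub>F w in at 0 within {w. p + s * w \<in> S}. s * deriv f (p + s * w) = deriv (\<lambda>w. f (p + s * w)) w"
      unfolding eventually_at_filter
      by (rule always_eventually) (auto simp: deriv_affine[OF f \<open>open S\<close>])
    ultimately show ?thesis using tendsto_cong by fastforce
  qed
  ultimately show False by blast
qed

text \<open>By \<open>locally_finite\<close> all but finitely many frontier points near
  \<open>p\<close> have a neighbourhood in which \<open>Im f\<close> has one sign. There Hopf's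
  lemma, for \<open>f\<close> or for \<open>- f\<close>, excludes the limit 0.\<close>

lemma finite_critical_near_frontier:
  assumes dom: "C1_DMO_domain_in (ball 0 1) \<Omega>" and p: "p \<in> frontier \<Omega>" "norm p < 1"
  defines "S \<equiv> \<Omega> \<inter> ball 0 1"
  assumes sc: "simply_connected S" and f: "f holomorphic_on S" and nc: "\<not> f constant_on S"
    and f0: "\<And>z. z \<in> frontier \<Omega> \<Longrightarrow> norm z < 1 \<Longrightarrow> ((\<lambda>z. Im (f z)) \<longlongrightarrow> 0) (at z within S)"
  obtains \<delta> where "0 < \<delta>" "finite {z \<in> S. dist z p < \<delta> \<and> deriv f z = 0}"
    "finite {z \<in> frontier \<Omega>. norm z < 1 \<and> dist z p < \<delta> \<and> (deriv f \<longlongrightarrow> 0) (at z within S)}"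
proof -
  have "open \<Omega>" using dom by (simp add: C1_DMO_domain_in_def)
  then have "open S" by (auto simp: S_def open_Int)
  obtain s \<psi> L where s: "s \<noteq> 0" and gd: "graph_domain {w. p + s * w \<in> S} \<psi> L"
    and ins: "\<And>w. norm w < 1 \<Longrightarrow> norm (p + s * w) < 1"
    using C1_DMO_domain_local_graph[OF dom p] unfolding S_def by metis
  define S' where "S' = {w. p + s * w \<in> S}"
  have "S \<noteq> {}" using nc by (auto simp: constant_on_def)
  moreover have "S \<noteq> UNIV"
  proof
    assume "S = UNIV"
    then have "(2::complex) \<in> S" by simp
    then show False by (simp add: S_def)
  qed
  ultimately obtain g0 G0 where g0: "g0 holomorphic_on S" "G0 holomorphic_on ball 0 1"
    "\<And>z. z \<in> S \<Longrightarrow> g0 z \<in> ball 0 1 \<and> G0 (g0 z) = z" "\<And>w. w \<in> ball 0 1 \<Longrightarrow> G0 w \<in> S \<and> g0 (G0 w) = w"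
    using Riemann_mapping_theorem[of S] \<open>open S\<close> sc by blast
  define g where "g w = g0 (p + s * w)" for w
  define G where "G w = (G0 w - p) / s" for w
  have inv: "p + s * ((v - p) / s) = v" for v using s by simp
  interpret graph_domain S' \<psi> L using gd by (simp add: S'_def)
  interpret graph_domain_map S' \<psi> L g G
  proof
    show "g holomorphic_on S'" unfolding g_def S'_def by (rule holomorphic_affine[OF g0(1) \<open>open S\<close>])
    show "G holomorphic_on ball 0 1" unfolding G_def using s by (intro holomorphic_intros g0(2)) auto
    show "norm (g z) < 1" if "z \<in> S'" for z using g0(3)[of "p + s * z"] that by (simp add: g_def S'_def)
    show "G (g z) = z" if "z \<in> S'" for z
      using g0(3)[of "p + s * z"] that s by (simp add: g_def G_def S'_def)
    show "G w \<in> S'" if "norm w < 1" for w using g0(4)[of w] that inv by (simp add: G_def S'_def)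
    show "g (G w) = w" if "norm w < 1" for w using g0(4)[of w] that inv by (simp add: G_def g_def)
  qed
  obtain r e where re: "0 < r" "r \<le> 1/2" "continuous_on (closure S' \<inter> ball 0 r) e"
    "\<And>z. z \<in> S' \<Longrightarrow> norm z < r \<Longrightarrow> e z = g z"
    "\<And>z. z \<in> frontier S' \<Longrightarrow> norm z < r \<Longrightarrow> norm (e z) = 1"
    using g_extension by metis
  interpret graph_domain_extended S' \<psi> L g G r e by unfold_locales (use re in auto)
  have frS: "z \<in> frontier S \<longleftrightarrow> z \<in> frontier \<Omega>" if "norm z < 1" for z
    using frontier_Int_open[OF \<open>open \<Omega>\<close> open_ball, of z 0 1] that by (simp add: S_def)
  have frS': "w \<in> frontier S' \<longleftrightarrow> p + s * w \<in> frontier \<Omega>" if "norm w < 1" for w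
    unfolding S'_def frontier_affine_preimage[OF s \<open>open S\<close>] using frS[OF ins[OF that]] .
  define f' where "f' w = f (p + s * w)" for w
  have f': "f' holomorphic_on S'" unfolding f'_def S'_def by (rule holomorphic_affine[OF f \<open>open S\<close>])
  have nc': "\<not> f' constant_on S'"
  proof
    assume "f' constant_on S'"
    then obtain a where a: "\<And>w. w \<in> S' \<Longrightarrow> f' w = a" unfolding constant_on_def by blast
    have "f z = a" if "z \<in> S" for z using a[of "(z - p) / s"] that inv by (simp add: f'_def S'_def)
    then show False using nc unfolding constant_on_def by blast
  qed
  have f'0: "((\<lambda>w. Im (f' w)) \<longlongrightarrow> 0) (at \<xi> within S')" if "\<xi> \<in> frontier S'" "norm \<xi> < 1" for \<xi>
    unfolding f'_def S'_def
    by (rule filterlim_compose[OF f0 filterlim_affine_at_within[OF s]]) (use frS' ins that in auto)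
  obtain d where d: "0 < d" and A: "finite {z \<in> S'. norm z < d \<and> deriv f' z = 0}" (is "finite ?A")
    and B: "finite {q \<in> frontier S'. norm q < d \<and>
      \<not> (\<exists>s>0. (\<forall>z\<in>S'. dist z q < s \<longrightarrow> 0 < Im (f' z)) \<or> (\<forall>z\<in>S'. dist z q < s \<longrightarrow> Im (f' z) < 0))}" (is "finite ?B")
    by (rule locally_finite[OF f' nc' f'0]) blast+
  \<comment> \<open>The minimum with 1 keeps the rescaled points in the unit disc, where
    \<open>frS'\<close> identifies the frontiers.\<close>
  define \<delta> where "\<delta> = norm s * min d 1"
  have del: "0 < \<delta>" using s d by (simp add: \<delta>_def)
  have small: "norm ((z - p) / s) < d" "norm ((z - p) / s) < 1" if "dist z p < \<delta>" for z
  proof -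
    have "norm ((z - p) / s) < min d 1"
      using that s
      by (simp add: \<delta>_def norm_divide dist_norm pos_divide_less_eq mult.commute del: min_less_iff_conj)
    then show "norm ((z - p) / s) < d" "norm ((z - p) / s) < 1" by auto
  qed
  have 1: "finite {z \<in> S. dist z p < \<delta> \<and> deriv f z = 0}"
  proof (rule finite_subset)
    show "{z \<in> S. dist z p < \<delta> \<and> deriv f z = 0} \<subseteq> (\<lambda>w. p + s * w) ` ?A"
    proof
      fix z assume z: "z \<in> {z \<in> S. dist z p < \<delta> \<and> deriv f z = 0}"
      have "deriv f' ((z - p) / s) = s * deriv f z"
        using deriv_affine[OF f \<open>open S\<close>, of p s "(z - p) / s"] z unfolding f'_def inv by simp
      then have "(z - p) / s \<in> ?A" using z small inv by (simp add: S'_def)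
      then show "z \<in> (\<lambda>w. p + s * w) ` ?A" using inv[of z] by (metis (no_types, lifting) imageI)
    qed
  qed (use A in simp)
  have 2: "finite {z \<in> frontier \<Omega>. norm z < 1 \<and> dist z p < \<delta> \<and> (deriv f \<longlongrightarrow> 0) (at z within S)}"
  proof (rule finite_subset)
    show "{z \<in> frontier \<Omega>. norm z < 1 \<and> dist z p < \<delta> \<and> (deriv f \<longlongrightarrow> 0) (at z within S)} \<subseteq> (\<lambda>w. p + s * w) ` ?B"
    proof
      fix z assume "z \<in> {z \<in> frontier \<Omega>. norm z < 1 \<and> dist z p < \<delta> \<and> (deriv f \<longlongrightarrow> 0) (at z within S)}"
      then have z: "z \<in> frontier \<Omega>" "norm z < 1" "dist z p < \<delta>" and lim: "(deriv f \<longlongrightarrow> 0) (at z within S)" by auto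
      define q where "q = (z - p) / s"
      have zq: "z = p + s * q" using inv by (simp add: q_def)
      have qd: "norm q < d" "norm q < 1" using small[OF z(3)] by (simp_all add: q_def)
      have near: "dist ((v - p) / s) q < t" if "dist v z < norm s * t" for v t
      proof -
        have "(v - p) / s - q = (v - z) / s" by (simp add: q_def diff_divide_distrib)
        then show ?thesis using that s by (simp add: dist_norm norm_divide pos_divide_less_eq mult.commute)
      qed
      have pull: "(v - p) / s \<in> S'" "f' ((v - p) / s) = f v" if "v \<in> S" for v
        using that inv by (simp_all add: S'_def f'_def)
      have "\<not> (\<exists>t>0. (\<forall>w\<in>S'. dist w q < t \<longrightarrow> 0 < Im (f' w)) \<or> (\<forall>w\<in>S'. dist w q < t \<longrightarrow> Im (f' w) < 0))"
      proof
        assume "\<exists>t>0. (\<forall>w\<in>S'. dist w q < t \<longrightarrow> 0 < Im (f' w)) \<or> (\<forall>w\<in>S'. dist w q < t \<longrightarrow> Im (f' w) < 0)"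
        then obtain t where t: "0 < t"
          "(\<forall>w\<in>S'. dist w q < t \<longrightarrow> 0 < Im (f' w)) \<or> (\<forall>w\<in>S'. dist w q < t \<longrightarrow> Im (f' w) < 0)" by blast
        have st: "0 < norm s * t" using s t by simp
        from t(2) show False
        proof
          assume pos: "\<forall>w\<in>S'. dist w q < t \<longrightarrow> 0 < Im (f' w)"
          have "\<not> (deriv f \<longlongrightarrow> 0) (at z within S)"
            unfolding S_def
          proof (rule hopf_C1_DMO[OF dom z(1,2) f[unfolded S_def] f0[OF z(1,2), unfolded S_def] st])
            fix v assume "v \<in> \<Omega> \<inter> ball 0 1" "dist v z < norm s * t"
            then show "0 < Im (f v)" using pos near pull unfolding S_def by metis
          qed
          with lim show False by blast
        next
          assume neg: "\<forall>w\<in>S'. dist w q < t \<longrightarrow> Im (f' w) < 0"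
          have mf: "(\<lambda>v. - f v) holomorphic_on S" by (intro holomorphic_intros f)
          have mf0: "((\<lambda>v. Im (- f v)) \<longlongrightarrow> 0) (at z within S)"
            using tendsto_minus[OF f0[OF z(1,2)]] by simp
          have "\<not> (deriv (\<lambda>v. - f v) \<longlongrightarrow> 0) (at z within S)"
            unfolding S_def
          proof (rule hopf_C1_DMO[OF dom z(1,2) mf[unfolded S_def] mf0[unfolded S_def] st])
            fix v assume "v \<in> \<Omega> \<inter> ball 0 1" "dist v z < norm s * t"
            then have "Im (f v) < 0" using neg near pull unfolding S_def by metis
            then show "0 < Im (- f v)" by simp
          qed
          moreover have "(deriv (\<lambda>v. - f v) \<longlongrightarrow> 0) (at z within S)"
          proof -
            have ev: "\<forall>\<^sub>F v in at z within S. - deriv f v = deriv (\<lambda>v. - f v) v"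
              unfolding eventually_at_filter
              by (rule always_eventually)
                (auto intro!: DERIV_imp_deriv[symmetric] DERIV_minus holomorphic_derivI[OF f \<open>open S\<close>])
            have "((\<lambda>v. - deriv f v) \<longlongrightarrow> - 0) (at z within S)" by (intro tendsto_minus lim)
            then show ?thesis using tendsto_cong[OF ev] by simp
          qed
          ultimately show False by blast
        qed
      qed
      then have "q \<in> ?B" using qd frS'[OF qd(2)] z(1) zq by blast
      then show "z \<in> (\<lambda>w. p + s * w) ` ?B" using zq by blast
    qed
  qed (use B in simp)
  show thesis by (rule that[OF del 1 2])
qed

theorem theorem1p3:
  fixes \<Omega> :: "complex set" and u :: "complex \<Rightarrow> real"
  assumes "C1_DMO_domain_in (ball 0 1) \<Omega>"
    and "0 \<in> frontier \<Omega>"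
    and "simply_connected (\<Omega> \<inter> ball 0 1)"
    and "dirichlet_solution (ball 0 1) \<Omega> u"
    and "\<exists>z\<in>\<Omega> \<inter> ball 0 1. u z \<noteq> 0"
  shows "emeasure (count_space UNIV)
           (critical_set (\<Omega> \<inter> ball 0 1) u \<inter> closure \<Omega> \<inter> ball 0 (1/2)) < \<infinity>"
proof -
  define S where "S = \<Omega> \<inter> ball 0 1"
  have "open \<Omega>" using assms(1) by (simp add: C1_DMO_domain_in_def)
  then have "open S" by (auto simp: S_def open_Int)
  have sc: "simply_connected S" using assms(3) by (simp add: S_def)
  have conn: "connected S" using sc by (rule simply_connected_imp_connected)
  have harm: "harmonic_on S u" and ucont: "continuous_on (closure \<Omega> \<inter> ball 0 1) u"
    and u0: "\<And>z. z \<in> frontier \<Omega> \<Longrightarrow> norm z < 1 \<Longrightarrow> u z = 0"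
    using assms(4) by (auto simp: dirichlet_solution_def S_def)
  obtain f where f: "f holomorphic_on S" and Imf: "\<And>z. z \<in> S \<Longrightarrow> Im (f z) = u z"
    and df: "\<And>z. z \<in> S \<Longrightarrow> norm (deriv f z) = norm (gradient u z)"
    using harmonic_on_imp_holomorphic[OF \<open>open S\<close> sc harm] by metis
  have f0: "((\<lambda>z. Im (f z)) \<longlongrightarrow> 0) (at z within S)" if z: "z \<in> frontier \<Omega>" "norm z < 1" for z
  proof -
    have "(u \<longlongrightarrow> u z) (at z within closure \<Omega> \<inter> ball 0 1)"
      using ucont z by (auto simp: continuous_on_def frontier_def)
    then have "(u \<longlongrightarrow> 0) (at z within S)"
      unfolding u0[OF z] by (rule tendsto_within_subset) (use closure_subset in \<open>auto simp: S_def\<close>)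
    moreover have "\<forall>\<^sub>F v in at z within S. u v = Im (f v)"
      unfolding eventually_at_filter by (rule always_eventually) (simp add: Imf)
    ultimately show ?thesis using tendsto_cong by fastforce
  qed
  have frS: "z \<in> frontier S \<longleftrightarrow> z \<in> frontier \<Omega>" if "norm z < 1" for z
    using frontier_Int_open[OF \<open>open \<Omega>\<close> open_ball, of z 0 1] that by (simp add: S_def)
  \<comment> \<open>A constant \<open>f\<close> would have imaginary part 0, the limit at the
    frontier point 0, against the nontriviality of \<open>u\<close>.\<close>
  have nc: "\<not> f constant_on S"
  proof
    assume "f constant_on S"
    then obtain a where a: "\<And>z. z \<in> S \<Longrightarrow> f z = a" unfolding constant_on_def by blast
    have "0 \<in> frontier S" using frS[of 0] assms(2) by simp
    then have "0 islimpt S" using \<open>open S\<close> by (auto simp: frontier_def interior_open closure_def)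
    then have nb: "at 0 within S \<noteq> bot" by (simp add: trivial_limit_within)
    have "((\<lambda>z. Im (f z)) \<longlongrightarrow> Im a) (at 0 within S)"
    proof (rule tendsto_eventually)
      show "\<forall>\<^sub>F v in at 0 within S. Im (f v) = Im a"
        unfolding eventually_at_filter by (rule always_eventually) (simp add: a)
    qed
    then have "Im a = 0" using tendsto_unique[OF nb _ f0[OF assms(2)]] by simp
    then show False using assms(5) Imf a unfolding S_def[symmetric] by metis
  qed
  define Cr where "Cr = critical_set S u \<inter> closure \<Omega> \<inter> ball 0 (1/2)"
  \<comment> \<open>The circle of radius 1/2 is included because an accumulation point of
    \<open>Cr\<close> could lie on it; it is still inside \<open>ball 0 1\<close>, where the local
    results apply.\<close>
  have "\<exists>\<delta>>0. finite (Cr \<inter> ball p \<delta>)" if p: "p \<in> closure \<Omega>" "norm p \<le> 1/2" for p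
  proof (cases "p \<in> \<Omega>")
    case True
    then have pS: "p \<in> S" using p by (simp add: S_def)
    then obtain \<delta> where del: "0 < \<delta>" "cball p \<delta> \<subseteq> S" using \<open>open S\<close> open_contains_cball by blast
    have "finite {z \<in> cball p \<delta>. deriv f z = 0}"
    proof (cases "deriv f constant_on S")
      case False
      then show ?thesis
        using del by (intro holomorphic_compact_finite_zeros[OF holomorphic_deriv[OF f \<open>open S\<close>] \<open>open S\<close> conn]) auto
    next
      case True
      then obtain c where c: "\<And>z. z \<in> S \<Longrightarrow> deriv f z = c" unfolding constant_on_def by blast
      have "c \<noteq> 0"
      proof
        assume "c = 0"
        then have D: "(f has_field_derivative 0) (at z)" if "z \<in> S" for z
          using holomorphic_derivI[OF f \<open>open S\<close> that, of UNIV] c[OF that] by simp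
        have "(f has_derivative (\<lambda>h. 0)) (at z)" if "z \<in> S" for z
          by (rule has_derivative_eq_rhs[OF has_field_derivative_imp_has_derivative[OF D[OF that]]])
            (simp add: fun_eq_iff)
        then have "f z = f p" if "z \<in> S" for z
          using has_derivative_zero_unique_connected[OF \<open>open S\<close> conn] pS that by blast
        then show False using nc unfolding constant_on_def by blast
      qed
      then have "{z \<in> cball p \<delta>. deriv f z = 0} = {}" using c del(2) by auto
      then show ?thesis by (metis finite.emptyI)
    qed
    moreover have "Cr \<inter> ball p \<delta> \<subseteq> {z \<in> cball p \<delta>. deriv f z = 0}"
    proof
      fix z assume z: "z \<in> Cr \<inter> ball p \<delta>"
      then have "z \<in> S" using del(2) by auto
      moreover from this have "z \<notin> frontier S" using \<open>open S\<close> by (simp add: frontier_def interior_open)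
      ultimately have "gradient u z = 0" using z by (auto simp: Cr_def critical_set_def)
      then show "z \<in> {z \<in> cball p \<delta>. deriv f z = 0}" using df[OF \<open>z \<in> S\<close>] z by simp
    qed
    ultimately show ?thesis using del(1) finite_subset by blast
  next
    case False
    then have pf: "p \<in> frontier \<Omega>" "norm p < 1" using p \<open>open \<Omega>\<close> by (auto simp: frontier_def interior_open)
    obtain \<delta> where del: "0 < \<delta>" "finite {z \<in> S. dist z p < \<delta> \<and> deriv f z = 0}" (is "finite ?A")
      "finite {z \<in> frontier \<Omega>. norm z < 1 \<and> dist z p < \<delta> \<and> (deriv f \<longlongrightarrow> 0) (at z within S)}" (is "finite ?B")
      by (rule finite_critical_near_frontier[OF assms(1) pf, folded S_def, OF sc f nc f0]) blast+
    have "Cr \<inter> ball p \<delta> \<subseteq> ?A \<union> ?B"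
    proof
      fix z assume z: "z \<in> Cr \<inter> ball p \<delta>"
      then have zd: "dist z p < \<delta>" "norm z < 1" by (auto simp: Cr_def dist_commute)
      from z consider "z \<in> S" "gradient u z = 0" | "z \<in> frontier S" "(gradient u \<longlongrightarrow> 0) (at z within S)"
        unfolding Cr_def critical_set_def by blast
      then show "z \<in> ?A \<union> ?B"
      proof cases
        case 1
        then show ?thesis using df[of z] zd by simp
      next
        case 2
        have "((\<lambda>v. norm (gradient u v)) \<longlongrightarrow> 0) (at z within S)"
          using tendsto_norm[OF 2(2)] by simp
        moreover have "\<forall>\<^sub>F v in at z within S. norm (gradient u v) = norm (deriv f v)"
          unfolding eventually_at_filter by (rule always_eventually) (simp add: df)
        ultimately have "((\<lambda>v. norm (deriv f v)) \<longlongrightarrow> 0) (at z within S)"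
          using tendsto_cong by fastforce
        then have "(deriv f \<longlongrightarrow> 0) (at z within S)" by (rule tendsto_norm_zero_cancel)
        then show ?thesis using frS[OF zd(2)] 2(1) zd by simp
      qed
    qed
    then have "finite (Cr \<inter> ball p \<delta>)" by (rule finite_subset) (use del in simp)
    then show ?thesis using del(1) by blast
  qed
  note loc = this
  have "finite Cr"
  proof (rule ccontr)
    assume inf: "infinite Cr"
    have "compact (closure \<Omega> \<inter> cball 0 (1/2))" by (intro closed_Int_compact) auto
    moreover have "Cr \<subseteq> closure \<Omega> \<inter> cball 0 (1/2)" by (auto simp: Cr_def)
    ultimately obtain p where p: "p \<in> closure \<Omega> \<inter> cball 0 (1/2)" "p islimpt Cr"
      using inf unfolding compact_eq_Bolzano_Weierstrass by blast
    then obtain \<delta> where "0 < \<delta>" "finite (Cr \<inter> ball p \<delta>)" using loc[of p] by auto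
    then show False using p(2) unfolding islimpt_eq_infinite_ball by blast
  qed
  then show ?thesis unfolding Cr_def S_def by (simp add: of_nat_less_top)
qed

end
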